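(* Let $c$ be a piecewise constant, strictly positive function of time with finitely many jumps, located at times $0<t_1<\dots<t_m$ (for instance $c(t)=c_0+(c_1-c_0)H(t-1)$ with $c_0,c_1>0$), and let $u_0,u_1\in\mathcal{D}'(\mathbb{R})$. Let $U\in\mathcal{G}([0,\infty)\times\mathbb{R})$ be the corresponding generalized solution, i.e. the unique solution of $$\partial_t^2U - C^2\partial_x^2U = 0 \ \text{ in } \mathcal{G}([0,\infty)\times\mathbb{R}),\qquad U|_{t = 0} = U_0,\quad \partial_tU|_{t = 0} = U_1 \ \text{ in } \mathcal{G}(\mathbb{R}),$$ where $C$ is the class of $(c*\varphi_\varepsilon)_{\varepsilon\in(0,1]}$ and $U_0$, $U_1$ are the classes of $(u_0*\psi_\varepsilon)_{\varepsilon\in(0,1]}$ and $(u_1*\psi_\varepsilon)_{\varepsilon\in(0,1]}$, with mollifiers $\varphi,\psi$ as in the context. Then $U$ is associated with the piecewise distributional solution $u$ of the transmission problem for $\partial_t^2u-c(t)^2\partial_x^2u=0$, $u|_{t=0}=u_0$, $\partial_tu|_{t=0}=u_1$ (as defined in the context).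
   Context: Mollifiers: $\varphi\in\mathcal{C}^\infty_0(\mathbb{R})$ is symmetric (even), with $\varphi'\ge 0$ on $[-1,0]$, $\operatorname{supp}\varphi\subset[-1,1]$ and $\int_{\mathbb{R}}\varphi=1$; $\psi\in\mathcal{C}_0^\infty(\mathbb{R})$ is a compactly supported mollifier with $\int_{\mathbb{R}}\psi=1$. Notation: $\varphi_\varepsilon(x)=\varepsilon^{-1}\varphi(x/\varepsilon)$, and likewise $\psi_\varepsilon$. For the convolution, $c$ is extended to $t<0$ by its constant value on $(0,t_1)$. Functions of $t$ only are regarded as functions of $(t,x)$. $H$ is the Heaviside function. Colombeau algebra. Let $X$ be a non-empty open subset of $\mathbb{R}^d$, or $X=[0,\infty)\times\mathbb{R}$ (in which case $\mathcal{C}^\infty(X)$ denotes functions smooth up to the boundary). Let $\mathcal{E}_M(X)$ be the set of families $(u^\varepsilon)_{\varepsilon\in(0,1]}$ of real-valued functions in $\mathcal{C}^\infty(X)$ such that for every compact $K\subset X$ and every multi-index $\alpha$ there is $p\ge 0$ with $\sup_{K}|\partial^\alpha u^\varepsilon| = O(\varepsilon^{-p})$ as $\varepsilon\downarrow 0$. Let $\mathcal{N}(X)$ be the set of families such that for every compact $K\subset X$, every $\alpha$ and every $q\ge 0$, $\sup_{K}|\partial^\alpha u^\varepsilon| = O(\varepsilon^{q})$ as $\varepsilon\downarrow 0$. Then $\mathcal{G}(X)=\mathcal{E}_M(X)/\mathcal{N}(X)$. Derivatives, products and restrictions are defined on representatives. Under the hypotheses of the claim the Cauchy problem has exactly one solution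 $U\in\mathcal{G}([0,\infty)\times\mathbb{R})$. Association. $U$ is associated with a distribution $w\in\mathcal{D}'(\Omega)$ on an open set $\Omega$ if it has a representative $(u^\varepsilon)_\varepsilon$ with $u^\varepsilon\to w$ in $\mathcal{D}'(\Omega)$ as $\varepsilon\downarrow0$; here $\Omega=(0,\infty)\times\mathbb{R}$, and $u\in\mathcal{C}([0,\infty):\mathcal{D}'(\mathbb{R}))$ is identified with the distribution $\theta\mapsto\int_0^\infty\langle u(t),\theta(t,\cdot)\rangle\,dt$. Piecewise distributional solution. With $t_0=0$, $t_{m+1}=\infty$, it is the unique $u\in\mathcal{C}^1([0,\infty):\mathcal{D}'(\mathbb{R}))$ whose restriction to each interval $(t_j,t_{j+1})$, $0\le j\le m$, belongs to $\mathcal{C}^2((t_j,t_{j+1}):\mathcal{D}'(\mathbb{R}))$ and satisfies $\partial_t^2u-c(t)^2\partial_x^2u=0$ there, and which satisfies $u|_{t=0}=u_0$, $\partial_tu|_{t=0}=u_1$. (It is obtained by solving the wave equation successively on the intervals, taking the terminal values of $u$ and $\partial_t u$ at each $t_j$ as initial values for the next interval.) In the case of a single jump at $t=1$ this means $u\in\mathcal{C}^1([0,\infty):\mathcal{D}'(\mathbb{R}))\cap\big(\mathcal{C}^2((0,1):\mathcal{D}'(\mathbb{R}))\oplus\mathcal{C}^2((1,\infty):\mathcal{D}'(\mathbb{R}))\big)$. *)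

theory Defs
  imports "HOL-Analysis.Analysis" "HOL-Library.Landau_Symbols"
begin

section \<open>Smooth functions on a set\<close>

text \<open>
  The derivative in direction \<open>b\<close> is taken relative to \<open>X\<close>. For open \<open>X\<close> it is the usual partial
  derivative; for \<open>X = [0,\<infinity>) \<times> \<real>\<close> it is one-sided in time at \<open>t = 0\<close>, so that \<open>smooth_on X\<close>
  below means smooth up to the boundary. At points of \<open>X\<close> only the values of \<open>f\<close> on \<open>X\<close> enter.
\<close>

definition partial_deriv :: "'a::euclidean_space set \<Rightarrow> 'a \<Rightarrow> ('a \<Rightarrow> real) \<Rightarrow> 'a \<Rightarrow> real" where
  "partial_deriv X b f x =
     vector_derivative (\<lambda>h. f (x + h *\<^sub>R b)) (at 0 within {h. x + h *\<^sub>R b \<in> X})"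

text \<open>A multi-index is given as a list of basis directions; its order is the length of the list.\<close>

definition multi_indices :: "'a::euclidean_space list set" where
  "multi_indices = {\<alpha>. set \<alpha> \<subseteq> Basis}"

definition iter_deriv :: "'a::euclidean_space set \<Rightarrow> 'a list \<Rightarrow> ('a \<Rightarrow> real) \<Rightarrow> 'a \<Rightarrow> real" where
  "iter_deriv X \<alpha> f = foldr (partial_deriv X) \<alpha> f"

definition smooth_on :: "'a::euclidean_space set \<Rightarrow> ('a \<Rightarrow> real) \<Rightarrow> bool" where
  "smooth_on X f \<longleftrightarrow>
     (\<forall>\<alpha>\<in>multi_indices.
        continuous_on X (iter_deriv X \<alpha> f) \<and>
        (\<forall>b\<in>Basis. \<forall>x\<in>X. (\<lambda>h. iter_deriv X \<alpha> f (x + h *\<^sub>R b))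
             differentiable (at 0 within {h. x + h *\<^sub>R b \<in> X})))"


section \<open>Distributions\<close>

definition supp :: "('a::euclidean_space \<Rightarrow> real) \<Rightarrow> 'a set" where
  "supp f = closure {x. f x \<noteq> 0}"

definition test_functions :: "'a::euclidean_space set \<Rightarrow> ('a \<Rightarrow> real) set" where
  "test_functions \<Omega> = {\<theta>. smooth_on UNIV \<theta> \<and> compact (supp \<theta>) \<and> supp \<theta> \<subseteq> \<Omega>}"

text \<open>
  Real distributions on \<open>\<Omega>\<close> are total functionals of which only the values on test functions
  matter; accordingly, equality of distributions means agreement on test functions.
  Continuity is the usual seminorm estimate on each compact set.
\<close>

type_synonym 'a functional = "('a \<Rightarrow> real) \<Rightarrow> real"

definition distributions :: "'a::euclidean_space set \<Rightarrow> 'a functional set" where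
  "distributions \<Omega> = {w.
     (\<forall>\<theta>\<in>test_functions \<Omega>. \<forall>\<eta>\<in>test_functions \<Omega>. w (\<lambda>x. \<theta> x + \<eta> x) = w \<theta> + w \<eta>) \<and>
     (\<forall>\<theta>\<in>test_functions \<Omega>. \<forall>r. w (\<lambda>x. r * \<theta> x) = r * w \<theta>) \<and>
     (\<forall>K. compact K \<and> K \<subseteq> \<Omega> \<longrightarrow>
        (\<exists>M N. \<forall>\<theta>\<in>test_functions \<Omega>. supp \<theta> \<subseteq> K \<longrightarrow>
           \<bar>w \<theta>\<bar> \<le> M * (\<Sum>\<alpha>\<in>{\<alpha>\<in>multi_indices. length \<alpha> \<le> N}. SUP x. \<bar>iter_deriv UNIV \<alpha> \<theta> x\<bar>)))}"

definition distr_eq :: "'a::euclidean_space set \<Rightarrow> 'a functional \<Rightarrow> 'a functional \<Rightarrow> bool" where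
  "distr_eq \<Omega> v w \<longleftrightarrow> (\<forall>\<theta>\<in>test_functions \<Omega>. v \<theta> = w \<theta>)"

definition distr_deriv :: "'a::euclidean_space \<Rightarrow> 'a functional \<Rightarrow> 'a functional" where
  "distr_deriv b w = (\<lambda>\<theta>. - w (partial_deriv UNIV b \<theta>))"

text \<open>
  Curves in \<open>\<D>'(\<real>)\<close>: continuity and differentiability refer to the weak topology. Since weakly and
  strongly convergent sequences of distributions coincide, the strong topology yields the same
  classes \<open>C\<^sup>k(I : \<D>'(\<real>))\<close>.
\<close>

definition time_deriv :: "real set \<Rightarrow> (real \<Rightarrow> real functional) \<Rightarrow> real \<Rightarrow> real functional" where
  "time_deriv I u t = (\<lambda>\<theta>. vector_derivative (\<lambda>s. u s \<theta>) (at t within I))"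

primrec Ck_distr :: "nat \<Rightarrow> real set \<Rightarrow> (real \<Rightarrow> real functional) \<Rightarrow> bool" where
  "Ck_distr 0 I u \<longleftrightarrow>
     (\<forall>t\<in>I. u t \<in> distributions UNIV) \<and>
     (\<forall>\<theta>\<in>test_functions UNIV. continuous_on I (\<lambda>t. u t \<theta>))"
| "Ck_distr (Suc k) I u \<longleftrightarrow>
     (\<forall>t\<in>I. u t \<in> distributions UNIV) \<and>
     (\<forall>\<theta>\<in>test_functions UNIV. \<forall>t\<in>I. (\<lambda>s. u s \<theta>) differentiable (at t within I)) \<and>
     Ck_distr k I (time_deriv I u)"

definition curve_distr :: "(real \<Rightarrow> real functional) \<Rightarrow> (real \<times> real) functional" where
  "curve_distr u = (\<lambda>\<theta>. LINT t:{0<..}|lborel. u t (\<lambda>x. \<theta> (t, x)))"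


section \<open>Colombeau algebras\<close>

type_synonym 'a family = "real \<Rightarrow> 'a \<Rightarrow> real"

definition moderate :: "'a::euclidean_space set \<Rightarrow> 'a family set" where
  "moderate X = {u.
     (\<forall>\<epsilon>\<in>{0<..1}. smooth_on X (u \<epsilon>)) \<and>
     (\<forall>K. compact K \<and> K \<noteq> {} \<and> K \<subseteq> X \<longrightarrow> (\<forall>\<alpha>\<in>multi_indices. \<exists>p\<ge>0.
        (\<lambda>\<epsilon>. SUP x\<in>K. \<bar>iter_deriv X \<alpha> (u \<epsilon>) x\<bar>) \<in> O[at_right 0](\<lambda>\<epsilon>. \<epsilon> powr (- p))))}"

definition negligible_families :: "'a::euclidean_space set \<Rightarrow> 'a family set" where
  "negligible_families X = {u.
     (\<forall>\<epsilon>\<in>{0<..1}. smooth_on X (u \<epsilon>)) \<and>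
     (\<forall>K. compact K \<and> K \<noteq> {} \<and> K \<subseteq> X \<longrightarrow> (\<forall>\<alpha>\<in>multi_indices. \<forall>q\<ge>0.
        (\<lambda>\<epsilon>. SUP x\<in>K. \<bar>iter_deriv X \<alpha> (u \<epsilon>) x\<bar>) \<in> O[at_right 0](\<lambda>\<epsilon>. \<epsilon> powr q)))}"

definition colombeau_rel :: "'a::euclidean_space set \<Rightarrow> ('a family \<times> 'a family) set" where
  "colombeau_rel X = {(u, v). u \<in> moderate X \<and> v \<in> moderate X \<and>
     (\<lambda>\<epsilon> x. u \<epsilon> x - v \<epsilon> x) \<in> negligible_families X}"

type_synonym 'a gen_fun = "'a family set"

definition colombeau :: "'a::euclidean_space set \<Rightarrow> 'a gen_fun set" where
  "colombeau X = moderate X // colombeau_rel X"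

definition gclass :: "'a::euclidean_space set \<Rightarrow> 'a family \<Rightarrow> 'a gen_fun" where
  "gclass X u = colombeau_rel X `` {u}"

definition gdiff :: "'a::euclidean_space set \<Rightarrow> 'a gen_fun \<Rightarrow> 'a gen_fun \<Rightarrow> 'a gen_fun" where
  "gdiff X U V = (\<Union>u\<in>U. \<Union>v\<in>V. gclass X (\<lambda>\<epsilon> x. u \<epsilon> x - v \<epsilon> x))"

definition gmult :: "'a::euclidean_space set \<Rightarrow> 'a gen_fun \<Rightarrow> 'a gen_fun \<Rightarrow> 'a gen_fun" where
  "gmult X U V = (\<Union>u\<in>U. \<Union>v\<in>V. gclass X (\<lambda>\<epsilon> x. u \<epsilon> x * v \<epsilon> x))"

definition gderiv :: "'a::euclidean_space set \<Rightarrow> 'a \<Rightarrow> 'a gen_fun \<Rightarrow> 'a gen_fun" where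
  "gderiv X b U = (\<Union>u\<in>U. gclass X (\<lambda>\<epsilon>. partial_deriv X b (u \<epsilon>)))"

definition grestrict0 :: "(real \<times> real) gen_fun \<Rightarrow> real gen_fun" where
  "grestrict0 U = (\<Union>u\<in>U. gclass UNIV (\<lambda>\<epsilon> x. u \<epsilon> (0, x)))"

definition associated ::
    "'a::euclidean_space set \<Rightarrow> 'a gen_fun \<Rightarrow> 'a functional \<Rightarrow> bool" where
  "associated \<Omega> U w \<longleftrightarrow> w \<in> distributions \<Omega> \<and>
     (\<exists>u\<in>U. \<forall>\<theta>\<in>test_functions \<Omega>.
        ((\<lambda>\<epsilon>. LINT p:\<Omega>|lborel. u \<epsilon> p * \<theta> p) \<longlongrightarrow> w \<theta>) (at_right 0))"


section \<open>The wave equation with piecewise constant speed\<close>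

definition scaled :: "(real \<Rightarrow> real) \<Rightarrow> real \<Rightarrow> real \<Rightarrow> real" where
  "scaled \<rho> \<epsilon> x = \<rho> (x / \<epsilon>) / \<epsilon>"

definition conv :: "(real \<Rightarrow> real) \<Rightarrow> (real \<Rightarrow> real) \<Rightarrow> real \<Rightarrow> real" where
  "conv f g t = (LINT s|lborel. f s * g (t - s))"

definition distr_conv :: "real functional \<Rightarrow> (real \<Rightarrow> real) \<Rightarrow> real \<Rightarrow> real" where
  "distr_conv w g x = w (\<lambda>y. g (x - y))"

text \<open>The interval \<open>(t\<^sub>j, t\<^sub>j\<^sub>+\<^sub>1)\<close> for \<open>j \<le> m\<close>, with \<open>t\<^sub>m\<^sub>+\<^sub>1 = \<infinity>\<close>.\<close>

definition piece :: "nat \<Rightarrow> (nat \<Rightarrow> real) \<Rightarrow> nat \<Rightarrow> real set" where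
  "piece m \<tau> j = {t. \<tau> j < t \<and> (j < m \<longrightarrow> t < \<tau> (Suc j))}"

text \<open>
  The speed \<open>c\<close> on \<open>[0,\<infinity>)\<close> has its jumps at \<open>0 < \<tau> 1 < \<dots> < \<tau> m\<close> and takes the value \<open>a j\<close> on the
  \<open>j\<close>-th piece; its values at \<open>0\<close> and at the jumps are only required to be positive.
\<close>

definition piecewise_constant_speed ::
    "nat \<Rightarrow> (nat \<Rightarrow> real) \<Rightarrow> (nat \<Rightarrow> real) \<Rightarrow> (real \<Rightarrow> real) \<Rightarrow> bool" where
  "piecewise_constant_speed m \<tau> a c \<longleftrightarrow>
     \<tau> 0 = 0 \<and> (\<forall>j<m. \<tau> j < \<tau> (Suc j)) \<and>
     (\<forall>t\<ge>0. c t > 0) \<and>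
     (\<forall>j\<le>m. \<forall>t\<in>piece m \<tau> j. c t = a j) \<and>
     (\<forall>j<m. a j \<noteq> a (Suc j))"

abbreviation half_space :: "(real \<times> real) set" where
  "half_space \<equiv> {0..} \<times> UNIV"

text \<open>\<open>a0\<close> is the value of \<open>c\<close> on \<open>(0, t\<^sub>1)\<close>, by which \<open>c\<close> is extended to negative times.\<close>

definition gen_speed :: "(real \<Rightarrow> real) \<Rightarrow> real \<Rightarrow> (real \<Rightarrow> real) \<Rightarrow> (real \<times> real) gen_fun" where
  "gen_speed \<phi> a0 c =
     gclass half_space (\<lambda>\<epsilon> (t, x). conv (\<lambda>s. if s < 0 then a0 else c s) (scaled \<phi> \<epsilon>) t)"

definition gen_data :: "(real \<Rightarrow> real) \<Rightarrow> real functional \<Rightarrow> real gen_fun" where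
  "gen_data \<psi> w = gclass UNIV (\<lambda>\<epsilon>. distr_conv w (scaled \<psi> \<epsilon>))"

abbreviation gdt :: "(real \<times> real) gen_fun \<Rightarrow> (real \<times> real) gen_fun" where
  "gdt \<equiv> gderiv half_space (1, 0)"

abbreviation gdx :: "(real \<times> real) gen_fun \<Rightarrow> (real \<times> real) gen_fun" where
  "gdx \<equiv> gderiv half_space (0, 1)"

definition generalized_solution ::
    "(real \<times> real) gen_fun \<Rightarrow> real gen_fun \<Rightarrow> real gen_fun \<Rightarrow> (real \<times> real) gen_fun \<Rightarrow> bool" where
  "generalized_solution C U0 U1 U \<longleftrightarrow>
     U \<in> colombeau half_space \<and>
     gdiff half_space (gdt (gdt U)) (gmult half_space (gmult half_space C C) (gdx (gdx U)))
       = gclass half_space (\<lambda>\<epsilon> p. 0) \<and>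
     grestrict0 U = U0 \<and>
     grestrict0 (gdt U) = U1"

definition piecewise_distributional_solution ::
    "nat \<Rightarrow> (nat \<Rightarrow> real) \<Rightarrow> (real \<Rightarrow> real) \<Rightarrow> real functional \<Rightarrow> real functional
      \<Rightarrow> (real \<Rightarrow> real functional) \<Rightarrow> bool" where
  "piecewise_distributional_solution m \<tau> c u0 u1 u \<longleftrightarrow>
     Ck_distr 1 {0..} u \<and>
     (\<forall>j\<le>m. Ck_distr 2 (piece m \<tau> j) u \<and>
        (\<forall>t\<in>piece m \<tau> j.
           distr_eq UNIV
             (\<lambda>\<theta>. time_deriv (piece m \<tau> j) (time_deriv (piece m \<tau> j) u) t \<theta>
                  - (c t)\<^sup>2 * distr_deriv 1 (distr_deriv 1 (u t)) \<theta>)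
             (\<lambda>\<theta>. 0))) \<and>
     distr_eq UNIV (u 0) u0 \<and>
     distr_eq UNIV (time_deriv {0..} u 0) u1"

definition speed_mollifier :: "(real \<Rightarrow> real) \<Rightarrow> bool" where
  "speed_mollifier \<phi> \<longleftrightarrow>
     \<phi> \<in> test_functions UNIV \<and> (\<forall>x. \<phi> (- x) = \<phi> x) \<and> (\<forall>x\<in>{-1..0}. deriv \<phi> x \<ge> 0) \<and>
     supp \<phi> \<subseteq> {-1..1} \<and> (LINT x|lborel. \<phi> x) = 1"

definition data_mollifier :: "(real \<Rightarrow> real) \<Rightarrow> bool" where
  "data_mollifier \<psi> \<longleftrightarrow> \<psi> \<in> test_functions UNIV \<and> (LINT x|lborel. \<psi> x) = 1"

end

theory Submission
  imports Defs
begin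

text \<open>
  The equation is tested in space only, so that a solution becomes a curve of functionals
  \<open>s \<mapsto> \<langle>u(s), \<eta>\<rangle>\<close>. On an interval where the speed is \<open>a\<close>, the functional \<open>\<langle>\<partial>\<^sub>t u + a \<partial>\<^sub>x u, \<eta>\<rangle>\<close> is
  constant along the characteristics, so all estimates only need translates and derivatives of \<open>\<eta>\<close>.

  Let \<open>D\<close> be the difference of the regularised and the piecewise distributional solution. It solves
  the wave equation with the piecewise constant speed \<open>c\<close> up to the error \<open>(c\<^sub>\<epsilon>\<^sup>2 - c\<^sup>2) \<partial>\<^sub>x\<^sup>2 u\<^sub>\<epsilon>\<close>, which
  lives on a set of times of measure \<open>O(\<epsilon>)\<close>, and a negligible term. Hence a bound \<open>D = O(q(\<epsilon>))\<close> with
  \<open>q \<ge> 1\<close>, uniform on bounded sets of test functions, improves to \<open>D = O(\<epsilon> q(\<epsilon>))\<close>; the two lost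
  derivatives are harmless because they fall on the test function. Moderateness provides the start
  \<open>q = \<epsilon>\<^sup>-\<^sup>p\<close>, and finitely many steps give \<open>D = O(\<epsilon>)\<close>. Neither energy estimates nor an existence
  theory for the regularised equation are used.

  That \<open>\<langle>u(s), \<eta>\<^sub>s\<rangle>\<close> may be differentiated for a moving test function \<open>\<eta>\<^sub>s\<close> rests on the uniform
  boundedness principle, since \<open>u\<close> is only weakly differentiable in time.
\<close>

section \<open>Test functions and distributions on the line\<close>

text \<open>Why the iteration closes: the error acts on \<open>P = D + u\<close>, and
  \<open>u\<close> is bounded on bounded sets, so for \<open>q \<ge> 1\<close> a rate
  \<open>q\<close> of \<open>D\<close> is also one of \<open>P\<close>. Differentiating test
  functions replaces one bounded set by another; therefore every estimate is stated for all
  sequences \<open>A\<close> of derivative bounds, and the starting exponent must not depend on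
  \<open>A\<close>. It does not, because testing in space uses only the values of a moderate family:
  its supremum on one slab serves all test functions.

  The jumps shape the rest. The factor \<open>\<epsilon>\<close> comes from integrating a multiple
  of \<open>q\<close> over layers of length \<open>\<epsilon>\<close> at the ends of a piece, so the
  pieces are treated in succession, and both \<open>D\<close> and \<open>D'\<close> have to be
  handed over at a jump. Characteristics control \<open>D\<close> and a combination
  \<open>z\<close>; \<open>D'\<close> is recovered from these at the price of one more derivative of
  the test function.

  Each \<open>u s\<close> has finite order on a ball, but a priori this order varies with
  \<open>s\<close>. Uniform boundedness also supplies one order and one constant for a compact time
  interval.\<close>

abbreviation dv :: "nat \<Rightarrow> (real \<Rightarrow> real) \<Rightarrow> real \<Rightarrow> real" where
  "dv k f \<equiv> (deriv ^^ k) f"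

text \<open>The smooth functions supported in \<open>[-R, R]\<close>. The radius is a parameter
  because order bounds hold ball by ball, and because in a cone of dependence it changes with
  time.\<close>

definition tests :: "real \<Rightarrow> (real \<Rightarrow> real) set" where
  "tests R = {\<eta>. (\<forall>k x. (dv k \<eta> has_real_derivative dv (Suc k) \<eta> x) (at x)) \<and> (\<forall>x. \<bar>x\<bar> > R \<longrightarrow> \<eta> x = 0)}"

text \<open>Exhibiting a candidate chain \<open>D\<close> of derivatives determines the iterated
  \<open>deriv\<close> for all orders at once. The closure properties of \<open>tests\<close> rest
  on such chains.\<close>

lemma dv_eqI:
  assumes "\<And>x. f x = D 0 x" "\<And>k x. (D k has_real_derivative D (Suc k) x) (at x)"
  shows "dv k f = D k"
proof -
  have "f = D 0" using assms(1) by auto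
  then show ?thesis
  proof (induction k)
    case (Suc k)
    then have "dv (Suc k) f = deriv (D k)" by simp
    also have "\<dots> = D (Suc k)" using DERIV_imp_deriv[OF assms(2)] by auto
    finally show ?case .
  qed simp
qed

lemma testsI:
  assumes "\<And>x. f x = D 0 x" "\<And>k x. (D k has_real_derivative D (Suc k) x) (at x)"
    "\<And>x. \<bar>x\<bar> > R \<Longrightarrow> f x = 0"
  shows "f \<in> tests R"
  unfolding tests_def using assms(2,3) dv_eqI[of f D, OF assms(1,2)] by (simp del: funpow.simps)

lemma tests_DERIV: "\<eta> \<in> tests R \<Longrightarrow> (dv k \<eta> has_real_derivative dv (Suc k) \<eta> x) (at x)"
  unfolding tests_def by blast

lemma tests_zero: "\<eta> \<in> tests R \<Longrightarrow> \<bar>x\<bar> > R \<Longrightarrow> \<eta> x = 0"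
  unfolding tests_def by blast

lemma tests_mono: "\<eta> \<in> tests R \<Longrightarrow> R \<le> R' \<Longrightarrow> \<eta> \<in> tests R'"
  unfolding tests_def by (simp del: funpow.simps)

lemma tests_cont: "\<eta> \<in> tests R \<Longrightarrow> continuous_on S (dv k \<eta>)"
  by (meson DERIV_continuous continuous_at_imp_continuous_on tests_DERIV)

lemma tests_cont0: "\<eta> \<in> tests R \<Longrightarrow> continuous_on S \<eta>"
  using tests_cont[of \<eta> R S 0] by simp

lemma dv_add:
  assumes "\<eta> \<in> tests R" "\<zeta> \<in> tests R'"
  shows "dv k (\<lambda>x. \<eta> x + \<zeta> x) = (\<lambda>x. dv k \<eta> x + dv k \<zeta> x)"
  by (rule dv_eqI[where D="\<lambda>k x. dv k \<eta> x + dv k \<zeta> x"])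
     (simp, intro DERIV_add tests_DERIV[OF assms(1)] tests_DERIV[OF assms(2)])

lemma tests_add:
  assumes "\<eta> \<in> tests R" "\<zeta> \<in> tests R"
  shows "(\<lambda>x. \<eta> x + \<zeta> x) \<in> tests R"
proof (rule testsI[where D="\<lambda>k x. dv k \<eta> x + dv k \<zeta> x"])
  show "((\<lambda>x. dv k \<eta> x + dv k \<zeta> x) has_real_derivative dv (Suc k) \<eta> x + dv (Suc k) \<zeta> x) (at x)" for k x
    by (intro DERIV_add tests_DERIV[OF assms(1)] tests_DERIV[OF assms(2)])
qed (use tests_zero[OF assms(1)] tests_zero[OF assms(2)] in simp_all)

lemma dv_scale:
  assumes "\<eta> \<in> tests R"
  shows "dv k (\<lambda>x. r * \<eta> x) = (\<lambda>x. r * dv k \<eta> x)"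
  by (rule dv_eqI[where D="\<lambda>k x. r * dv k \<eta> x"])
     (simp, intro DERIV_cmult tests_DERIV[OF assms(1)])

lemma tests_scale:
  assumes "\<eta> \<in> tests R"
  shows "(\<lambda>x. r * \<eta> x) \<in> tests R"
proof (rule testsI[where D="\<lambda>k x. r * dv k \<eta> x"])
  show "((\<lambda>x. r * dv k \<eta> x) has_real_derivative r * dv (Suc k) \<eta> x) (at x)" for k x
    by (intro DERIV_cmult tests_DERIV[OF assms(1)])
qed (use tests_zero[OF assms(1)] in simp_all)

lemma dv_diff:
  assumes "\<eta> \<in> tests R" "\<zeta> \<in> tests R'"
  shows "dv k (\<lambda>x. \<eta> x - \<zeta> x) = (\<lambda>x. dv k \<eta> x - dv k \<zeta> x)"
  by (rule dv_eqI[where D="\<lambda>k x. dv k \<eta> x - dv k \<zeta> x"])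
     (simp, intro DERIV_diff tests_DERIV[OF assms(1)] tests_DERIV[OF assms(2)])

lemma tests_diff:
  assumes "\<eta> \<in> tests R" "\<zeta> \<in> tests R"
  shows "(\<lambda>x. \<eta> x - \<zeta> x) \<in> tests R"
  using tests_add[OF assms(1) tests_scale[OF assms(2), of "-1"]] by simp

lemma DERIV_shift_arg:
  "(f has_real_derivative D) (at (x + y)) \<Longrightarrow> ((\<lambda>x. f (x + y)) has_real_derivative D) (at x)"
  for f :: "real \<Rightarrow> real"
  using DERIV_shift[of f D x y] by (simp add: add.commute)

lemma dv_shift:
  assumes "\<eta> \<in> tests R"
  shows "dv k (\<lambda>x. \<eta> (x + y)) = (\<lambda>x. dv k \<eta> (x + y))"
  by (rule dv_eqI[where D="\<lambda>k x. dv k \<eta> (x + y)"])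
     (simp, rule DERIV_shift_arg, rule tests_DERIV[OF assms(1)])

lemma tests_shift:
  assumes "\<eta> \<in> tests R" "R + \<bar>y\<bar> \<le> R'"
  shows "(\<lambda>x. \<eta> (x + y)) \<in> tests R'"
proof (rule testsI[where D="\<lambda>k x. dv k \<eta> (x + y)"])
  show "((\<lambda>x. dv k \<eta> (x + y)) has_real_derivative dv (Suc k) \<eta> (x + y)) (at x)" for k x
    by (rule DERIV_shift_arg, rule tests_DERIV[OF assms(1)])
qed (use tests_zero[OF assms(1)] assms(2) in simp_all)

lemma dv_dv: "dv j (dv k \<eta>) = dv (j + k) \<eta>"
  by (simp add: funpow_add)

lemma tests_dv_zero:
  assumes "\<eta> \<in> tests R" "\<bar>x\<bar> > R"
  shows "dv k \<eta> x = 0"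
  using assms(2)
proof (induction k arbitrary: x)
  case 0
  then show ?case using tests_zero[OF assms(1)] by simp
next
  case (Suc k)
  have "(dv k \<eta> has_real_derivative 0) (at x)"
  proof (rule has_field_derivative_transform_within_open[where f="\<lambda>x. 0" and S="{x. \<bar>x\<bar> > R}"])
    show "open {x::real. \<bar>x\<bar> > R}" by (intro open_Collect_less continuous_intros)
  qed (use Suc in auto)
  then show ?case by (simp add: DERIV_imp_deriv)
qed

lemma tests_dv:
  assumes "\<eta> \<in> tests R"
  shows "dv k \<eta> \<in> tests R"
proof (rule testsI[where D="\<lambda>j. dv (j + k) \<eta>"])
  show "(dv (j + k) \<eta> has_real_derivative dv (Suc j + k) \<eta> x) (at x)" for j x
    using tests_DERIV[OF assms, of "j+k" x] by simp
qed (use tests_dv_zero[OF assms] in simp_all)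

lemma tests_bounded:
  assumes "\<eta> \<in> tests R"
  shows "\<exists>A. \<forall>x. \<bar>dv k \<eta> x\<bar> \<le> A"
proof -
  have "compact (dv k \<eta> ` {-R..R})"
    by (intro compact_continuous_image tests_cont[OF assms] compact_Icc)
  then have "bounded (dv k \<eta> ` {-R..R})" by (rule compact_imp_bounded)
  then obtain A where A: "\<forall>x\<in>{-R..R}. \<bar>dv k \<eta> x\<bar> \<le> A"
    unfolding bounded_iff by auto
  have "\<bar>dv k \<eta> x\<bar> \<le> max A 0" for x
  proof (cases "\<bar>x\<bar> \<le> R")
    case True then have "x \<in> {-R..R}" by auto
    then show ?thesis using A by fastforce
  next
    case False then show ?thesis using tests_dv_zero[OF assms, of x k] by auto
  qed
  then show ?thesis by blast
qed

section \<open>Multi-index derivatives on the line\<close>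

lemma partial_deriv_real: "partial_deriv UNIV (1::real) = deriv"
proof (intro ext)
  fix f :: "real \<Rightarrow> real" and x
  have "((\<lambda>h. f (x + h)) has_vector_derivative D) (at 0) \<longleftrightarrow> (f has_field_derivative D) (at x)" for D
    using DERIV_shift[of f D 0 x] by (simp add: has_real_derivative_iff_has_vector_derivative add.commute)
  then show "partial_deriv UNIV 1 f x = deriv f x"
    by (simp add: partial_deriv_def vector_derivative_def deriv_def)
qed

lemma iter_deriv_real:
  assumes "\<alpha> \<in> multi_indices"
  shows "iter_deriv UNIV \<alpha> f = dv (length \<alpha>) (f :: real \<Rightarrow> real)"
proof -
  have "set \<alpha> \<subseteq> {1}" using assms by (simp add: multi_indices_def)
  then show ?thesis
    by (induction \<alpha>) (auto simp: iter_deriv_def partial_deriv_real)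
qed

lemma replicate_multi_index: "replicate k (1::real) \<in> multi_indices"
  by (auto simp: multi_indices_def)

lemma smooth_on_real:
  "smooth_on UNIV (f :: real \<Rightarrow> real) \<longleftrightarrow> (\<forall>k x. (dv k f has_real_derivative dv (Suc k) f x) (at x))"
    (is "?L = ?R")
proof
  have sh: "(\<lambda>h. g (x + h)) differentiable (at 0) \<longleftrightarrow> (g has_real_derivative deriv g x) (at x)"
    for g :: "real \<Rightarrow> real" and x
  proof
    assume "(\<lambda>h. g (x + h)) differentiable (at 0)"
    then obtain D where "((\<lambda>h. g (x + h)) has_real_derivative D) (at 0)"
      by (auto simp: real_differentiable_def)
    then have "(g has_real_derivative D) (at x)"
      using DERIV_shift[of g D 0 x] by (simp add: add.commute)
    then show "(g has_real_derivative deriv g x) (at x)"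
      using DERIV_deriv_iff_has_field_derivative by blast
  next
    assume "(g has_real_derivative deriv g x) (at x)"
    then have "((\<lambda>h. g (x + h)) has_real_derivative deriv g x) (at 0)"
      using DERIV_shift[of g "deriv g x" 0 x] by (simp add: add.commute)
    then show "(\<lambda>h. g (x + h)) differentiable (at 0)"
      using real_differentiable_def by blast
  qed
  {
    assume ?L
    show ?R
    proof (intro allI)
      fix k x
      have "(\<lambda>h. iter_deriv UNIV (replicate k 1) f (x + h *\<^sub>R 1)) differentiable (at 0 within {h. x + h *\<^sub>R 1 \<in> UNIV})"
        using \<open>?L\<close>[unfolded smooth_on_def, rule_format, OF replicate_multi_index[of k]] by simp
      then show "(dv k f has_real_derivative dv (Suc k) f x) (at x)"
        by (simp add: iter_deriv_real replicate_multi_index sh)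
    qed
  }
  assume R: ?R
  show ?L
    unfolding smooth_on_def
  proof (intro ballI conjI)
    fix \<alpha> :: "real list" assume a: "\<alpha> \<in> multi_indices"
    show "continuous_on UNIV (iter_deriv UNIV \<alpha> f)"
      unfolding iter_deriv_real[OF a] by (intro continuous_at_imp_continuous_on ballI DERIV_isCont) (rule R[rule_format])
    fix b x :: real assume "b \<in> Basis"
    then show "(\<lambda>h. iter_deriv UNIV \<alpha> f (x + h *\<^sub>R b)) differentiable (at 0 within {h. x + h *\<^sub>R b \<in> UNIV})"
      unfolding iter_deriv_real[OF a] using R by (simp add: sh)
  qed
qed

lemma tests_imp_test_function:
  assumes "\<eta> \<in> tests R"
  shows "\<eta> \<in> test_functions UNIV" "supp \<eta> \<subseteq> {-R..R}"
proof -
  have "x \<in> {-R..R}" if "\<eta> x \<noteq> 0" for x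
    using tests_zero[OF assms, of x] that by (cases "\<bar>x\<bar> > R") auto
  then have "{x. \<eta> x \<noteq> 0} \<subseteq> {-R..R}" by blast
  then show s: "supp \<eta> \<subseteq> {-R..R}" unfolding supp_def by (simp add: closure_minimal)
  then have "compact (supp \<eta>)" 
    unfolding supp_def by (meson bounded_closed_interval bounded_subset closed_closure compact_eq_bounded_closed)
  then show "\<eta> \<in> test_functions UNIV"
    using assms unfolding test_functions_def smooth_on_real tests_def by simp
qed

lemma test_function_imp_tests:
  assumes "\<eta> \<in> test_functions (UNIV::real set)"
  shows "\<exists>R. \<eta> \<in> tests R"
proof -
  have "bounded (supp \<eta>)" using assms by (auto simp: test_functions_def compact_imp_bounded)
  then obtain R where R: "\<And>x. x \<in> supp \<eta> \<Longrightarrow> \<bar>x\<bar> \<le> R" by (auto simp: bounded_iff)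
  have "\<eta> x = 0" if "\<bar>x\<bar> > R" for x
    using R[of x] that closure_subset[of "{x. \<eta> x \<noteq> 0}"] by (force simp: supp_def)
  then have "\<eta> \<in> tests R"
    using assms unfolding test_functions_def smooth_on_real tests_def by simp
  then show ?thesis ..
qed

section \<open>Linear functionals and bounds of finite order\<close>

definition test_linear :: "real functional \<Rightarrow> bool" where
  "test_linear w \<longleftrightarrow> (\<forall>R. \<forall>\<eta>\<in>tests R. \<forall>\<zeta>\<in>tests R. w (\<lambda>x. \<eta> x + \<zeta> x) = w \<eta> + w \<zeta>) \<and>
     (\<forall>R. \<forall>\<eta>\<in>tests R. \<forall>r. w (\<lambda>x. r * \<eta> x) = r * w \<eta>)"

text \<open>The seminorm of order \<open>N\<close> enters through any common bound \<open>A\<close>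
  instead of a supremum, so that applications only have to supply pointwise estimates.\<close>

definition order_bound :: "real \<Rightarrow> real \<Rightarrow> nat \<Rightarrow> real functional \<Rightarrow> bool" where
  "order_bound R M N w \<longleftrightarrow> (\<forall>\<eta>\<in>tests R. \<forall>A. (\<forall>k\<le>N. \<forall>x. \<bar>dv k \<eta> x\<bar> \<le> A) \<longrightarrow> \<bar>w \<eta>\<bar> \<le> M * A)"

lemma test_linear_add: "test_linear w \<Longrightarrow> \<eta> \<in> tests R \<Longrightarrow> \<zeta> \<in> tests R \<Longrightarrow> w (\<lambda>x. \<eta> x + \<zeta> x) = w \<eta> + w \<zeta>"
  unfolding test_linear_def by blast

lemma test_linear_scale: "test_linear w \<Longrightarrow> \<eta> \<in> tests R \<Longrightarrow> w (\<lambda>x. r * \<eta> x) = r * w \<eta>"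
  unfolding test_linear_def by blast

lemma test_linear_diff:
  assumes "test_linear w" "\<eta> \<in> tests R" "\<zeta> \<in> tests R"
  shows "w (\<lambda>x. \<eta> x - \<zeta> x) = w \<eta> - w \<zeta>"
  using test_linear_add[OF assms(1,2) tests_scale[OF assms(3), of "-1"]] test_linear_scale[OF assms(1,3), of "-1"] by simp

lemma order_bound_mono:
  assumes "order_bound R M N w" "M \<le> M'" "N \<le> N'" shows "order_bound R M' N' w"
  unfolding order_bound_def
proof (intro ballI allI impI)
  fix \<eta> A assume e: "\<eta> \<in> tests R" and A: "\<forall>k\<le>N'. \<forall>x. \<bar>dv k \<eta> x\<bar> \<le> A"
  have "\<bar>w \<eta>\<bar> \<le> M * A" using assms(1,3) e A unfolding order_bound_def by (meson le_trans)
  moreover have "0 \<le> A" using A[rule_format, of 0 0] by linarith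
  ultimately show "\<bar>w \<eta>\<bar> \<le> M' * A" using assms(2) by (meson mult_right_mono order_trans)
qed

lemma order_boundD: "order_bound R M N w \<Longrightarrow> \<eta> \<in> tests R \<Longrightarrow> (\<And>k x. k \<le> N \<Longrightarrow> \<bar>dv k \<eta> x\<bar> \<le> A) \<Longrightarrow> \<bar>w \<eta>\<bar> \<le> M * A"
  unfolding order_bound_def by blast

lemma distributions_lin: "w \<in> distributions UNIV \<Longrightarrow> test_linear w"
  unfolding test_linear_def distributions_def by (simp add: tests_imp_test_function(1))

lemma multi_indices_real_le: 
  "{\<alpha> \<in> multi_indices. length \<alpha> \<le> N} = (\<lambda>k. replicate k (1::real)) ` {..N}"
proof (intro equalityI subsetI)
  fix \<alpha> :: "real list" assume "\<alpha> \<in> {\<alpha> \<in> multi_indices. length \<alpha> \<le> N}"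
  then have "\<alpha> = replicate (length \<alpha>) 1" "length \<alpha> \<le> N"
    by (auto simp: multi_indices_def intro!: replicate_eqI)
  then show "\<alpha> \<in> (\<lambda>k. replicate k 1) ` {..N}" by (metis atMost_iff image_eqI)
qed (auto simp: replicate_multi_index)

lemma distributions_ctrl:
  assumes "w \<in> distributions UNIV"
  shows "\<exists>M\<ge>0. \<exists>N. order_bound R M N w"
proof -
  have "\<exists>M N. \<forall>\<theta>\<in>test_functions UNIV. supp \<theta> \<subseteq> {-R..R} \<longrightarrow>
           \<bar>w \<theta>\<bar> \<le> M * (\<Sum>\<alpha>\<in>{\<alpha>\<in>multi_indices. length \<alpha> \<le> N}. SUP x. \<bar>iter_deriv UNIV \<alpha> \<theta> x\<bar>)"
    using assms compact_Icc[of "-R" R] unfolding distributions_def by blast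
  then obtain M N where MN: "\<And>\<theta>. \<theta>\<in>test_functions UNIV \<Longrightarrow> supp \<theta> \<subseteq> {-R..R} \<Longrightarrow>
           \<bar>w \<theta>\<bar> \<le> M * (\<Sum>\<alpha>\<in>{\<alpha>\<in>multi_indices. length \<alpha> \<le> N}. SUP x. \<bar>iter_deriv UNIV \<alpha> \<theta> x\<bar>)"
    by blast
  \<comment> \<open>On the line there is one multi-index of each length, so the sum has
    \<open>N + 1\<close> terms, each at most \<open>A\<close>. The absolute value is there because
    \<open>distributions\<close> puts no sign on \<open>M\<close>.\<close>
  have "order_bound R (\<bar>M\<bar> * (N + 1)) N w"
    unfolding order_bound_def
  proof (intro ballI allI impI)
    fix \<eta> A assume e: "\<eta> \<in> tests R" and A: "\<forall>k\<le>N. \<forall>x. \<bar>dv k \<eta> x\<bar> \<le> A"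
    have "(\<Sum>\<alpha>\<in>{\<alpha>\<in>multi_indices. length \<alpha> \<le> N}. SUP x. \<bar>iter_deriv UNIV \<alpha> \<eta> x\<bar>)
       = (\<Sum>k\<le>N. SUP x. \<bar>dv k \<eta> x\<bar>)"
      unfolding multi_indices_real_le
      by (subst sum.reindex)
         (auto simp: iter_deriv_real[OF replicate_multi_index] intro: inj_on_inverseI[where g=length])
    also have "\<bar>\<dots>\<bar> \<le> (\<Sum>k\<le>N. A)"
    proof (rule order_trans[OF sum_abs], rule sum_mono)
      fix k assume k: "k \<in> {..N}"
      have "(SUP x. \<bar>dv k \<eta> x\<bar>) \<le> A" using k A by (intro cSUP_least) auto
      moreover have "0 \<le> (SUP x. \<bar>dv k \<eta> x\<bar>)"
        using k A by (intro cSUP_upper2[where x=0]) (auto simp: bdd_above_def)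
      ultimately show "\<bar>SUP x. \<bar>dv k \<eta> x\<bar>\<bar> \<le> A" by simp
    qed
    finally have *: "\<bar>\<Sum>\<alpha>\<in>{\<alpha>\<in>multi_indices. length \<alpha> \<le> N}. SUP x. \<bar>iter_deriv UNIV \<alpha> \<eta> x\<bar>\<bar> \<le> (N+1) * A"
      by simp
    define S where "S = (\<Sum>\<alpha>\<in>{\<alpha>\<in>multi_indices. length \<alpha> \<le> N}. SUP x. \<bar>iter_deriv UNIV \<alpha> \<eta> x\<bar>)"
    have "\<bar>w \<eta>\<bar> \<le> M * S"
      unfolding S_def using MN tests_imp_test_function[OF e] by blast
    also have "M * S \<le> \<bar>M\<bar> * \<bar>S\<bar>"
      using abs_ge_self[of "M * S"] by (simp add: abs_mult)
    also have "\<bar>M\<bar> * \<bar>S\<bar> \<le> \<bar>M\<bar> * ((N+1) * A)" using * unfolding S_def[symmetric] by (intro mult_left_mono) auto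
    finally show "\<bar>w \<eta>\<bar> \<le> \<bar>M\<bar> * (N + 1) * A" by (simp add: mult.assoc)
  qed
  moreover have "0 \<le> \<bar>M\<bar> * (N + 1)" by simp
  ultimately show ?thesis by blast
qed

section \<open>Uniform boundedness of families of distributions\<close>

text \<open>For a fixed order \<open>k\<close> the majorant is only available from the index
  \<open>n = k\<close> on. This suffices for the Weierstrass test, and it is what a gliding hump
  delivers, where the controlled order grows with the index.\<close>

lemma tests_series:
  assumes \<theta>: "\<And>n. \<theta> n \<in> tests R" and d: "summable d"
    and le: "\<And>k n x. k \<le> n \<Longrightarrow> \<bar>dv k (\<theta> n) x\<bar> \<le> d n"
  shows "(\<lambda>x. \<Sum>n. \<theta> n x) \<in> tests R" "dv k (\<lambda>x. \<Sum>n. \<theta> n x) = (\<lambda>x. \<Sum>n. dv k (\<theta> n) x)"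
    "summable (\<lambda>n. dv k (\<theta> n) x)"
proof -
  have uc: "uniformly_convergent_on UNIV (\<lambda>n x. \<Sum>i<n. dv k (\<theta> i) x)" for k
    by (rule Weierstrass_m_test'_ev[OF _ d])
       (use le in \<open>auto intro!: eventually_sequentiallyI[of k]\<close>)
  have sm: "summable (\<lambda>n. dv k (\<theta> n) x)" for k x
    by (rule summable_comparison_test_ev[OF _ d])
       (use le in \<open>auto intro!: eventually_sequentiallyI[of k]\<close>)
  show "summable (\<lambda>n. dv k (\<theta> n) x)" by (rule sm)
  have der: "((\<lambda>x. \<Sum>n. dv k (\<theta> n) x) has_real_derivative (\<Sum>n. dv (Suc k) (\<theta> n) x)) (at x)" for k x
    using has_field_derivative_series'(2)[of UNIV "\<lambda>n. dv k (\<theta> n)" "\<lambda>n. dv (Suc k) (\<theta> n)" 0 x,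
        OF _ has_field_derivative_at_within[OF tests_DERIV[OF \<theta>]] uc _ sm]
    by (simp del: funpow.simps)
  show "dv k (\<lambda>x. \<Sum>n. \<theta> n x) = (\<lambda>x. \<Sum>n. dv k (\<theta> n) x)"
    by (rule dv_eqI[where D="\<lambda>k x. \<Sum>n. dv k (\<theta> n) x"]) (simp, rule der)
  show "(\<lambda>x. \<Sum>n. \<theta> n x) \<in> tests R"
    by (rule testsI[where D="\<lambda>k x. \<Sum>n. dv k (\<theta> n) x"])
       (simp, rule der, simp add: tests_zero[OF \<theta>])
qed

text \<open>The sequence is dominated by a geometric one of ratio 1/2. The resulting factor
  \<open>2\<close> reappears in the condition \<open>M * (2 * d') \<le> 1\<close> of the gliding
  hump.\<close>

lemma suminf_geometric_tail_le:
  fixes d :: "nat \<Rightarrow> real"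
  assumes "\<And>n. 0 \<le> d n" "\<And>n. d (Suc n) \<le> d n / 2"
  shows "summable d" "(\<Sum>n. d (n + m)) \<le> 2 * d m"
proof -
  have le: "d (n + m) \<le> d m * (1/2)^n" for n m
  proof (induction n)
    case (Suc n)
    then show ?case using assms(2)[of "n + m"] by simp
  qed simp
  have "summable (\<lambda>n. d 0 * (1/2)^n)" by (intro summable_mult summable_geometric) simp
  then show s: "summable d"
    by (rule summable_comparison_test') (use le[of _ 0] assms(1) in auto)
  have "(\<Sum>n. d (n + m)) \<le> (\<Sum>n. d m * (1/2)^n)"
    by (rule suminf_le[OF le summable_ignore_initial_segment[OF s]])
       (intro summable_mult summable_geometric, simp)
  also have "\<dots> = 2 * d m" by (subst suminf_mult) (simp_all add: suminf_geometric)
  finally show "(\<Sum>n. d (n + m)) \<le> 2 * d m" .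
qed

text \<open>
  Gliding hump. A stage consists of a partial sum \<open>S\<close>, a scale \<open>d\<close> and an order \<open>K\<close>: the summands still
  to come have derivatives up to order \<open>K\<close> bounded by \<open>d\<close>, \<open>d/2\<close>, \<open>d/4\<close>,  and so on, so they can change the
  value of the functional chosen last by at most \<open>1\<close>.
\<close>

theorem uniform_boundedness:
  fixes W :: "'i \<Rightarrow> real functional"
  assumes test_linear: "\<And>i. i \<in> I \<Longrightarrow> test_linear (W i)"
    and cont: "\<And>i. i \<in> I \<Longrightarrow> \<exists>M N. order_bound R M N (W i)"
    and pw: "\<And>\<theta>. \<theta> \<in> tests R \<Longrightarrow> \<exists>B. \<forall>i\<in>I. \<bar>W i \<theta>\<bar> \<le> B"
  shows "\<exists>M\<ge>0. \<exists>N. \<forall>i\<in>I. order_bound R M N (W i)"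
proof (rule ccontr)
  assume neg: "\<not> ?thesis"
  \<comment> \<open>The negated claim is applied with \<open>M\<close> and \<open>N\<close> both
    equal to \<open>n\<close>; homogeneity then normalises the offending test function.\<close>
  have ex: "\<exists>i\<in>I. \<exists>\<theta>\<in>tests R. (\<forall>k\<le>n. \<forall>x. \<bar>dv k \<theta> x\<bar> \<le> 1) \<and> \<bar>W i \<theta>\<bar> > n" for n :: nat
  proof -
    obtain i where i: "i \<in> I" "\<not> order_bound R (real n) n (W i)" using neg by (metis of_nat_0_le_iff)
    then obtain \<eta> A where e: "\<eta> \<in> tests R" "\<forall>k\<le>n. \<forall>x. \<bar>dv k \<eta> x\<bar> \<le> A" "\<bar>W i \<eta>\<bar> > real n * A"
      unfolding order_bound_def by (auto simp: not_le)
    obtain M N where MN: "order_bound R M N (W i)" using cont i by blast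
    have A0: "A \<ge> 0" using e(2)[rule_format, of 0 0] by linarith
    \<comment> \<open>Normalising needs a positive divisor. If \<open>A = 0\<close>, the replacement
      is positive and still keeps \<open>n * A'\<close> strictly below the value of the
      functional.\<close>
    define A' where "A' = (if A > 0 then A else \<bar>W i \<eta>\<bar> / (n + 1))"
    have Wpos: "\<bar>W i \<eta>\<bar> > 0" using e(3) A0 by (meson mult_nonneg_nonneg of_nat_0_le_iff order_le_less_trans)
    have A': "A' > 0" "A \<le> A'" "\<bar>W i \<eta>\<bar> > real n * A'"
      using A0 e(3) Wpos by (auto simp: A'_def field_simps not_less)
    have "W i (\<lambda>x. (1/A') * \<eta> x) = (1/A') * W i \<eta>"
      by (rule test_linear_scale[OF test_linear[OF i(1)] e(1)])
    then have "\<bar>W i (\<lambda>x. (1/A') * \<eta> x)\<bar> = \<bar>W i \<eta>\<bar> / A'" using A'(1) by (simp only: abs_mult) simp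
    also have "\<dots> > n" using A'(1,3) by (simp add: field_simps)
    finally have "\<bar>W i (\<lambda>x. (1/A') * \<eta> x)\<bar> > n" .
    moreover have "\<bar>dv k (\<lambda>x. (1/A') * \<eta> x) x\<bar> \<le> 1" if "k \<le> n" for k x
    proof -
      have "\<bar>dv k \<eta> x\<bar> \<le> A'" using e(2) that A'(2) by (meson order_trans)
      then show ?thesis unfolding dv_scale[OF e(1)] using A' by (simp add: abs_mult field_simps)
    qed
    ultimately show ?thesis using i(1) tests_scale[OF e(1), of "1/A'"] by blast
  qed
  obtain i0 where "i0 \<in> I" using ex[of 0] by blast
  \<comment> \<open>The target \<open>real K + 1\<close> leaves at least \<open>K\<close> after the
    tail has taken away \<open>1\<close>. As \<open>K\<close> increases strictly from stage to
    stage, these values are unbounded.\<close>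
  define step where "step = (\<lambda>(n::nat) (S::real\<Rightarrow>real, d::real, K::nat, \<theta>::real\<Rightarrow>real, i::'i) (S', d', K', \<theta>', i').
     S' = (\<lambda>x. S x + \<theta>' x) \<and> i' \<in> I \<and> \<theta>' \<in> tests R \<and> (\<forall>k\<le>K. \<forall>x. \<bar>dv k \<theta>' x\<bar> \<le> d) \<and> \<bar>W i' S'\<bar> \<ge> real K + 1 \<and>
      d' \<le> d / 2 \<and> K' > K \<and> (\<exists>M. order_bound R M K' (W i') \<and> M * (2 * d') \<le> 1))"
  have "\<exists>f :: nat \<Rightarrow> (real\<Rightarrow>real) \<times> real \<times> nat \<times> (real\<Rightarrow>real) \<times> 'i. \<forall>n. (case f n of (S, d, K, \<theta>, i) \<Rightarrow> S \<in> tests R \<and> d > 0) \<and> step n (f n) (f (Suc n))"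
  proof (rule dependent_nat_choice)
    have "(\<lambda>x. 0) \<in> tests R"
      by (rule testsI[where D="\<lambda>_ _. 0"]) auto
    then show "\<exists>x. case x of (S, d::real, K::nat, \<theta>::real\<Rightarrow>real, i::'i) \<Rightarrow> S \<in> tests R \<and> d > 0"
      by (intro exI[of _ "(\<lambda>x. 0, 1, 0, \<lambda>x. 0, i0)"]) auto
  next
    fix x :: "(real\<Rightarrow>real) \<times> real \<times> nat \<times> (real\<Rightarrow>real) \<times> 'i" and n
    obtain S d K \<theta> i where x: "x = (S, d, K, \<theta>, i)" by (metis prod_cases5)
    assume "case x of (S, d, K, \<theta>, i) \<Rightarrow> S \<in> tests R \<and> d > 0"
    then have S: "S \<in> tests R" and d: "d > 0" by (auto simp: x)
    obtain B where B: "\<And>i. i\<in>I \<Longrightarrow> \<bar>W i S\<bar> \<le> B" using pw[OF S] by blast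
    \<comment> \<open>Large enough that after scaling by \<open>d\<close> the new hump alone
      contributes \<open>B + K + 1\<close>, which beats the bound \<open>B\<close> for the value at
      the old partial sum.\<close>
    define n' where "n' = K + nat \<lceil>(B + K + 1) / d\<rceil>"
    have n': "K \<le> n'" "(B + K + 1) / d \<le> real n'"
      unfolding n'_def by simp linarith
    obtain i' \<theta>' where i': "i' \<in> I" "\<theta>' \<in> tests R" "\<And>k x. k \<le> n' \<Longrightarrow> \<bar>dv k \<theta>' x\<bar> \<le> 1" "\<bar>W i' \<theta>'\<bar> > n'"
      using ex[of n'] by blast
    define \<xi> where "\<xi> = (\<lambda>x. d * \<theta>' x)"
    have \<xi>: "\<xi> \<in> tests R" unfolding \<xi>_def by (rule tests_scale[OF i'(2)])
    have "\<bar>W i' \<xi>\<bar> = d * \<bar>W i' \<theta>'\<bar>"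
      unfolding \<xi>_def test_linear_scale[OF test_linear[OF i'(1)] i'(2)] using d by (simp add: abs_mult)
    also have "\<dots> \<ge> d * n'" using i'(4) d by (intro mult_left_mono) auto
    also have "d * n' \<ge> B + K + 1" using n'(2) d by (simp add: field_simps)
    finally have W: "\<bar>W i' \<xi>\<bar> \<ge> B + K + 1" .
    have "W i' (\<lambda>x. S x + \<xi> x) = W i' S + W i' \<xi>" by (rule test_linear_add[OF test_linear[OF i'(1)] S \<xi>])
    then have W2: "\<bar>W i' (\<lambda>x. S x + \<xi> x)\<bar> \<ge> real K + 1" using W B[OF i'(1)] by linarith
    obtain M N where MN: "order_bound R M N (W i')" using cont i'(1) by blast
    define d' where "d' = min (d / 2) (1 / (2 * (\<bar>M\<bar> + 1)))"
    have d': "d' > 0" "d' \<le> d/2" using d by (auto simp: d'_def)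
    have "(\<bar>M\<bar> + 1) * (2 * d') \<le> (\<bar>M\<bar> + 1) * (2 * (1 / (2 * (\<bar>M\<bar> + 1))))"
      by (intro mult_left_mono) (auto simp: d'_def)
    also have "\<dots> = 1" by (simp add: add_nonneg_eq_0_iff)
    finally have M1: "(\<bar>M\<bar> + 1) * (2 * d') \<le> 1" .
    have M2: "order_bound R (\<bar>M\<bar> + 1) (max N (Suc K)) (W i')"
      by (rule order_bound_mono[OF MN]) auto
    have dv\<xi>: "\<bar>dv k \<xi> x\<bar> \<le> d" if "k \<le> K" for k x
      unfolding \<xi>_def dv_scale[OF i'(2)] using i'(3)[of k x] that n'(1) d by (simp add: abs_mult)
    have "step n x ((\<lambda>x. S x + \<xi> x), d', max N (Suc K), \<xi>, i')"
      unfolding step_def x using i'(1) \<xi> dv\<xi> W2 d' M1 M2 by auto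
    moreover have "case ((\<lambda>x. S x + \<xi> x), d', max N (Suc K), \<xi>, i') of (S, d, K, \<theta>, i) \<Rightarrow> S \<in> tests R \<and> d > 0"
      unfolding prod.case using tests_add[OF S \<xi>] d'(1) by blast
    ultimately show "\<exists>y. (case y of (S, d, K, \<theta>, i) \<Rightarrow> S \<in> tests R \<and> d > 0) \<and> step n x y"
      by blast
  qed
  then obtain f :: "nat \<Rightarrow> (real\<Rightarrow>real) \<times> real \<times> nat \<times> (real\<Rightarrow>real) \<times> 'i" where
    fall: "\<forall>n. (case f n of (S, d, K, \<theta>, i) \<Rightarrow> S \<in> tests R \<and> d > 0) \<and> step n (f n) (f (Suc n))" ..
  note f = conjunct1[OF spec[OF fall]] conjunct2[OF spec[OF fall]]
  define S d K \<theta> i where "S = (\<lambda>n. fst (f n))" and "d = (\<lambda>n. fst (snd (f n)))"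
    and "K = (\<lambda>n. fst (snd (snd (f n))))" and "\<theta> = (\<lambda>n. fst (snd (snd (snd (f n)))))"
    and "i = (\<lambda>n. snd (snd (snd (snd (f n)))))"
  have fn: "f n = (S n, d n, K n, \<theta> n, i n)" for n by (simp add: S_def d_def K_def \<theta>_def i_def)
  have st: "step n (S n, d n, K n, \<theta> n, i n) (S (Suc n), d (Suc n), K (Suc n), \<theta> (Suc n), i (Suc n))" for n
    using f(2)[of n] unfolding fn .
  have S: "S n \<in> tests R" and d: "d n > 0" for n using f(1)[of n] unfolding fn by auto
  have SS: "S (Suc n) = (\<lambda>x. S n x + \<theta> (Suc n) x)" and iI: "i (Suc n) \<in> I" and \<theta>: "\<theta> (Suc n) \<in> tests R"
    and \<theta>le: "\<And>k x. k\<le>K n \<Longrightarrow> \<bar>dv k (\<theta> (Suc n)) x\<bar> \<le> d n" and WS: "\<bar>W (i (Suc n)) (S (Suc n))\<bar> \<ge> real (K n) + 1"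
    and dd: "d (Suc n) \<le> d n / 2" and KK: "K (Suc n) > K n"
    and cc: "\<exists>M. order_bound R M (K (Suc n)) (W (i (Suc n))) \<and> M * (2 * d (Suc n)) \<le> 1" for n
    using st[of n] unfolding step_def by auto
  have Kn: "n \<le> K n" for n by (induction n) (use KK less_le_trans in \<open>auto simp: Suc_le_eq intro: le_less_trans\<close>)
  have Kmono: "K m \<le> K (n + m)" for n m by (induction n) (use KK less_imp_le order_trans in fastforce)+
  have d0: "\<And>n. 0 \<le> d n" using d less_imp_le by blast
  note geo = suminf_geometric_tail_le[of d, OF d0 dd]
  define T where "T = (\<lambda>m x. \<Sum>n. \<theta> (Suc (n + m)) x)"
  have T: "T m \<in> tests R" "\<And>k x. k \<le> K m \<Longrightarrow> \<bar>dv k (T m) x\<bar> \<le> 2 * d m" for m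
  proof -
    have sm: "summable (\<lambda>n. d (n + m))" by (rule summable_ignore_initial_segment[OF geo(1)])
    \<comment> \<open>Two sources of control: \<open>k \<le> n\<close> makes the series converge in
      every order since \<open>n \<le> K n\<close>, while \<open>k \<le> K m\<close> bounds the
      whole tail in the orders fixed at stage \<open>m\<close>.\<close>
    have le: "k \<le> n \<or> k \<le> K m \<Longrightarrow> \<bar>dv k (\<theta> (Suc (n + m))) x\<bar> \<le> d (n + m)" for k n x
      using \<theta>le[of k "n+m" x] Kn[of "n+m"] Kmono[of m n] by (meson le_add1 order_trans)
    note ts = tests_series[of "\<lambda>n. \<theta> (Suc (n + m))", OF \<theta> sm le]
    show "T m \<in> tests R" unfolding T_def using ts(1) by blast
    fix k x assume k: "k \<le> K m"
    have "\<bar>\<Sum>n. dv k (\<theta> (Suc (n + m))) x\<bar> \<le> (\<Sum>n. d (n + m))"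
      using norm_suminf_le[of "\<lambda>n. dv k (\<theta> (Suc (n + m))) x", OF _ sm] le k by simp
    also have "\<dots> \<le> 2 * d m" by (rule geo(2))
    finally show "\<bar>dv k (T m) x\<bar> \<le> 2 * d m" unfolding T_def using ts(2) by simp
  qed
  have sm: "summable (\<lambda>n. \<theta> (Suc n) x)" for x
    using tests_series(3)[of "\<lambda>n. \<theta> (Suc n)", OF \<theta> geo(1), of 0 x] \<theta>le Kn by (simp, meson order_trans)
  have split: "S 0 x + T 0 x = S m x + T m x" for m x
  proof (induction m)
    case (Suc m)
    have "T m x = \<theta> (Suc m) x + T (Suc m) x"
      using suminf_split_head[of "\<lambda>n. \<theta> (Suc (n + m)) x"] summable_ignore_initial_segment[OF sm[of x], of m]
      by (simp add: T_def)
    then show ?case using Suc by (simp add: SS)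
  qed simp
  define Z where "Z = (\<lambda>x. S 0 x + T 0 x)"
  have Z: "Z \<in> tests R" unfolding Z_def by (intro tests_add S T)
  obtain B where B: "\<And>j. j\<in>I \<Longrightarrow> \<bar>W j Z\<bar> \<le> B" using pw[OF Z] by blast
  obtain n :: nat where n: "real n > B" using reals_Archimedean2 by blast
  obtain M where M: "order_bound R M (K (Suc n)) (W (i (Suc n)))" "M * (2 * d (Suc n)) \<le> 1" using cc by blast
  have "\<bar>W (i (Suc n)) (T (Suc n))\<bar> \<le> M * (2 * d (Suc n))"
    by (rule order_boundD[OF M(1) T(1)]) (rule T(2))
  moreover have "W (i (Suc n)) Z = W (i (Suc n)) (S (Suc n)) + W (i (Suc n)) (T (Suc n))"
  proof -
    have "Z = (\<lambda>x. S (Suc n) x + T (Suc n) x)" unfolding Z_def using split by blast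
    then show ?thesis using test_linear_add[OF test_linear[OF iI] S T(1)] by simp
  qed
  moreover have "real n \<le> real (K n)" using Kn by simp
  ultimately show False using WS[of n] B[OF iI[of n]] M(2) n by linarith
qed

section \<open>Moving test functions\<close>

lemma test_linear_add3:
  assumes "test_linear w" "f \<in> tests R" "g \<in> tests R" "h \<in> tests R"
  shows "w (\<lambda>x. f x + r * g x + h x) = w f + r * w g + w h"
proof -
  have rg: "(\<lambda>x. r * g x) \<in> tests R" by (rule tests_scale[OF assms(3)])
  show ?thesis
    using test_linear_add[OF assms(1) tests_add[OF assms(2) rg] assms(4)] test_linear_add[OF assms(1,2) rg]
      test_linear_scale[OF assms(1,3), of r] by simp
qed

text \<open>A product rule. Up to \<open>(s - s0) * gd\<close>, the motion of the test function is a
  remainder that is quadratic in all orders up to \<open>N\<close>; the order bound, being uniform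
  in \<open>s\<close>, turns it into a quadratic error. Thus \<open>L\<close> is differentiated only
  on the fixed function \<open>g s0\<close>.\<close>

lemma has_real_derivative_moving_test:
  fixes L :: "real \<Rightarrow> real functional"
  assumes test_linear: "\<And>s. s \<in> S \<Longrightarrow> test_linear (L s)" and order_bound: "\<And>s. s \<in> S \<Longrightarrow> order_bound R M N (L s)"
    and g: "\<And>s. s \<in> S \<Longrightarrow> g s \<in> tests R" and gd: "gd \<in> tests R" and s0: "s0 \<in> S"
    and der: "((\<lambda>s. L s (g s0)) has_real_derivative l) (at s0 within S)"
    and cont: "continuous (at s0 within S) (\<lambda>s. L s gd)"
    and rem: "\<And>k s x. s \<in> S \<Longrightarrow> k \<le> N \<Longrightarrow>
      \<bar>dv k (g s) x - dv k (g s0) x - (s - s0) * dv k gd x\<bar> \<le> C * (s - s0)\<^sup>2"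
  shows "((\<lambda>s. L s (g s)) has_real_derivative l + L s0 gd) (at s0 within S)"
proof -
  define r where "r s = (\<lambda>x. g s x - (g s0 x + (s - s0) * gd x))" for s
  have r: "r s \<in> tests R" if "s \<in> S" for s
    unfolding r_def by (intro tests_diff tests_add tests_scale g gd s0 that)
  have dvr: "dv k (r s) x = dv k (g s) x - dv k (g s0) x - (s - s0) * dv k gd x" if "s \<in> S" for k s x
    unfolding r_def dv_diff[OF g[OF that] tests_add[OF g[OF s0] tests_scale[OF gd]]]
      dv_add[OF g[OF s0] tests_scale[OF gd]] dv_scale[OF gd] by simp
  have Lr: "\<bar>L s (r s)\<bar> \<le> M * (C * (s - s0)\<^sup>2)" if "s \<in> S" for s
    by (rule order_boundD[OF order_bound[OF that] r[OF that]]) (use rem that dvr in simp)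
  have eq: "L s (g s) = L s (g s0) + (s - s0) * L s gd + L s (r s)" if "s \<in> S" for s
    using test_linear_add3[OF test_linear[OF that] g[OF s0] gd r[OF that], of "s - s0"] by (simp add: r_def)
  \<comment> \<open>On \<open>gd\<close> the curve is merely continuous; the factor
    \<open>s - s0\<close> still makes the product differentiable at \<open>s0\<close>.\<close>
  have d2: "((\<lambda>s. (s - s0) * L s gd) has_real_derivative L s0 gd) (at s0 within S)"
  proof -
    have "((\<lambda>s. L s gd) \<longlongrightarrow> L s0 gd) (at s0 within S)" using cont by (simp add: continuous_within)
    moreover have "\<forall>\<^sub>F s in at s0 within S. L s gd = ((s - s0) * L s gd - (s0 - s0) * L s0 gd) / (s - s0)"
      by (auto simp: eventually_at_filter)
    ultimately show ?thesis unfolding has_field_derivative_iff by (rule Lim_transform_eventually)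
  qed
  have r0: "L s0 (r s0) = 0" using Lr[OF s0] by simp
  have d3: "((\<lambda>s. L s (r s)) has_real_derivative 0) (at s0 within S)"
    unfolding has_field_derivative_iff
  proof (rule tendsto_0_le[where K=1])
    show "((\<lambda>s. M * C * (s - s0)) \<longlongrightarrow> 0) (at s0 within S)" by (auto intro!: tendsto_eq_intros)
    show "\<forall>\<^sub>F s in at s0 within S. norm ((L s (r s) - L s0 (r s0)) / (s - s0)) \<le> norm (M * C * (s - s0)) * 1"
    proof -
      have "norm ((L s (r s) - L s0 (r s0)) / (s - s0)) \<le> norm (M * C * (s - s0)) * 1" if "s \<noteq> s0" "s \<in> S" for s
      proof -
        have "\<bar>L s (r s)\<bar> \<le> \<bar>M * C * (s - s0)\<bar> * \<bar>s - s0\<bar>"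
          using Lr[OF that(2)] abs_ge_self[of "M * C * (s - s0) * (s - s0)"]
          by (simp add: abs_mult power2_eq_square mult.assoc)
        then show ?thesis using that(1) r0 by (simp add: divide_le_eq)
      qed
      then show ?thesis by (auto simp: eventually_at_filter)
    qed
  qed
  have "((\<lambda>s. L s (g s0) + (s - s0) * L s gd + L s (r s)) has_real_derivative l + L s0 gd + 0) (at s0 within S)"
    by (intro DERIV_add der d2 d3)
  then show ?thesis
    using has_field_derivative_transform_within[OF _ zero_less_one s0, where g="\<lambda>s. L s (g s)"] eq by simp
qed

text \<open>The same splitting without the linear term: for continuity a Lipschitz remainder is
  enough.\<close>

lemma continuous_moving_test:
  fixes L :: "real \<Rightarrow> real functional"
  assumes test_linear: "\<And>s. s \<in> S \<Longrightarrow> test_linear (L s)" and order_bound: "\<And>s. s \<in> S \<Longrightarrow> order_bound R M N (L s)"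
    and g: "\<And>s. s \<in> S \<Longrightarrow> g s \<in> tests R" and s0: "s0 \<in> S"
    and cont: "continuous (at s0 within S) (\<lambda>s. L s (g s0))"
    and rem: "\<And>k s x. s \<in> S \<Longrightarrow> k \<le> N \<Longrightarrow> \<bar>dv k (g s) x - dv k (g s0) x\<bar> \<le> C * \<bar>s - s0\<bar>"
  shows "continuous (at s0 within S) (\<lambda>s. L s (g s))"
proof -
  define r where "r s = (\<lambda>x. g s x - g s0 x)" for s
  have r: "r s \<in> tests R" if "s \<in> S" for s
    unfolding r_def by (intro tests_diff g s0 that)
  have Lr: "\<bar>L s (r s)\<bar> \<le> M * (C * \<bar>s - s0\<bar>)" if "s \<in> S" for s
    by (rule order_boundD[OF order_bound[OF that] r[OF that]])
       (use rem that in \<open>simp add: r_def dv_diff[OF g[OF that] g[OF s0]]\<close>)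
  have eq: "L s (g s) = L s (g s0) + L s (r s)" if "s \<in> S" for s
    using test_linear_add[OF test_linear[OF that] g[OF s0] r[OF that]] by (simp add: r_def)
  have "((\<lambda>s. L s (r s)) \<longlongrightarrow> 0) (at s0 within S)"
  proof (rule tendsto_0_le[where K=1])
    show "((\<lambda>s. M * C * \<bar>s - s0\<bar>) \<longlongrightarrow> 0) (at s0 within S)" by (auto intro!: tendsto_eq_intros)
    have "norm (L s (r s)) \<le> norm (M * C * \<bar>s - s0\<bar>) * 1" if "s \<in> S" for s
      using Lr[OF that] abs_ge_self[of "M * (C * \<bar>s - s0\<bar>)"] by (simp add: abs_mult mult.assoc)
    then show "\<forall>\<^sub>F s in at s0 within S. norm (L s (r s)) \<le> norm (M * C * \<bar>s - s0\<bar>) * 1"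
      by (auto simp: eventually_at_filter)
  qed
  then have "((\<lambda>s. L s (g s0) + L s (r s)) \<longlongrightarrow> L s0 (g s0) + 0) (at s0 within S)"
    using cont by (intro tendsto_add) (auto simp: continuous_within)
  moreover have "\<forall>\<^sub>F s in at s0 within S. L s (g s0) + L s (r s) = L s (g s)"
    using eq by (auto simp: eventually_at_filter)
  ultimately have "((\<lambda>s. L s (g s)) \<longlongrightarrow> L s0 (g s0) + 0) (at s0 within S)"
    by (rule Lim_transform_eventually)
  then show ?thesis by (simp add: continuous_within)
qed

text \<open>The second bound is the mean value inequality for \<open>f y - y * f' x\<close> on the
  segment, whose derivative is at most \<open>A * \<bar>h\<bar>\<close> by the first one. This route
  gives \<open>A\<close> instead of the sharp \<open>A / 2\<close>.\<close>

lemma taylor_bounds: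
  fixes f :: "real \<Rightarrow> real"
  assumes f: "\<And>x. (f has_real_derivative f' x) (at x)"
  shows "(\<And>x. \<bar>f' x\<bar> \<le> A) \<Longrightarrow> \<bar>f (x + h) - f x\<bar> \<le> A * \<bar>h\<bar>"
    and "(\<And>x. (f' has_real_derivative f'' x) (at x)) \<Longrightarrow> (\<And>x. \<bar>f'' x\<bar> \<le> A) \<Longrightarrow>
          \<bar>f (x + h) - f x - h * f' x\<bar> \<le> A * h\<^sup>2"
proof -
  have 1: "\<bar>f (x + h) - f x\<bar> \<le> A * \<bar>h\<bar>" if "\<And>x. (f has_real_derivative f' x) (at x)" "\<And>x. \<bar>f' x\<bar> \<le> A" for f f' x h A
    using field_differentiable_bound[of UNIV f f' A "x+h" x] that by simp
  show "(\<And>x. \<bar>f' x\<bar> \<le> A) \<Longrightarrow> \<bar>f (x + h) - f x\<bar> \<le> A * \<bar>h\<bar>" using 1[OF f] .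
  assume d: "\<And>x. (f' has_real_derivative f'' x) (at x)" and A: "\<And>x. \<bar>f'' x\<bar> \<le> A"
  define g where "g = (\<lambda>y. f y - y * f' x)"
  have "norm (g (x + h) - g x) \<le> (A * \<bar>h\<bar>) * norm ((x + h) - x)"
  proof (rule field_differentiable_bound[of "closed_segment x (x + h)" g "\<lambda>y. f' y - f' x"])
    fix z assume z: "z \<in> closed_segment x (x + h)"
    show "(g has_real_derivative f' z - f' x) (at z within closed_segment x (x + h))"
      unfolding g_def by (rule has_field_derivative_at_within) (auto intro!: derivative_eq_intros f)
    have "\<bar>f' (x + (z - x)) - f' x\<bar> \<le> A * \<bar>z - x\<bar>" by (rule 1[OF d A])
    also have "\<dots> \<le> A * \<bar>h\<bar>"
    proof (rule mult_left_mono)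
      show "\<bar>z - x\<bar> \<le> \<bar>h\<bar>" using z by (auto simp: closed_segment_eq_real_ivl split: if_splits)
      show "0 \<le> A" using A[of 0] by linarith
    qed
    finally show "norm (f' z - f' x) \<le> A * \<bar>h\<bar>" by simp
  qed auto
  then show "\<bar>f (x + h) - f x - h * f' x\<bar> \<le> A * h\<^sup>2"
    by (simp add: g_def algebra_simps power2_eq_square)
qed

section \<open>Test functions translated with constant velocity\<close>

lemma common_nat_bound:
  assumes "\<And>k::nat. \<exists>A. \<forall>p. g k p \<le> (A::real)"
  shows "\<exists>A. \<forall>k\<le>N. \<forall>p. g k p \<le> A"
proof (induction N)
  case 0 then show ?case using assms[of 0] by auto
next
  case (Suc N)
  then obtain A where A: "\<forall>k\<le>N. \<forall>x. g k x \<le> A" by blast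
  obtain A' where A': "\<forall>x. g (Suc N) x \<le> A'" using assms by blast
  have "\<forall>k\<le>Suc N. \<forall>x. g k x \<le> max A A'"
    using A A' unfolding le_Suc_eq by (metis max.coboundedI1 max.coboundedI2)
  then show ?case ..
qed

lemma common_bound:
  assumes "\<eta> \<in> tests R"
  shows "\<exists>A. \<forall>k\<le>N. \<forall>x. \<bar>dv k \<eta> x\<bar> \<le> A"
  by (rule common_nat_bound) (rule tests_bounded[OF assms])

lemma continuous_shifted_test:
  fixes L :: "real \<Rightarrow> real functional"
  assumes test_linear: "\<And>s. s \<in> S \<Longrightarrow> test_linear (L s)" and order_bound: "\<And>s. s \<in> S \<Longrightarrow> order_bound R M N (L s)"
    and \<eta>: "\<eta> \<in> tests R1" and R: "\<And>s. s \<in> S \<Longrightarrow> R1 + \<bar>\<kappa> * (s - s1)\<bar> \<le> R"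
    and cont: "\<And>\<zeta>. \<zeta> \<in> tests R \<Longrightarrow> continuous_on S (\<lambda>s. L s \<zeta>)"
  shows "continuous_on S (\<lambda>s. L s (\<lambda>x. \<eta> (x + \<kappa> * (s - s1))))"
  unfolding continuous_on_eq_continuous_within
proof
  fix s0 assume s0: "s0 \<in> S"
  obtain A where A: "\<And>k x. k \<le> Suc N \<Longrightarrow> \<bar>dv k \<eta> x\<bar> \<le> A" using common_bound[OF \<eta>] by blast
  have g: "(\<lambda>x. \<eta> (x + \<kappa> * (s - s1))) \<in> tests R" if "s \<in> S" for s
    using tests_shift[OF \<eta> R[OF that]] .
  have sh: "x + \<kappa> * (s0 - s1) + \<kappa> * (s - s0) = x + \<kappa> * (s - s1)" for x s by (simp add: algebra_simps)
  show "continuous (at s0 within S) (\<lambda>s. L s (\<lambda>x. \<eta> (x + \<kappa> * (s - s1))))"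
  proof (rule continuous_moving_test[where C="A * \<bar>\<kappa>\<bar>" and g="\<lambda>s x. \<eta> (x + \<kappa> * (s - s1))"
        and L=L and R=R and M=M and N=N])
    show "continuous (at s0 within S) (\<lambda>s. L s (\<lambda>x. \<eta> (x + \<kappa> * (s0 - s1))))"
      using cont[OF g[OF s0]] s0 by (simp add: continuous_on_eq_continuous_within)
    fix k s x assume "s \<in> S" "k \<le> N"
    then show "\<bar>dv k (\<lambda>x. \<eta> (x + \<kappa> * (s - s1))) x - dv k (\<lambda>x. \<eta> (x + \<kappa> * (s0 - s1))) x\<bar> \<le> A * \<bar>\<kappa>\<bar> * \<bar>s - s0\<bar>"
      using taylor_bounds(1)[of "dv k \<eta>" "dv (Suc k) \<eta>" A "x + \<kappa> * (s0 - s1)" "\<kappa> * (s - s0)", OF tests_DERIV[OF \<eta>] A[of "Suc k"]]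
      unfolding dv_shift[OF \<eta>] sh[of x s] by (simp add: abs_mult mult_ac del: funpow.simps)
  qed (rule test_linear order_bound g s0; assumption)+
qed

text \<open>The test function travels with velocity \<open>-\<kappa>\<close> and passes its original
  position at \<open>s1\<close>. The Taylor remainder costs two derivatives beyond the order
  \<open>N\<close> of the functionals, hence the bounds up to order \<open>N + 2\<close>.\<close>

lemma has_real_derivative_shifted_test:
  fixes L :: "real \<Rightarrow> real functional"
  assumes test_linear: "\<And>s. s \<in> S \<Longrightarrow> test_linear (L s)" and order_bound: "\<And>s. s \<in> S \<Longrightarrow> order_bound R M N (L s)"
    and \<eta>: "\<eta> \<in> tests R1" and R: "\<And>s. s \<in> S \<Longrightarrow> R1 + \<bar>\<kappa> * (s - s1)\<bar> \<le> R"
    and der: "((\<lambda>s. L s (\<lambda>x. \<eta> (x + \<kappa> * (s0 - s1)))) has_real_derivative l) (at s0 within S)"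
    and cont: "\<And>\<zeta>. \<zeta> \<in> tests R \<Longrightarrow> continuous_on S (\<lambda>s. L s \<zeta>)"
    and s0: "s0 \<in> S"
  shows "((\<lambda>s. L s (\<lambda>x. \<eta> (x + \<kappa> * (s - s1)))) has_real_derivative
      l + \<kappa> * L s0 (\<lambda>x. deriv \<eta> (x + \<kappa> * (s0 - s1)))) (at s0 within S)"
proof -
  obtain A where A: "\<And>k x. k \<le> Suc (Suc N) \<Longrightarrow> \<bar>dv k \<eta> x\<bar> \<le> A" using common_bound[OF \<eta>] by blast
  have g: "(\<lambda>x. \<eta> (x + \<kappa> * (s - s1))) \<in> tests R" if "s \<in> S" for s
    using tests_shift[OF \<eta> R[OF that]] .
  have d: "deriv \<eta> \<in> tests R1" using tests_dv[OF \<eta>, of 1] by simp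
  have gd0: "(\<lambda>x. deriv \<eta> (x + \<kappa> * (s0 - s1))) \<in> tests R"
    using tests_shift[OF d R[OF s0]] .
  note gd = tests_scale[OF gd0, of \<kappa>]
  have Dgd: "dv k (\<lambda>x. \<kappa> * deriv \<eta> (x + \<kappa> * (s0 - s1))) = (\<lambda>x. \<kappa> * dv (Suc k) \<eta> (x + \<kappa> * (s0 - s1)))" for k
    unfolding dv_scale[OF gd0] dv_shift[OF d] using dv_dv[of k 1 \<eta>] by simp
  have sh: "x + \<kappa> * (s0 - s1) + \<kappa> * (s - s0) = x + \<kappa> * (s - s1)" for x s by (simp add: algebra_simps)
  have "((\<lambda>s. L s (\<lambda>x. \<eta> (x + \<kappa> * (s - s1)))) has_real_derivative
      l + L s0 (\<lambda>x. \<kappa> * deriv \<eta> (x + \<kappa> * (s0 - s1)))) (at s0 within S)"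
  proof (rule has_real_derivative_moving_test[where C="A * \<kappa>\<^sup>2" and g="\<lambda>s x. \<eta> (x + \<kappa> * (s - s1))"
        and L=L and R=R and M=M and N=N])
    show "continuous (at s0 within S) (\<lambda>s. L s (\<lambda>x. \<kappa> * deriv \<eta> (x + \<kappa> * (s0 - s1))))"
      using cont[OF gd] s0 by (simp add: continuous_on_eq_continuous_within)
    fix k s x assume "s \<in> S" "k \<le> N"
    then show "\<bar>dv k (\<lambda>x. \<eta> (x + \<kappa> * (s - s1))) x - dv k (\<lambda>x. \<eta> (x + \<kappa> * (s0 - s1))) x
        - (s - s0) * dv k (\<lambda>x. \<kappa> * deriv \<eta> (x + \<kappa> * (s0 - s1))) x\<bar> \<le> A * \<kappa>\<^sup>2 * (s - s0)\<^sup>2"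
      using taylor_bounds(2)[of "dv k \<eta>" "dv (Suc k) \<eta>" "dv (Suc (Suc k)) \<eta>" A "x + \<kappa> * (s0 - s1)" "\<kappa> * (s - s0)",
          OF tests_DERIV[OF \<eta>] tests_DERIV[OF \<eta>] A[of "Suc (Suc k)"]]
      unfolding Dgd dv_shift[OF \<eta>] sh[of x s] power_mult_distrib
      by (simp add: mult_ac del: funpow.simps)
  qed (rule test_linear order_bound g gd s0 der; assumption)+
  then show ?thesis using test_linear_scale[OF test_linear[OF s0] gd0] by simp
qed

section \<open>Mean value estimates\<close>

lemma mean_value_bound:
  fixes f :: "real \<Rightarrow> real"
  assumes "a \<le> b" "continuous_on {a..b} f"
    "\<And>s. s \<in> {a<..<b} \<Longrightarrow> (f has_real_derivative f' s) (at s)" "\<And>s. s \<in> {a<..<b} \<Longrightarrow> \<bar>f' s\<bar> \<le> C" "0 \<le> C"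
  shows "\<bar>f b - f a\<bar> \<le> C * (b - a)"
proof (cases "a = b")
  case False
  then have ab: "a < b" using assms(1) by simp
  obtain z where "z \<in> {a<..<b}" "f b - f a = (b - a) * f' z"
    using MVT[OF ab assms(2)] assms(3) by (metis DERIV_unique greaterThanLessThan_iff real_differentiable_def)
  then show ?thesis using assms(4)[of z] ab by (simp add: abs_mult mult.commute[of "b-a"] mult_right_mono)
qed simp

text \<open>This is where a small factor is gained: the crude bound \<open>C2\<close> is only paid
  on two layers of length at most \<open>\<epsilon>\<close>, next to \<open>\<alpha>\<close> and
  next to \<open>\<beta>\<close>.\<close>

lemma mean_value_bound_split:
  fixes f :: "real \<Rightarrow> real"
  assumes s1: "\<alpha> \<le> s1" "s1 \<le> \<beta>" and cont: "continuous_on {\<alpha>..s1} f"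
    and der: "\<And>s. s \<in> {\<alpha><..<s1} \<Longrightarrow> (f has_real_derivative f' s) (at s)"
    and C2: "\<And>s. s \<in> {\<alpha><..<s1} \<Longrightarrow> \<bar>f' s\<bar> \<le> C2"
    and C1: "\<And>s. s \<in> {\<alpha><..<s1} \<Longrightarrow> \<alpha> + \<epsilon> < s \<Longrightarrow> s < \<beta> - \<epsilon> \<Longrightarrow> \<bar>f' s\<bar> \<le> C1"
    and nn: "0 \<le> \<epsilon>" "0 \<le> C1" "0 \<le> C2"
  shows "\<bar>f s1 - f \<alpha>\<bar> \<le> C1 * (\<beta> - \<alpha>) + 2 * \<epsilon> * C2"
proof -
  \<comment> \<open>The truncations keep \<open>\<alpha> \<le> p \<le> q \<le> s1\<close> even if
    the layers overlap or \<open>s1\<close> lies in one of them. If the open interval between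
    \<open>p\<close> and \<open>q\<close> is not empty, it avoids both layers.\<close>
  define p where "p = min s1 (\<alpha> + \<epsilon>)"
  define q where "q = max p (min s1 (\<beta> - \<epsilon>))"
  have o: "\<alpha> \<le> p" "p \<le> q" "q \<le> s1" using s1 nn by (auto simp: p_def q_def)
  have 1: "\<bar>f p - f \<alpha>\<bar> \<le> C2 * (p - \<alpha>)"
    by (rule mean_value_bound[where f'=f'])
       (use o der C2 nn in \<open>auto intro: continuous_on_subset[OF cont]\<close>)
  have 2: "\<bar>f q - f p\<bar> \<le> C1 * (q - p)"
  proof (rule mean_value_bound[where f'=f'])
    fix s assume s: "s \<in> {p<..<q}"
    then have "p = \<alpha> + \<epsilon>" "q = min s1 (\<beta> - \<epsilon>)" by (auto simp: p_def q_def)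
    with s o show "\<bar>f' s\<bar> \<le> C1" by (intro C1) auto
  qed (use o der nn in \<open>auto intro: continuous_on_subset[OF cont]\<close>)
  have 3: "\<bar>f s1 - f q\<bar> \<le> C2 * (s1 - q)"
    by (rule mean_value_bound[where f'=f'])
       (use o der C2 nn in \<open>auto intro: continuous_on_subset[OF cont]\<close>)
  have "C2 * (p - \<alpha>) \<le> C2 * \<epsilon>" using nn by (intro mult_left_mono) (auto simp: p_def)
  moreover have "C2 * (s1 - q) \<le> C2 * \<epsilon>" using nn s1 by (intro mult_left_mono) (auto simp: p_def q_def)
  moreover have "C1 * (q - p) \<le> C1 * (\<beta> - \<alpha>)" using nn o s1 by (intro mult_left_mono) auto
  ultimately show ?thesis using 1 2 3 by (simp add: algebra_simps)
qed

section \<open>Transport along characteristics\<close>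

text \<open>The bounded sets of test functions supported in a fixed ball. Since \<open>A\<close> is
  an arbitrary sequence, a derivative leads to another set of this form, with \<open>A\<close>
  shifted.\<close>

definition test_ball :: "real \<Rightarrow> (nat \<Rightarrow> real) \<Rightarrow> (real \<Rightarrow> real) set" where
  "test_ball R A = {\<eta> \<in> tests R. \<forall>k x. \<bar>dv k \<eta> x\<bar> \<le> A k}"

lemma test_ball_shift: "\<eta> \<in> test_ball R A \<Longrightarrow> R + \<bar>y\<bar> \<le> R' \<Longrightarrow> (\<lambda>x. \<eta> (x + y)) \<in> test_ball R' A"
  unfolding test_ball_def using tests_shift dv_shift by fastforce

lemma test_ball_deriv: "\<eta> \<in> test_ball R A \<Longrightarrow> dv j \<eta> \<in> test_ball R (\<lambda>k. A (k + j))"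
  unfolding test_ball_def using tests_dv dv_dv by simp

text \<open>One interval of constant speed, with all errors collected in the source
  \<open>E\<close>. The bounds \<open>M\<close> and \<open>N\<close> only license differentiation
  along moving test functions and appear in no estimate; so they may depend on
  \<open>\<epsilon>\<close> in the application.\<close>

locale wave_piece =
  fixes \<alpha> \<beta> a R M :: real and N :: nat and D D' E :: "real \<Rightarrow> real functional"
  assumes a: "0 \<le> a" and \<alpha>\<beta>: "\<alpha> \<le> \<beta>"
    and test_linear: "s \<in> {\<alpha>..\<beta>} \<Longrightarrow> test_linear (D s)" "s \<in> {\<alpha>..\<beta>} \<Longrightarrow> test_linear (D' s)"
    and order_bound: "s \<in> {\<alpha>..\<beta>} \<Longrightarrow> order_bound R M N (D s)" "s \<in> {\<alpha>..\<beta>} \<Longrightarrow> order_bound R M N (D' s)"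
    and der: "\<eta> \<in> tests R \<Longrightarrow> s \<in> {\<alpha>..\<beta>} \<Longrightarrow> ((\<lambda>s. D s \<eta>) has_real_derivative D' s \<eta>) (at s within {\<alpha>..\<beta>})"
    and cont': "\<eta> \<in> tests R \<Longrightarrow> continuous_on {\<alpha>..\<beta>} (\<lambda>s. D' s \<eta>)"
    and der': "\<eta> \<in> tests R \<Longrightarrow> s \<in> {\<alpha><..<\<beta>} \<Longrightarrow>
      ((\<lambda>s. D' s \<eta>) has_real_derivative a\<^sup>2 * D s (dv 2 \<eta>) + E s \<eta>) (at s)"
begin

lemma cont: "\<eta> \<in> tests R \<Longrightarrow> continuous_on {\<alpha>..\<beta>} (\<lambda>s. D s \<eta>)"
  using der DERIV_continuous continuous_on_eq_continuous_within by metis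

text \<open>The functional \<open>z s\<close> tests \<open>\<partial>\<^sub>t + a \<partial>\<^sub>x\<close> applied to \<open>D\<close>, integrated by parts.\<close>

definition z :: "real \<Rightarrow> real functional" where
  "z s \<eta> = D' s \<eta> - a * D s (deriv \<eta>)"

text \<open>One half of the factorisation of the wave operator. Along the moving test function both
  parts of \<open>z\<close> produce the terms \<open>a * D'\<close> on the first and
  \<open>a\<^sup>2 * D\<close> on the second derivative of the test function; they cancel, and only
  the source remains.\<close>

lemma characteristic_z:
  assumes s1: "s1 \<in> {\<alpha>..\<beta>}" and \<eta>: "\<eta> \<in> tests R1" and R: "R1 + a * (s1 - \<alpha>) \<le> R"
  shows "continuous_on {\<alpha>..s1} (\<lambda>s. z s (\<lambda>x. \<eta> (x + a * (s - s1))))"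
    and "s \<in> {\<alpha><..<s1} \<Longrightarrow> ((\<lambda>s. z s (\<lambda>x. \<eta> (x + a * (s - s1)))) has_real_derivative
           E s (\<lambda>x. \<eta> (x + a * (s - s1)))) (at s)"
proof -
  have sub: "{\<alpha>..s1} \<subseteq> {\<alpha>..\<beta>}" using s1 by auto
  have R': "R1 + \<bar>a * (s - s1)\<bar> \<le> R" if "s \<in> {\<alpha>..s1}" for s
  proof -
    have "\<bar>a * (s - s1)\<bar> = a * (s1 - s)" using that a by (simp add: abs_mult)
    also have "\<dots> \<le> a * (s1 - \<alpha>)" using that a by (intro mult_left_mono) auto
    finally show ?thesis using R by simp
  qed
  have d\<eta>: "deriv \<eta> \<in> tests R1" using tests_dv[OF \<eta>, of 1] by simp
  have dd: "deriv (\<lambda>x. \<eta> (x + y)) = (\<lambda>x. deriv \<eta> (x + y))" for y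
    using dv_shift[OF \<eta>, of 1 y] by simp
  have zz: "z s (\<lambda>x. \<eta> (x + a * (s - s1))) = D' s (\<lambda>x. \<eta> (x + a * (s - s1))) - a * D s (\<lambda>x. deriv \<eta> (x + a * (s - s1)))" for s
    unfolding z_def dd ..
  have c: "\<zeta> \<in> tests R \<Longrightarrow> continuous_on {\<alpha>..s1} (\<lambda>s. D s \<zeta>)" "\<zeta> \<in> tests R \<Longrightarrow> continuous_on {\<alpha>..s1} (\<lambda>s. D' s \<zeta>)" for \<zeta>
    using cont cont' continuous_on_subset[OF _ sub] by blast+
  show "continuous_on {\<alpha>..s1} (\<lambda>s. z s (\<lambda>x. \<eta> (x + a * (s - s1))))"
    unfolding zz
    using continuous_shifted_test[of "{\<alpha>..s1}" D' R M N, OF _ _ \<eta> R' c(2)]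
       continuous_shifted_test[of "{\<alpha>..s1}" D R M N, OF _ _ d\<eta> R' c(1)] test_linear order_bound sub
    by (intro continuous_intros) (auto simp: subset_iff)
  assume s: "s \<in> {\<alpha><..<s1}"
  then have sS: "s \<in> {\<alpha>..s1}" and at: "at s within {\<alpha>..s1} = at s" "at s within {\<alpha>..\<beta>} = at s"
    using s1 by (auto simp: at_within_Icc_at)
  have t: "(\<lambda>x. \<eta> (x + a * (s - s1))) \<in> tests R" by (rule tests_shift[OF \<eta> R'[OF sS]])
  have dt: "(\<lambda>x. deriv \<eta> (x + a * (s - s1))) \<in> tests R" by (rule tests_shift[OF d\<eta> R'[OF sS]])
  have dv2: "dv 2 (\<lambda>x. \<eta> (x + a * (s - s1))) = (\<lambda>x. deriv (deriv \<eta>) (x + a * (s - s1)))"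
    using dv_shift[OF \<eta>, of 2] by (simp add: numeral_2_eq_2)
  have s\<beta>: "s \<in> {\<alpha><..<\<beta>}" using s s1 by auto
  have 1: "((\<lambda>s. D' s (\<lambda>x. \<eta> (x + a * (s - s1)))) has_real_derivative
     a\<^sup>2 * D s (dv 2 (\<lambda>x. \<eta> (x + a * (s - s1)))) + E s (\<lambda>x. \<eta> (x + a * (s - s1)))
     + a * D' s (\<lambda>x. deriv \<eta> (x + a * (s - s1)))) (at s within {\<alpha>..s1})"
    by (rule has_real_derivative_shifted_test[of _ D' R M N, OF _ _ \<eta> R' _ c(2) sS])
       (use test_linear order_bound sub der'[OF t s\<beta>] at in \<open>auto simp: subset_iff\<close>)
  have 2: "((\<lambda>s. D s (\<lambda>x. deriv \<eta> (x + a * (s - s1)))) has_real_derivative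
     D' s (\<lambda>x. deriv \<eta> (x + a * (s - s1)))
     + a * D s (\<lambda>x. deriv (deriv \<eta>) (x + a * (s - s1)))) (at s within {\<alpha>..s1})"
    by (rule has_real_derivative_shifted_test[of _ D R M N, OF _ _ d\<eta> R' _ c(1) sS])
       (use test_linear order_bound sub der[OF dt, of s] s s1 at in \<open>auto simp: subset_iff\<close>)
  show "((\<lambda>s. z s (\<lambda>x. \<eta> (x + a * (s - s1)))) has_real_derivative
           E s (\<lambda>x. \<eta> (x + a * (s - s1)))) (at s)"
    unfolding zz using DERIV_diff[OF 1 DERIV_cmult[OF 2, of a]] unfolding at dv2
    by (rule DERIV_cong) (simp add: algebra_simps power2_eq_square)
qed

text \<open>The other half: when the test function moves in the opposite direction, the time
  derivative of \<open>D\<close> and the derivative caused by the motion combine to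
  \<open>z\<close>. Integrating the bound for \<open>z\<close> therefore bounds
  \<open>D\<close>.\<close>

lemma characteristic_D:
  assumes s1: "s1 \<in> {\<alpha>..\<beta>}" and \<eta>: "\<eta> \<in> tests R1" and R: "R1 + a * (s1 - \<alpha>) \<le> R"
  shows "continuous_on {\<alpha>..s1} (\<lambda>s. D s (\<lambda>x. \<eta> (x + (- a) * (s - s1))))"
    and "s \<in> {\<alpha><..<s1} \<Longrightarrow> ((\<lambda>s. D s (\<lambda>x. \<eta> (x + (- a) * (s - s1)))) has_real_derivative
           z s (\<lambda>x. \<eta> (x + (- a) * (s - s1)))) (at s)"
proof -
  have sub: "{\<alpha>..s1} \<subseteq> {\<alpha>..\<beta>}" using s1 by auto
  have R': "R1 + \<bar>(- a) * (s - s1)\<bar> \<le> R" if "s \<in> {\<alpha>..s1}" for s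
  proof -
    have "\<bar>(- a) * (s - s1)\<bar> = a * (s1 - s)" using that a by (simp add: abs_mult)
    also have "\<dots> \<le> a * (s1 - \<alpha>)" using that a by (intro mult_left_mono) auto
    finally show ?thesis using R by simp
  qed
  have c: "\<zeta> \<in> tests R \<Longrightarrow> continuous_on {\<alpha>..s1} (\<lambda>s. D s \<zeta>)" for \<zeta>
    using cont continuous_on_subset[OF _ sub] by blast
  show "continuous_on {\<alpha>..s1} (\<lambda>s. D s (\<lambda>x. \<eta> (x + (- a) * (s - s1))))"
    using continuous_shifted_test[of "{\<alpha>..s1}" D R M N, OF _ _ \<eta> R' c] test_linear order_bound sub
    by (auto simp: subset_iff)
  assume s: "s \<in> {\<alpha><..<s1}"
  then have sS: "s \<in> {\<alpha>..s1}" and at: "at s within {\<alpha>..s1} = at s" "at s within {\<alpha>..\<beta>} = at s"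
    using s1 by (auto simp: at_within_Icc_at)
  have t: "(\<lambda>x. \<eta> (x + (- a) * (s - s1))) \<in> tests R" by (rule tests_shift[OF \<eta> R'[OF sS]])
  have dd: "deriv (\<lambda>x. \<eta> (x + y)) = (\<lambda>x. deriv \<eta> (x + y))" for y
    using dv_shift[OF \<eta>, of 1 y] by simp
  have 2: "((\<lambda>s. D s (\<lambda>x. \<eta> (x + (- a) * (s - s1)))) has_real_derivative
     D' s (\<lambda>x. \<eta> (x + (- a) * (s - s1)))
     + (- a) * D s (\<lambda>x. deriv \<eta> (x + (- a) * (s - s1)))) (at s within {\<alpha>..s1})"
    by (rule has_real_derivative_shifted_test[of _ D R M N, OF _ _ \<eta> R' _ c sS])
       (use test_linear order_bound sub der[OF t, of s] s s1 at in \<open>auto simp: subset_iff\<close>)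
  then show "((\<lambda>s. D s (\<lambda>x. \<eta> (x + (- a) * (s - s1)))) has_real_derivative
           z s (\<lambda>x. \<eta> (x + (- a) * (s - s1)))) (at s)"
    unfolding z_def dd at by simp
qed

text \<open>
  \<open>\<rho> s\<close> is the radius at time \<open>s\<close> of a backward cone that contains all characteristics. \<open>C1\<close> bounds
  the error away from the end points, \<open>C2\<close> within distance \<open>\<epsilon>\<close> of them.
\<close>

lemma estimate:
  assumes abar: "a \<le> abar" and R: "\<rho> \<alpha> \<le> R" and \<rho>: "\<And>s. \<rho> s = L + abar * (T - s)"
    and C1: "\<And>s \<eta>. s \<in> {\<alpha><..<\<beta>} \<Longrightarrow> \<alpha> + \<epsilon> < s \<Longrightarrow> s < \<beta> - \<epsilon> \<Longrightarrow> \<eta> \<in> test_ball (\<rho> s) A \<Longrightarrow> \<bar>E s \<eta>\<bar> \<le> C1"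
    and C2: "\<And>s \<eta>. s \<in> {\<alpha><..<\<beta>} \<Longrightarrow> \<eta> \<in> test_ball (\<rho> s) A \<Longrightarrow> \<bar>E s \<eta>\<bar> \<le> C2"
    and Z: "\<And>\<eta>. \<eta> \<in> test_ball (\<rho> \<alpha>) A \<Longrightarrow> \<bar>D \<alpha> \<eta>\<bar> \<le> C0" "\<And>\<eta>. \<eta> \<in> test_ball (\<rho> \<alpha>) A \<Longrightarrow> \<bar>D' \<alpha> \<eta>\<bar> \<le> C0"
      "\<And>\<eta>. \<eta> \<in> test_ball (\<rho> \<alpha>) (\<lambda>k. A (k + 1)) \<Longrightarrow> \<bar>D \<alpha> \<eta>\<bar> \<le> C0"
    and nn: "0 \<le> C0" "0 \<le> C1" "0 \<le> C2" "0 \<le> \<epsilon>"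
    and s: "s \<in> {\<alpha>..\<beta>}" and \<eta>: "\<eta> \<in> test_ball (\<rho> s) A"
  shows "\<bar>z s \<eta>\<bar> \<le> (1 + a) * C0 + C1 * (\<beta> - \<alpha>) + 2 * \<epsilon> * C2"
    and "\<bar>D s \<eta>\<bar> \<le> C0 + (\<beta> - \<alpha>) * ((1 + a) * C0 + C1 * (\<beta> - \<alpha>) + 2 * \<epsilon> * C2)"
proof -
  have cone: "(\<lambda>x. \<eta> (x + y)) \<in> test_ball (\<rho> s) A" if "\<eta> \<in> test_ball (\<rho> s1) A" "s \<le> s1" "\<bar>y\<bar> \<le> a * (s1 - s)" for \<eta> s s1 y
  proof (rule test_ball_shift[OF that(1)])
    have "a * (s1 - s) \<le> abar * (s1 - s)" using abar that by (intro mult_right_mono) auto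
    then show "\<rho> s1 + \<bar>y\<bar> \<le> \<rho> s" using that(3) by (simp add: \<rho> algebra_simps)
  qed
  have T: "\<eta> \<in> tests (\<rho> s)" "\<rho> s + a * (s - \<alpha>) \<le> R" if "\<eta> \<in> test_ball (\<rho> s) A" "s \<in> {\<alpha>..\<beta>}" for \<eta> s A
  proof -
    have "a * (s - \<alpha>) \<le> abar * (s - \<alpha>)" using abar that by (intro mult_right_mono) auto
    then show "\<rho> s + a * (s - \<alpha>) \<le> R" using R by (simp add: \<rho> algebra_simps)
    show "\<eta> \<in> tests (\<rho> s)" using that by (simp add: test_ball_def)
  qed
  have zb: "\<bar>z s1 \<eta>\<bar> \<le> (1 + a) * C0 + C1 * (\<beta> - \<alpha>) + 2 * \<epsilon> * C2" if s1: "s1 \<in> {\<alpha>..\<beta>}" and \<eta>: "\<eta> \<in> test_ball (\<rho> s1) A" for s1 \<eta>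
  proof -
    define f where "f s = z s (\<lambda>x. \<eta> (x + a * (s - s1)))" for s
    have ab: "\<bar>a * (s - s1)\<bar> \<le> a * (s1 - s)" if "s \<le> s1" for s using that a by (simp add: abs_mult)
    have "\<bar>f s1 - f \<alpha>\<bar> \<le> C1 * (\<beta> - \<alpha>) + 2 * \<epsilon> * C2"
    proof (rule mean_value_bound_split[where f'="\<lambda>s. E s (\<lambda>x. \<eta> (x + a * (s - s1)))"])
      show "continuous_on {\<alpha>..s1} f" unfolding f_def by (rule characteristic_z(1)[OF s1 T[OF \<eta> s1]])
      show "\<And>s. s \<in> {\<alpha><..<s1} \<Longrightarrow> (f has_real_derivative E s (\<lambda>x. \<eta> (x + a * (s - s1)))) (at s)"
        unfolding f_def by (rule characteristic_z(2)[OF s1 T[OF \<eta> s1]])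
      show "\<And>s. s \<in> {\<alpha><..<s1} \<Longrightarrow> \<bar>E s (\<lambda>x. \<eta> (x + a * (s - s1)))\<bar> \<le> C2"
        by (intro C2 cone[OF \<eta>] ab) (use s1 in auto)
      show "\<And>s. s \<in> {\<alpha><..<s1} \<Longrightarrow> \<alpha> + \<epsilon> < s \<Longrightarrow> s < \<beta> - \<epsilon> \<Longrightarrow> \<bar>E s (\<lambda>x. \<eta> (x + a * (s - s1)))\<bar> \<le> C1"
        by (intro C1 cone[OF \<eta>] ab) (use s1 in auto)
    qed (use s1 nn in auto)
    moreover have "\<bar>f \<alpha>\<bar> \<le> (1 + a) * C0"
    proof -
      define \<zeta> where "\<zeta> = (\<lambda>x. \<eta> (x + a * (\<alpha> - s1)))"
      have \<zeta>: "\<zeta> \<in> test_ball (\<rho> \<alpha>) A" unfolding \<zeta>_def by (rule cone[OF \<eta>]) (use s1 ab in auto)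
      \<comment> \<open>At the initial time \<open>z\<close> contains \<open>D\<close> on the
        derivative of the test function; the third of the assumptions \<open>Z\<close>, with the
        shifted sequence, is made for this term.\<close>
      have d\<zeta>: "deriv \<zeta> \<in> test_ball (\<rho> \<alpha>) (\<lambda>k. A (k + 1))" using test_ball_deriv[OF \<zeta>, of 1] by simp
      have "\<bar>f \<alpha>\<bar> \<le> \<bar>D' \<alpha> \<zeta>\<bar> + a * \<bar>D \<alpha> (deriv \<zeta>)\<bar>"
        unfolding f_def z_def \<zeta>_def[symmetric] using a abs_triangle_ineq4[of "D' \<alpha> \<zeta>" "a * D \<alpha> (deriv \<zeta>)"]
        by (simp add: abs_mult)
      also have "\<dots> \<le> C0 + a * C0" using Z(2)[OF \<zeta>] Z(3)[OF d\<zeta>] a by (intro add_mono mult_left_mono) auto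
      finally show ?thesis by (simp add: algebra_simps)
    qed
    moreover have "f s1 = z s1 \<eta>" by (simp add: f_def)
    ultimately show ?thesis by linarith
  qed
  show "\<bar>z s \<eta>\<bar> \<le> (1 + a) * C0 + C1 * (\<beta> - \<alpha>) + 2 * \<epsilon> * C2" by (rule zb[OF s \<eta>])
  \<comment> \<open>The bound for \<open>z\<close> is uniform over the piece, so the second
    integration costs only the factor \<open>\<beta> - \<alpha>\<close>.\<close>
  define C where "C = (1 + a) * C0 + C1 * (\<beta> - \<alpha>) + 2 * \<epsilon> * C2"
  have C: "0 \<le> C" unfolding C_def using nn a \<alpha>\<beta> by simp
  define f where "f s' = D s' (\<lambda>x. \<eta> (x + (- a) * (s' - s)))" for s'
  have ab: "\<bar>(- a) * (s' - s)\<bar> \<le> a * (s - s')" if "s' \<le> s" for s' using that a by (simp add: abs_mult)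
  have "\<bar>f s - f \<alpha>\<bar> \<le> C * (s - \<alpha>)"
  proof (rule mean_value_bound[where f'="\<lambda>s'. z s' (\<lambda>x. \<eta> (x + (- a) * (s' - s)))"])
    show "continuous_on {\<alpha>..s} f" unfolding f_def by (rule characteristic_D(1)[OF s T[OF \<eta> s]])
    show "\<And>s'. s' \<in> {\<alpha><..<s} \<Longrightarrow> (f has_real_derivative z s' (\<lambda>x. \<eta> (x + (- a) * (s' - s)))) (at s')"
      unfolding f_def by (rule characteristic_D(2)[OF s T[OF \<eta> s]])
    show "\<And>s'. s' \<in> {\<alpha><..<s} \<Longrightarrow> \<bar>z s' (\<lambda>x. \<eta> (x + (- a) * (s' - s)))\<bar> \<le> C"
      unfolding C_def by (intro zb cone[OF \<eta>] ab) (use s in auto)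
  qed (use s C in auto)
  also have "\<dots> \<le> C * (\<beta> - \<alpha>)" using C s by (intro mult_left_mono) auto
  finally have "\<bar>f s - f \<alpha>\<bar> \<le> C * (\<beta> - \<alpha>)" .
  moreover have "\<bar>f \<alpha>\<bar> \<le> C0" unfolding f_def by (intro Z(1) cone[OF \<eta>] ab) (use s in auto)
  moreover have "f s = D s \<eta>" by (simp add: f_def)
  ultimately show "\<bar>D s \<eta>\<bar> \<le> C0 + (\<beta> - \<alpha>) * ((1 + a) * C0 + C1 * (\<beta> - \<alpha>) + 2 * \<epsilon> * C2)"
    unfolding C_def[symmetric] by (simp add: mult.commute)
qed

end

section \<open>Bootstrapping the rate of convergence\<close>

lemma test_linear_minus:
  assumes "test_linear v" "test_linear w" shows "test_linear (\<lambda>\<eta>. v \<eta> - w \<eta>)"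
  using assms unfolding test_linear_def by (simp add: algebra_simps)

lemma order_bound_minus:
  assumes "order_bound R M N v" "order_bound R M' N' w"
  shows "order_bound R (\<bar>M\<bar> + \<bar>M'\<bar>) (max N N') (\<lambda>\<eta>. v \<eta> - w \<eta>)"
proof -
  have "order_bound R (\<bar>M\<bar>) (max N N') v" "order_bound R (\<bar>M'\<bar>) (max N N') w"
    using order_bound_mono[OF assms(1)] order_bound_mono[OF assms(2)] by simp_all
  then show ?thesis
    unfolding order_bound_def distrib_right by (meson abs_triangle_ineq4 add_mono order_trans)
qed

lemma eventually_unit: "\<forall>\<^sub>F \<epsilon> in at_right (0::real). \<epsilon> \<in> {0<..1}"
  using eventually_at_right_real[OF zero_less_one] by eventually_elim auto

text \<open>
  All estimates stay inside the cone of radius \<open>\<rho> s\<close>. This is what makes the exponent \<open>p\<close> in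
  \<open>P_moderate\<close> independent of the number of bootstrapping steps: a moderate family has a different
  exponent on each compact set.
\<close>

locale wave_approximation =
  fixes m :: nat and \<sigma> a :: "nat \<Rightarrow> real" and T L abar M :: real and N :: nat
    and P P' n :: "real \<Rightarrow> real \<Rightarrow> real functional" and c :: "real \<Rightarrow> real \<Rightarrow> real"
    and u u' :: "real \<Rightarrow> real functional" and \<rho> :: "real \<Rightarrow> real"
  assumes \<rho>: "\<rho> s = L + abar * (T - s)"
    and \<sigma>: "\<sigma> 0 = 0" "j \<le> m \<Longrightarrow> \<sigma> j < \<sigma> (Suc j)" "\<sigma> (Suc m) = T"
    and a_range: "j \<le> m \<Longrightarrow> 0 \<le> a j" "j \<le> m \<Longrightarrow> a j \<le> abar"
    and u_lin: "s \<in> {0..T} \<Longrightarrow> test_linear (u s)" "s \<in> {0..T} \<Longrightarrow> test_linear (u' s)"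
    and u_ctrl: "s \<in> {0..T} \<Longrightarrow> order_bound (\<rho> 0) M N (u s)" "s \<in> {0..T} \<Longrightarrow> order_bound (\<rho> 0) M N (u' s)"
    and u_der: "\<eta> \<in> tests (\<rho> 0) \<Longrightarrow> s \<in> {0..T} \<Longrightarrow> ((\<lambda>s. u s \<eta>) has_real_derivative u' s \<eta>) (at s within {0..T})"
    and u_cont': "\<eta> \<in> tests (\<rho> 0) \<Longrightarrow> continuous_on {0..T} (\<lambda>s. u' s \<eta>)"
    and u_der': "\<eta> \<in> tests (\<rho> 0) \<Longrightarrow> j \<le> m \<Longrightarrow> s \<in> {\<sigma> j<..<\<sigma> (Suc j)} \<Longrightarrow>
      ((\<lambda>s. u' s \<eta>) has_real_derivative (a j)\<^sup>2 * u s (dv 2 \<eta>)) (at s)"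
    and P_lin: "\<epsilon> \<in> {0<..1} \<Longrightarrow> s \<in> {0..T} \<Longrightarrow> test_linear (P \<epsilon> s)" "\<epsilon> \<in> {0<..1} \<Longrightarrow> s \<in> {0..T} \<Longrightarrow> test_linear (P' \<epsilon> s)"
    and P_ctrl: "\<epsilon> \<in> {0<..1} \<Longrightarrow> \<exists>M N. \<forall>s\<in>{0..T}. order_bound (\<rho> 0) M N (P \<epsilon> s) \<and> order_bound (\<rho> 0) M N (P' \<epsilon> s)"
    and P_der: "\<epsilon> \<in> {0<..1} \<Longrightarrow> \<eta> \<in> tests (\<rho> 0) \<Longrightarrow> s \<in> {0..T} \<Longrightarrow>
      ((\<lambda>s. P \<epsilon> s \<eta>) has_real_derivative P' \<epsilon> s \<eta>) (at s within {0..T})"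
    and P_cont': "\<epsilon> \<in> {0<..1} \<Longrightarrow> \<eta> \<in> tests (\<rho> 0) \<Longrightarrow> continuous_on {0..T} (\<lambda>s. P' \<epsilon> s \<eta>)"
    and P_der': "\<epsilon> \<in> {0<..1} \<Longrightarrow> \<eta> \<in> tests (\<rho> 0) \<Longrightarrow> s \<in> {0<..<T} \<Longrightarrow>
      ((\<lambda>s. P' \<epsilon> s \<eta>) has_real_derivative (c \<epsilon> s)\<^sup>2 * P \<epsilon> s (dv 2 \<eta>) + n \<epsilon> s \<eta>) (at s)"
    and c_bounded: "\<exists>B. \<forall>\<epsilon>\<in>{0<..1}. \<forall>s\<in>{0..T}. \<bar>c \<epsilon> s\<bar> \<le> B"
    and c_const: "\<epsilon> \<in> {0<..1} \<Longrightarrow> j \<le> m \<Longrightarrow> s \<in> {\<sigma> j<..<\<sigma> (Suc j)} \<Longrightarrow> \<sigma> j + \<epsilon> < s \<Longrightarrow> s < \<sigma> (Suc j) - \<epsilon> \<Longrightarrow> c \<epsilon> s = a j"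
    and n_small: "\<exists>C. \<forall>\<^sub>F \<epsilon> in at_right 0. \<forall>s\<in>{0..T}. \<forall>\<eta>\<in>test_ball (\<rho> s) A. \<bar>n \<epsilon> s \<eta>\<bar> \<le> C * \<epsilon>"
    and P_moderate: "\<exists>p. \<forall>A. \<exists>C. \<forall>\<^sub>F \<epsilon> in at_right 0. \<forall>s\<in>{0..T}. \<forall>\<eta>\<in>test_ball (\<rho> s) A. \<bar>P \<epsilon> s \<eta>\<bar> \<le> C * (1 / \<epsilon>) ^ p"
    and init: "\<exists>C. \<forall>\<^sub>F \<epsilon> in at_right 0. \<forall>\<eta>\<in>test_ball (\<rho> 0) A. \<bar>P \<epsilon> 0 \<eta> - u 0 \<eta>\<bar> \<le> C * \<epsilon>"
      "\<exists>C. \<forall>\<^sub>F \<epsilon> in at_right 0. \<forall>\<eta>\<in>test_ball (\<rho> 0) A. \<bar>P' \<epsilon> 0 \<eta> - u' 0 \<eta>\<bar> \<le> C * \<epsilon>"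
begin

text \<open>The constant may depend on \<open>A\<close>, the rate \<open>r\<close> may not. Asking
  for all \<open>A\<close> makes the notion stable under derivatives of the test functions.\<close>

definition rate :: "(real \<Rightarrow> real) \<Rightarrow> real set \<Rightarrow> (real \<Rightarrow> real \<Rightarrow> real functional) \<Rightarrow> bool" where
  "rate r S F \<longleftrightarrow> (\<forall>A. \<exists>C. \<forall>\<^sub>F \<epsilon> in at_right 0. \<forall>s\<in>S. \<forall>\<eta>\<in>test_ball (\<rho> s) A. \<bar>F \<epsilon> s \<eta>\<bar> \<le> C * r \<epsilon>)"

abbreviation D where "D \<epsilon> s \<eta> \<equiv> P \<epsilon> s \<eta> - u s \<eta>"
abbreviation D' where "D' \<epsilon> s \<eta> \<equiv> P' \<epsilon> s \<eta> - u' s \<eta>"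
text \<open>The difference of the two equations, arranged such that the speed \<open>a j\<close>
  acts on \<open>D\<close>. The mismatch of the speeds then acts on \<open>P\<close>, which is
  estimated through \<open>D\<close> and \<open>u\<close>.\<close>

abbreviation E where "E j \<epsilon> s \<eta> \<equiv> ((c \<epsilon> s)\<^sup>2 - (a j)\<^sup>2) * P \<epsilon> s (dv 2 \<eta>) + n \<epsilon> s \<eta>"

lemma rateD:
  assumes "rate r S F" and r: "\<And>\<epsilon>. \<epsilon> \<in> {0<..1} \<Longrightarrow> 0 \<le> r \<epsilon>"
  obtains C where "0 \<le> C" "\<forall>\<^sub>F \<epsilon> in at_right 0. \<forall>s\<in>S. \<forall>\<eta>\<in>test_ball (\<rho> s) A. \<bar>F \<epsilon> s \<eta>\<bar> \<le> C * r \<epsilon>"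
proof -
  obtain C where C: "\<forall>\<^sub>F \<epsilon> in at_right 0. \<forall>s\<in>S. \<forall>\<eta>\<in>test_ball (\<rho> s) A. \<bar>F \<epsilon> s \<eta>\<bar> \<le> C * r \<epsilon>"
    using assms unfolding rate_def by blast
  have "\<forall>\<^sub>F \<epsilon> in at_right 0. \<forall>s\<in>S. \<forall>\<eta>\<in>test_ball (\<rho> s) A. \<bar>F \<epsilon> s \<eta>\<bar> \<le> \<bar>C\<bar> * r \<epsilon>"
    using C eventually_unit
  proof eventually_elim
    case (elim \<epsilon>)
    have "C * r \<epsilon> \<le> \<bar>C\<bar> * r \<epsilon>" using r[OF elim(2)] by (intro mult_right_mono) auto
    then show ?case using elim(1) by (meson order_trans)
  qed
  then show ?thesis using that[of "\<bar>C\<bar>"] by simp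
qed

lemma abar: "0 \<le> abar" using a_range[of 0] by simp

lemma \<sigma>_nonneg: "0 \<le> \<sigma> j" if "j \<le> Suc m" for j
  using that
proof (induction j)
  case (Suc j) then show ?case using \<sigma>(2)[of j] by simp
qed (simp add: \<sigma>(1))

lemma \<sigma>T: "j \<le> Suc m \<Longrightarrow> \<sigma> j \<le> T"
proof (induction rule: inc_induct)
  case base then show ?case using \<sigma>(3) by simp
next
  case (step j) then show ?case using \<sigma>(2)[of j] by simp
qed

lemma \<rho>_mono: "s \<ge> 0 \<Longrightarrow> \<rho> s \<le> \<rho> 0"
  using abar by (simp add: \<rho> mult_left_mono)

lemma u_bound:
  obtains C where "0 \<le> C" "\<And>s \<eta>. s \<in> {0..T} \<Longrightarrow> \<eta> \<in> test_ball (\<rho> s) A \<Longrightarrow> \<bar>u s \<eta>\<bar> \<le> C"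
proof
  show "0 \<le> \<bar>M\<bar> * (\<Sum>k\<le>N. \<bar>A k\<bar>)" by (simp add: sum_nonneg)
  fix s \<eta> assume s: "s \<in> {0..T}" and \<eta>: "\<eta> \<in> test_ball (\<rho> s) A"
  have t: "\<eta> \<in> tests (\<rho> 0)" using \<eta> s \<rho>_mono[of s] tests_mono by (auto simp: test_ball_def)
  have "order_bound (\<rho> 0) \<bar>M\<bar> N (u s)" using order_bound_mono[OF u_ctrl(1)[OF s]] by simp
  then show "\<bar>u s \<eta>\<bar> \<le> \<bar>M\<bar> * (\<Sum>k\<le>N. \<bar>A k\<bar>)"
  proof (rule order_boundD[OF _ t])
    fix k x assume "k \<le> N"
    then have "\<bar>A k\<bar> \<le> (\<Sum>k\<le>N. \<bar>A k\<bar>)" by (intro member_le_sum) auto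
    moreover have "\<bar>dv k \<eta> x\<bar> \<le> A k" using \<eta> by (simp add: test_ball_def)
    ultimately show "\<bar>dv k \<eta> x\<bar> \<le> (\<Sum>k\<le>N. \<bar>A k\<bar>)" by linarith
  qed
qed

lemma piece: 
  assumes j: "j \<le> m" and \<epsilon>: "\<epsilon> \<in> {0<..1}"
  shows "\<exists>M' N'. wave_piece (\<sigma> j) (\<sigma> (Suc j)) (a j) (\<rho> 0) M' N' (D \<epsilon>) (D' \<epsilon>) (E j \<epsilon>)"
proof -
  obtain M1 N1 where MN: "\<forall>s\<in>{0..T}. order_bound (\<rho> 0) M1 N1 (P \<epsilon> s) \<and> order_bound (\<rho> 0) M1 N1 (P' \<epsilon> s)"
    using P_ctrl[OF \<epsilon>] by blast
  have sub: "{\<sigma> j..\<sigma> (Suc j)} \<subseteq> {0..T}" using \<sigma>_nonneg[of j] \<sigma>T[of "Suc j"] j by auto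
  have "wave_piece (\<sigma> j) (\<sigma> (Suc j)) (a j) (\<rho> 0) (\<bar>M1\<bar> + \<bar>M\<bar>) (max N1 N) (D \<epsilon>) (D' \<epsilon>) (E j \<epsilon>)"
  proof
    fix \<eta> s assume \<eta>: "\<eta> \<in> tests (\<rho> 0)"
    {
      assume s: "s \<in> {\<sigma> j..\<sigma> (Suc j)}"
      show "((\<lambda>s. D \<epsilon> s \<eta>) has_real_derivative D' \<epsilon> s \<eta>) (at s within {\<sigma> j..\<sigma> (Suc j)})"
        by (rule has_field_derivative_subset[OF DERIV_diff[OF P_der[OF \<epsilon> \<eta>] u_der[OF \<eta>]] sub])
           (use s sub in auto)
    next
      assume s: "s \<in> {\<sigma> j<..<\<sigma> (Suc j)}"
      then have "s \<in> {0<..<T}" using \<sigma>_nonneg[of j] \<sigma>T[of "Suc j"] j by auto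
      note DERIV_diff[OF P_der'[OF \<epsilon> \<eta> this] u_der'[OF \<eta> j s]]
      then show "((\<lambda>s. D' \<epsilon> s \<eta>) has_real_derivative (a j)\<^sup>2 * D \<epsilon> s (dv 2 \<eta>) + E j \<epsilon> s \<eta>) (at s)"
        by (rule DERIV_cong) (simp add: algebra_simps)
    }
    show "continuous_on {\<sigma> j..\<sigma> (Suc j)} (\<lambda>s. D' \<epsilon> s \<eta>)"
      by (rule continuous_on_subset[OF continuous_on_diff[OF P_cont'[OF \<epsilon> \<eta>] u_cont'[OF \<eta>]] sub])
  next
    fix s assume s: "s \<in> {\<sigma> j..\<sigma> (Suc j)}"
    then have s: "s \<in> {0..T}" using sub by blast
    show "test_linear (D \<epsilon> s)" "test_linear (D' \<epsilon> s)" using test_linear_minus P_lin[OF \<epsilon> s] u_lin[OF s] by blast+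
    show "order_bound (\<rho> 0) (\<bar>M1\<bar> + \<bar>M\<bar>) (max N1 N) (D \<epsilon> s)" "order_bound (\<rho> 0) (\<bar>M1\<bar> + \<bar>M\<bar>) (max N1 N) (D' \<epsilon> s)"
      using order_bound_minus MN u_ctrl[OF s] s by blast+
  qed (use a_range \<sigma> j in \<open>auto simp: less_imp_le\<close>)
  then show ?thesis by blast
qed

text \<open>Since \<open>u\<close> is bounded and \<open>1 \<le> q\<close>, also
  \<open>P = O(q)\<close>, and this on second derivatives too because the rate of \<open>D\<close>
  holds for all \<open>A\<close>. Inside the layers the difference of the squared speeds is merely
  bounded; away from them it vanishes and leaves the negligible term, which is
  \<open>O(\<epsilon>)\<close> and so \<open>O(\<epsilon> * q)\<close>.\<close>

lemma rate_error:
  assumes j: "j \<le> m" and q: "\<And>\<epsilon>. \<epsilon> \<in> {0<..1} \<Longrightarrow> 1 \<le> q \<epsilon>" and Dq: "rate q {0..T} D"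
  obtains K Cn where "0 \<le> K" "0 \<le> Cn" "\<forall>\<^sub>F \<epsilon> in at_right 0. \<forall>s\<in>{\<sigma> j<..<\<sigma> (Suc j)}. \<forall>\<eta>\<in>test_ball (\<rho> s) A.
    \<bar>E j \<epsilon> s \<eta>\<bar> \<le> K * q \<epsilon> \<and> (\<sigma> j + \<epsilon> < s \<longrightarrow> s < \<sigma> (Suc j) - \<epsilon> \<longrightarrow> \<bar>E j \<epsilon> s \<eta>\<bar> \<le> Cn * (\<epsilon> * q \<epsilon>))"
proof -
  have q0: "\<And>\<epsilon>. \<epsilon> \<in> {0<..1} \<Longrightarrow> 0 \<le> q \<epsilon>" using q by (meson order_trans zero_le_one)
  define A2 where "A2 = (\<lambda>k. A (k + 2))"
  obtain CD where CD: "0 \<le> CD" "\<forall>\<^sub>F \<epsilon> in at_right 0. \<forall>s\<in>{0..T}. \<forall>\<eta>\<in>test_ball (\<rho> s) A2. \<bar>D \<epsilon> s \<eta>\<bar> \<le> CD * q \<epsilon>"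
    using rateD[OF Dq q0] by blast
  have "rate (\<lambda>\<epsilon>. \<epsilon>) {0..T} n" unfolding rate_def using n_small by blast
  then obtain Cn where Cn: "0 \<le> Cn" "\<forall>\<^sub>F \<epsilon> in at_right 0. \<forall>s\<in>{0..T}. \<forall>\<eta>\<in>test_ball (\<rho> s) A. \<bar>n \<epsilon> s \<eta>\<bar> \<le> Cn * \<epsilon>"
    using rateD[of "\<lambda>\<epsilon>. \<epsilon>" "{0..T}" n A] by auto
  obtain B0 where B0: "\<forall>\<epsilon>\<in>{0<..1}. \<forall>s\<in>{0..T}. \<bar>c \<epsilon> s\<bar> \<le> B0" using c_bounded by blast
  obtain Cu where Cu0: "0 \<le> Cu" and Cu: "\<And>s \<eta>. s \<in> {0..T} \<Longrightarrow> \<eta> \<in> test_ball (\<rho> s) A2 \<Longrightarrow> \<bar>u s \<eta>\<bar> \<le> Cu"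
    using u_bound by blast
  define K where "K = (B0\<^sup>2 + (a j)\<^sup>2) * (CD + Cu) + Cn"
  show thesis
  proof (rule that[of K Cn])
    show "0 \<le> K" "0 \<le> Cn" using CD Cn Cu0 by (auto simp: K_def)
    show "\<forall>\<^sub>F \<epsilon> in at_right 0. \<forall>s\<in>{\<sigma> j<..<\<sigma> (Suc j)}. \<forall>\<eta>\<in>test_ball (\<rho> s) A.
      \<bar>E j \<epsilon> s \<eta>\<bar> \<le> K * q \<epsilon> \<and> (\<sigma> j + \<epsilon> < s \<longrightarrow> s < \<sigma> (Suc j) - \<epsilon> \<longrightarrow> \<bar>E j \<epsilon> s \<eta>\<bar> \<le> Cn * (\<epsilon> * q \<epsilon>))"
      using CD(2) Cn(2) eventually_unit
    proof eventually_elim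
      case (elim \<epsilon>)
      show ?case
      proof (intro ballI conjI impI)
        fix s \<eta> assume s: "s \<in> {\<sigma> j<..<\<sigma> (Suc j)}" and \<eta>: "\<eta> \<in> test_ball (\<rho> s) A"
        have sT: "s \<in> {0..T}" using s \<sigma>_nonneg[of j] \<sigma>T[of "Suc j"] j by auto
        have \<eta>2: "dv 2 \<eta> \<in> test_ball (\<rho> s) A2" unfolding A2_def by (rule test_ball_deriv[OF \<eta>])
        have q1: "1 \<le> q \<epsilon>" by (rule q[OF elim(3)])
        have nb: "\<bar>n \<epsilon> s \<eta>\<bar> \<le> Cn * \<epsilon>" using elim(2) sT \<eta> by blast
        have "Cu \<le> Cu * q \<epsilon>" using q1 Cu0 by (simp add: mult_le_cancel_left1)
        moreover have "\<bar>P \<epsilon> s (dv 2 \<eta>)\<bar> \<le> \<bar>D \<epsilon> s (dv 2 \<eta>)\<bar> + \<bar>u s (dv 2 \<eta>)\<bar>" by linarith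
        ultimately have Pb: "\<bar>P \<epsilon> s (dv 2 \<eta>)\<bar> \<le> (CD + Cu) * q \<epsilon>"
          using elim(1)[rule_format, OF sT \<eta>2] Cu[OF sT \<eta>2] by (simp add: algebra_simps)
        have "\<bar>c \<epsilon> s\<bar> \<le> B0" using B0 elim(3) sT by blast
        then have "(c \<epsilon> s)\<^sup>2 \<le> B0\<^sup>2" using abs_le_square_iff[of "c \<epsilon> s" B0] by linarith
        then have cb: "\<bar>(c \<epsilon> s)\<^sup>2 - (a j)\<^sup>2\<bar> \<le> B0\<^sup>2 + (a j)\<^sup>2"
          using zero_le_power2[of "c \<epsilon> s"] zero_le_power2[of "a j"] by linarith
        have nq: "Cn * \<epsilon> \<le> Cn * q \<epsilon>" using q1 elim(3) Cn(1) by (intro mult_left_mono) auto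
        have "\<bar>E j \<epsilon> s \<eta>\<bar> \<le> \<bar>(c \<epsilon> s)\<^sup>2 - (a j)\<^sup>2\<bar> * \<bar>P \<epsilon> s (dv 2 \<eta>)\<bar> + \<bar>n \<epsilon> s \<eta>\<bar>"
          by (metis abs_mult abs_triangle_ineq)
        also have "\<dots> \<le> (B0\<^sup>2 + (a j)\<^sup>2) * ((CD + Cu) * q \<epsilon>) + Cn * q \<epsilon>"
          using cb Pb nb nq by (intro add_mono mult_mono) auto
        finally show "\<bar>E j \<epsilon> s \<eta>\<bar> \<le> K * q \<epsilon>" by (simp add: K_def algebra_simps)
        assume "\<sigma> j + \<epsilon> < s" "s < \<sigma> (Suc j) - \<epsilon>"
        then have "c \<epsilon> s = a j" using c_const[OF elim(3) j s] by blast
        then have "\<bar>E j \<epsilon> s \<eta>\<bar> \<le> Cn * \<epsilon>" using nb by simp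
        also have "\<dots> \<le> Cn * (\<epsilon> * q \<epsilon>)" using Cn(1) q1 elim(3) by (intro mult_left_mono) auto
        finally show "\<bar>E j \<epsilon> s \<eta>\<bar> \<le> Cn * (\<epsilon> * q \<epsilon>)" .
      qed
    qed
  qed
qed

text \<open>A source of size \<open>q\<close> on layers of length \<open>\<epsilon>\<close> and one
  of size \<open>\<epsilon> * q\<close> elsewhere both contribute \<open>O(\<epsilon> * q)\<close>
  along a characteristic, the same order as the initial error.\<close>

lemma rate_piece:
  assumes j: "j \<le> m" and q: "\<And>\<epsilon>. \<epsilon> \<in> {0<..1} \<Longrightarrow> 1 \<le> q \<epsilon>" and Dq: "rate q {0..T} D"
    and ini: "rate (\<lambda>\<epsilon>. \<epsilon> * q \<epsilon>) {\<sigma> j} D" "rate (\<lambda>\<epsilon>. \<epsilon> * q \<epsilon>) {\<sigma> j} D'"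
  shows "rate (\<lambda>\<epsilon>. \<epsilon> * q \<epsilon>) {\<sigma> j..\<sigma> (Suc j)} D \<and> rate (\<lambda>\<epsilon>. \<epsilon> * q \<epsilon>) {\<sigma> j..\<sigma> (Suc j)} D'"
proof -
  let ?r = "\<lambda>\<epsilon>. \<epsilon> * q \<epsilon>"
  let ?S = "{\<sigma> j..\<sigma> (Suc j)}"
  have q0: "0 \<le> q \<epsilon>" "0 \<le> ?r \<epsilon>" if "\<epsilon> \<in> {0<..1}" for \<epsilon> using q[OF that] that by auto
  have ex: "\<exists>C1 C2. \<forall>\<^sub>F \<epsilon> in at_right 0. \<forall>s\<in>?S. \<forall>\<eta>\<in>test_ball (\<rho> s) A.
     \<bar>D' \<epsilon> s \<eta> - a j * D \<epsilon> s (deriv \<eta>)\<bar> \<le> C1 * ?r \<epsilon> \<and> \<bar>D \<epsilon> s \<eta>\<bar> \<le> C2 * ?r \<epsilon>" for A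
  proof -
    obtain CA where CA: "0 \<le> CA" "\<forall>\<^sub>F \<epsilon> in at_right 0. \<forall>s\<in>{\<sigma> j}. \<forall>\<eta>\<in>test_ball (\<rho> s) A. \<bar>D \<epsilon> s \<eta>\<bar> \<le> CA * ?r \<epsilon>"
      using rateD[OF ini(1) q0(2)] by blast
    obtain CB where CB: "0 \<le> CB" "\<forall>\<^sub>F \<epsilon> in at_right 0. \<forall>s\<in>{\<sigma> j}. \<forall>\<eta>\<in>test_ball (\<rho> s) A. \<bar>D' \<epsilon> s \<eta>\<bar> \<le> CB * ?r \<epsilon>"
      using rateD[OF ini(2) q0(2)] by blast
    obtain CC where CC: "0 \<le> CC" "\<forall>\<^sub>F \<epsilon> in at_right 0. \<forall>s\<in>{\<sigma> j}. \<forall>\<eta>\<in>test_ball (\<rho> s) (\<lambda>k. A (k + 1)). \<bar>D \<epsilon> s \<eta>\<bar> \<le> CC * ?r \<epsilon>"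
      using rateD[OF ini(1) q0(2)] by blast
    obtain K Cn where K: "0 \<le> K" "0 \<le> Cn" "\<forall>\<^sub>F \<epsilon> in at_right 0. \<forall>s\<in>{\<sigma> j<..<\<sigma> (Suc j)}. \<forall>\<eta>\<in>test_ball (\<rho> s) A.
      \<bar>E j \<epsilon> s \<eta>\<bar> \<le> K * q \<epsilon> \<and> (\<sigma> j + \<epsilon> < s \<longrightarrow> s < \<sigma> (Suc j) - \<epsilon> \<longrightarrow> \<bar>E j \<epsilon> s \<eta>\<bar> \<le> Cn * (\<epsilon> * q \<epsilon>))"
      using rate_error[OF j q Dq] by blast
    define C0 where "C0 = CA + CB + CC"
    \<comment> \<open>The summands are the initial values, the source between the layers, and the
      two layers, with \<open>\<epsilon> * q \<epsilon>\<close> factored out of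
      \<open>estimate\<close>. The length \<open>2 * \<epsilon>\<close> of the layers provides the
      \<open>\<epsilon>\<close> that \<open>K * q \<epsilon>\<close> lacks.\<close>
    define C1 where "C1 = (1 + a j) * C0 + Cn * (\<sigma> (Suc j) - \<sigma> j) + 2 * K"
    define C2 where "C2 = C0 + (\<sigma> (Suc j) - \<sigma> j) * C1"
    have "\<forall>\<^sub>F \<epsilon> in at_right 0. \<forall>s\<in>?S. \<forall>\<eta>\<in>test_ball (\<rho> s) A.
        \<bar>D' \<epsilon> s \<eta> - a j * D \<epsilon> s (deriv \<eta>)\<bar> \<le> C1 * ?r \<epsilon> \<and> \<bar>D \<epsilon> s \<eta>\<bar> \<le> C2 * ?r \<epsilon>"
      using CA(2) CB(2) CC(2) K(3) eventually_unit
    proof eventually_elim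
      case (elim \<epsilon>)
      obtain M' N' where "wave_piece (\<sigma> j) (\<sigma> (Suc j)) (a j) (\<rho> 0) M' N' (D \<epsilon>) (D' \<epsilon>) (E j \<epsilon>)"
        using piece[OF j elim(5)] by blast
      then interpret wave_piece "\<sigma> j" "\<sigma> (Suc j)" "a j" "\<rho> 0" M' N' "D \<epsilon>" "D' \<epsilon>" "E j \<epsilon>" .
      have r0: "0 \<le> ?r \<epsilon>" by (rule q0(2)[OF elim(5)])
      have le: "CA * ?r \<epsilon> \<le> C0 * ?r \<epsilon>" "CB * ?r \<epsilon> \<le> C0 * ?r \<epsilon>" "CC * ?r \<epsilon> \<le> C0 * ?r \<epsilon>"
        using r0 CA(1) CB(1) CC(1) unfolding C0_def by (intro mult_right_mono; linarith)+
      have nn: "0 \<le> C0 * ?r \<epsilon>" "0 \<le> Cn * ?r \<epsilon>" "0 \<le> K * q \<epsilon>" "0 \<le> \<epsilon>"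
        using r0 CA(1) CB(1) CC(1) K q0[OF elim(5)] elim(5) by (auto simp: C0_def)
      show ?case
      proof (intro ballI)
        fix s \<eta> assume s: "s \<in> ?S" and \<eta>: "\<eta> \<in> test_ball (\<rho> s) A"
        have e: "0 \<le> \<sigma> j" using \<sigma>_nonneg[of j] j by simp
        have H1: "\<bar>E j \<epsilon> s \<eta>\<bar> \<le> Cn * ?r \<epsilon>"
          if "s \<in> {\<sigma> j<..<\<sigma> (Suc j)}" "\<sigma> j + \<epsilon> < s" "s < \<sigma> (Suc j) - \<epsilon>" "\<eta> \<in> test_ball (\<rho> s) A" for s \<eta>
          using elim(4) that by blast
        have H2: "\<bar>E j \<epsilon> s \<eta>\<bar> \<le> K * q \<epsilon>" if "s \<in> {\<sigma> j<..<\<sigma> (Suc j)}" "\<eta> \<in> test_ball (\<rho> s) A" for s \<eta>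
          using elim(4) that by blast
        have H3: "\<bar>D \<epsilon> (\<sigma> j) \<eta>\<bar> \<le> C0 * ?r \<epsilon>" if "\<eta> \<in> test_ball (\<rho> (\<sigma> j)) A" for \<eta>
          by (rule order_trans[OF _ le(1)]) (rule elim(1)[rule_format, OF singletonI that])
        have H4: "\<bar>D' \<epsilon> (\<sigma> j) \<eta>\<bar> \<le> C0 * ?r \<epsilon>" if "\<eta> \<in> test_ball (\<rho> (\<sigma> j)) A" for \<eta>
          by (rule order_trans[OF _ le(2)]) (rule elim(2)[rule_format, OF singletonI that])
        have H5: "\<bar>D \<epsilon> (\<sigma> j) \<eta>\<bar> \<le> C0 * ?r \<epsilon>" if "\<eta> \<in> test_ball (\<rho> (\<sigma> j)) (\<lambda>k. A (k + 1))" for \<eta>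
          by (rule order_trans[OF _ le(3)]) (rule elim(3)[rule_format, OF singletonI that])
        have eq1: "(1 + a j) * (C0 * ?r \<epsilon>) + (Cn * ?r \<epsilon>) * (\<sigma> (Suc j) - \<sigma> j) + 2 * \<epsilon> * (K * q \<epsilon>) = C1 * ?r \<epsilon>"
          unfolding C1_def by (simp add: algebra_simps)
        have eq2: "C0 * ?r \<epsilon> + (\<sigma> (Suc j) - \<sigma> j) * (C1 * ?r \<epsilon>) = C2 * ?r \<epsilon>"
          unfolding C2_def by (simp add: algebra_simps)
        note est = estimate[OF a_range(2)[OF j] \<rho>_mono[OF e] \<rho> H1 H2 H3 H4 H5 nn s \<eta>]
        show "\<bar>D' \<epsilon> s \<eta> - a j * D \<epsilon> s (deriv \<eta>)\<bar> \<le> C1 * ?r \<epsilon> \<and> \<bar>D \<epsilon> s \<eta>\<bar> \<le> C2 * ?r \<epsilon>"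
          using est unfolding eq1 eq2 z_def by blast
      qed
    qed
    then show ?thesis by blast
  qed
  have 1: "rate ?r ?S D" unfolding rate_def
  proof
    fix A
    obtain C1 C2 where "\<forall>\<^sub>F \<epsilon> in at_right 0. \<forall>s\<in>?S. \<forall>\<eta>\<in>test_ball (\<rho> s) A.
     \<bar>D' \<epsilon> s \<eta> - a j * D \<epsilon> s (deriv \<eta>)\<bar> \<le> C1 * ?r \<epsilon> \<and> \<bar>D \<epsilon> s \<eta>\<bar> \<le> C2 * ?r \<epsilon>" using ex[of A] by blast
    then have "\<forall>\<^sub>F \<epsilon> in at_right 0. \<forall>s\<in>?S. \<forall>\<eta>\<in>test_ball (\<rho> s) A. \<bar>D \<epsilon> s \<eta>\<bar> \<le> C2 * ?r \<epsilon>"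
      by eventually_elim blast
    then show "\<exists>C. \<forall>\<^sub>F \<epsilon> in at_right 0. \<forall>s\<in>?S. \<forall>\<eta>\<in>test_ball (\<rho> s) A. \<bar>D \<epsilon> s \<eta>\<bar> \<le> C * ?r \<epsilon>" ..
  qed
  \<comment> \<open>\<open>D'\<close> is \<open>z\<close> plus \<open>a j\<close> times
    \<open>D\<close> on the derivative of the test function, so the rate of \<open>D\<close> just
    obtained is used with the shifted sequence.\<close>
  have "rate ?r ?S D'" unfolding rate_def
  proof
    fix A
    obtain C1 C2 where C: "\<forall>\<^sub>F \<epsilon> in at_right 0. \<forall>s\<in>?S. \<forall>\<eta>\<in>test_ball (\<rho> s) A.
     \<bar>D' \<epsilon> s \<eta> - a j * D \<epsilon> s (deriv \<eta>)\<bar> \<le> C1 * ?r \<epsilon> \<and> \<bar>D \<epsilon> s \<eta>\<bar> \<le> C2 * ?r \<epsilon>" using ex[of A] by blast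
    obtain C3 where C3: "\<forall>\<^sub>F \<epsilon> in at_right 0. \<forall>s\<in>?S. \<forall>\<eta>\<in>test_ball (\<rho> s) (\<lambda>k. A (k + 1)). \<bar>D \<epsilon> s \<eta>\<bar> \<le> C3 * ?r \<epsilon>"
      using 1 unfolding rate_def by blast
    from C C3 have "\<forall>\<^sub>F \<epsilon> in at_right 0. \<forall>s\<in>?S. \<forall>\<eta>\<in>test_ball (\<rho> s) A. \<bar>D' \<epsilon> s \<eta>\<bar> \<le> (C1 + a j * C3) * ?r \<epsilon>"
    proof eventually_elim
      case (elim \<epsilon>)
      show ?case
      proof (intro ballI)
        fix s \<eta> assume s: "s \<in> ?S" and \<eta>: "\<eta> \<in> test_ball (\<rho> s) A"
        have "deriv \<eta> \<in> test_ball (\<rho> s) (\<lambda>k. A (k + 1))" using test_ball_deriv[OF \<eta>, of 1] by simp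
        then have "a j * \<bar>D \<epsilon> s (deriv \<eta>)\<bar> \<le> a j * (C3 * ?r \<epsilon>)"
          using elim(2) s a_range(1)[OF j] by (intro mult_left_mono) auto
        then have "\<bar>a j * D \<epsilon> s (deriv \<eta>)\<bar> \<le> a j * C3 * ?r \<epsilon>" using a_range(1)[OF j] by (simp add: abs_mult mult.assoc)
        moreover have "\<bar>D' \<epsilon> s \<eta> - a j * D \<epsilon> s (deriv \<eta>)\<bar> \<le> C1 * ?r \<epsilon>" using elim(1) s \<eta> by blast
        ultimately show "\<bar>D' \<epsilon> s \<eta>\<bar> \<le> (C1 + a j * C3) * ?r \<epsilon>" unfolding distrib_right by linarith
      qed
    qed
    then show "\<exists>C. \<forall>\<^sub>F \<epsilon> in at_right 0. \<forall>s\<in>?S. \<forall>\<eta>\<in>test_ball (\<rho> s) A. \<bar>D' \<epsilon> s \<eta>\<bar> \<le> C * ?r \<epsilon>" ..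
  qed
  with 1 show ?thesis ..
qed

lemma rate_mono: "rate r S F \<Longrightarrow> S' \<subseteq> S \<Longrightarrow> rate r S' F"
  unfolding rate_def by (elim all_forward ex_forward) (erule eventually_mono, blast)

lemma rate_Un:
  assumes "rate r S F" "rate r S' F" and r: "\<And>\<epsilon>. \<epsilon> \<in> {0<..1} \<Longrightarrow> 0 \<le> r \<epsilon>"
  shows "rate r (S \<union> S') F"
  unfolding rate_def
proof
  fix A
  obtain C where C: "\<forall>\<^sub>F \<epsilon> in at_right 0. \<forall>s\<in>S. \<forall>\<eta>\<in>test_ball (\<rho> s) A. \<bar>F \<epsilon> s \<eta>\<bar> \<le> C * r \<epsilon>"
    using assms(1) unfolding rate_def by blast
  obtain C' where C': "\<forall>\<^sub>F \<epsilon> in at_right 0. \<forall>s\<in>S'. \<forall>\<eta>\<in>test_ball (\<rho> s) A. \<bar>F \<epsilon> s \<eta>\<bar> \<le> C' * r \<epsilon>"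
    using assms(2) unfolding rate_def by blast
  from C C' eventually_unit have "\<forall>\<^sub>F \<epsilon> in at_right 0. \<forall>s\<in>S \<union> S'. \<forall>\<eta>\<in>test_ball (\<rho> s) A. \<bar>F \<epsilon> s \<eta>\<bar> \<le> max C C' * r \<epsilon>"
  proof eventually_elim
    case (elim \<epsilon>)
    have "C * r \<epsilon> \<le> max C C' * r \<epsilon>" "C' * r \<epsilon> \<le> max C C' * r \<epsilon>"
      using r[OF elim(3)] by (auto intro!: mult_right_mono)
    then show ?case using elim(1,2) by (meson UnE order_trans)
  qed
  then show "\<exists>C. \<forall>\<^sub>F \<epsilon> in at_right 0. \<forall>s\<in>S \<union> S'. \<forall>\<eta>\<in>test_ball (\<rho> s) A. \<bar>F \<epsilon> s \<eta>\<bar> \<le> C * r \<epsilon>" ..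
qed

text \<open>Induction over the jump times: the bounds for \<open>D\<close> and \<open>D'\<close> at
  the end of one piece are the initial bounds for the next. At time \<open>0\<close> the data error
  is \<open>O(\<epsilon>)\<close>, hence \<open>O(\<epsilon> * q)\<close> because \<open>q\<close>
  is at least \<open>1\<close>.\<close>

lemma rate_improve:
  assumes q: "\<And>\<epsilon>. \<epsilon> \<in> {0<..1} \<Longrightarrow> 1 \<le> q \<epsilon>" and Dq: "rate q {0..T} D"
  shows "rate (\<lambda>\<epsilon>. \<epsilon> * q \<epsilon>) {0..T} D"
proof -
  let ?r = "\<lambda>\<epsilon>. \<epsilon> * q \<epsilon>"
  have r0: "0 \<le> ?r \<epsilon>" if "\<epsilon> \<in> {0<..1}" for \<epsilon> using q[OF that] that by auto
  have i: "rate ?r {0} F" if h: "\<And>A. \<exists>C. \<forall>\<^sub>F \<epsilon> in at_right 0. \<forall>\<eta>\<in>test_ball (\<rho> 0) A. \<bar>F \<epsilon> 0 \<eta>\<bar> \<le> C * \<epsilon>" for F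
    unfolding rate_def
  proof
    fix A
    obtain C where "\<forall>\<^sub>F \<epsilon> in at_right 0. \<forall>\<eta>\<in>test_ball (\<rho> 0) A. \<bar>F \<epsilon> 0 \<eta>\<bar> \<le> C * \<epsilon>" using h by blast
    then have "\<forall>\<^sub>F \<epsilon> in at_right 0. \<forall>s\<in>{0}. \<forall>\<eta>\<in>test_ball (\<rho> s) A. \<bar>F \<epsilon> s \<eta>\<bar> \<le> \<bar>C\<bar> * ?r \<epsilon>"
      using eventually_unit
    proof eventually_elim
      case (elim \<epsilon>)
      have "C * \<epsilon> \<le> \<bar>C\<bar> * \<epsilon>" using elim by (intro mult_right_mono) auto
      also have "\<dots> \<le> \<bar>C\<bar> * ?r \<epsilon>" using elim q[OF elim(2)] by (intro mult_left_mono) auto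
      finally show ?case using elim(1) by (auto intro: order_trans)
    qed
    then show "\<exists>C. \<forall>\<^sub>F \<epsilon> in at_right 0. \<forall>s\<in>{0}. \<forall>\<eta>\<in>test_ball (\<rho> s) A. \<bar>F \<epsilon> s \<eta>\<bar> \<le> C * ?r \<epsilon>" ..
  qed
  have "rate ?r {0..\<sigma> j} D \<and> rate ?r {0..\<sigma> j} D'" if "j \<le> Suc m" for j
    using that
  proof (induction j)
    case 0
    then show ?case using i[of D, OF init(1)] i[of D', OF init(2)] \<sigma>(1) by simp
  next
    case (Suc j)
    then have IH: "rate ?r {0..\<sigma> j} D" "rate ?r {0..\<sigma> j} D'" and j: "j \<le> m" by auto
    have "0 \<le> \<sigma> j" using \<sigma>_nonneg j by simp
    then have m: "\<sigma> j \<in> {0..\<sigma> j}" by simp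
    note st = rate_piece[OF j q Dq rate_mono[OF IH(1)] rate_mono[OF IH(2)]]
    have eq: "{0..\<sigma> (Suc j)} = {0..\<sigma> j} \<union> {\<sigma> j..\<sigma> (Suc j)}"
      using m \<sigma>(2)[OF j] by (simp add: ivl_disj_un_two_touch(4) less_imp_le)
    show ?case unfolding eq using st m by (intro conjI rate_Un IH r0) auto
  qed
  from this[of "Suc m"] show ?thesis using \<sigma>(3) by simp
qed

text \<open>Each improvement removes one factor \<open>1 / \<epsilon>\<close>. After
  \<open>p\<close> of them the rate is \<open>1\<close>, and a last one gives
  \<open>\<epsilon>\<close>; there the iteration ends, because \<open>rate_improve\<close> starts
  from rates of at least \<open>1\<close>. The exponent \<open>p\<close> is fixed before
  \<open>A\<close>, so the number of steps is too.\<close>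

theorem convergence: "\<exists>C. \<forall>\<^sub>F \<epsilon> in at_right 0. \<forall>s\<in>{0..T}. \<forall>\<eta>\<in>test_ball (\<rho> s) A. \<bar>D \<epsilon> s \<eta>\<bar> \<le> C * \<epsilon>"
proof -
  obtain p where p: "\<And>A. \<exists>C. \<forall>\<^sub>F \<epsilon> in at_right 0. \<forall>s\<in>{0..T}. \<forall>\<eta>\<in>test_ball (\<rho> s) A. \<bar>P \<epsilon> s \<eta>\<bar> \<le> C * (1 / \<epsilon>) ^ p"
    using P_moderate by blast
  have ge1: "1 \<le> (1 / \<epsilon>) ^ k" if "\<epsilon> \<in> {0<..1}" for \<epsilon> :: real and k
    using that by (intro one_le_power) auto
  have "rate (\<lambda>\<epsilon>. (1 / \<epsilon>) ^ p) {0..T} D"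
    unfolding rate_def
  proof
    fix A
    obtain C where C: "\<forall>\<^sub>F \<epsilon> in at_right 0. \<forall>s\<in>{0..T}. \<forall>\<eta>\<in>test_ball (\<rho> s) A. \<bar>P \<epsilon> s \<eta>\<bar> \<le> C * (1 / \<epsilon>) ^ p"
      using p by blast
    obtain Cu where Cu0: "0 \<le> Cu" and Cu: "\<And>s \<eta>. s \<in> {0..T} \<Longrightarrow> \<eta> \<in> test_ball (\<rho> s) A \<Longrightarrow> \<bar>u s \<eta>\<bar> \<le> Cu"
      using u_bound by blast
    have "\<forall>\<^sub>F \<epsilon> in at_right 0. \<forall>s\<in>{0..T}. \<forall>\<eta>\<in>test_ball (\<rho> s) A. \<bar>D \<epsilon> s \<eta>\<bar> \<le> (C + Cu) * (1 / \<epsilon>) ^ p"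
      using C eventually_unit
    proof eventually_elim
      case (elim \<epsilon>)
      have "Cu * 1 \<le> Cu * (1 / \<epsilon>) ^ p" using Cu0 ge1[OF elim(2)] by (intro mult_left_mono) auto
      then show ?case using elim(1) Cu by (fastforce simp: distrib_right)
    qed
    then show "\<exists>C. \<forall>\<^sub>F \<epsilon> in at_right 0. \<forall>s\<in>{0..T}. \<forall>\<eta>\<in>test_ball (\<rho> s) A. \<bar>D \<epsilon> s \<eta>\<bar> \<le> C * (1 / \<epsilon>) ^ p" ..
  qed
  then have "rate (\<lambda>\<epsilon>. (1 / \<epsilon>) ^ 0) {0..T} D"
  proof (induction p)
    case (Suc p)
    have "rate (\<lambda>\<epsilon>. \<epsilon> * (1 / \<epsilon>) ^ Suc p) {0..T} D" by (rule rate_improve[OF ge1 Suc.prems])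
    moreover have "rate (\<lambda>\<epsilon>. (1 / \<epsilon>) ^ p) {0..T} D" if b: "rate (\<lambda>\<epsilon>. \<epsilon> * (1 / \<epsilon>) ^ Suc p) {0..T} D"
      unfolding rate_def
    proof
      fix A
      obtain C where C: "\<forall>\<^sub>F \<epsilon> in at_right 0. \<forall>s\<in>{0..T}. \<forall>\<eta>\<in>test_ball (\<rho> s) A. \<bar>D \<epsilon> s \<eta>\<bar> \<le> C * (\<epsilon> * (1 / \<epsilon>) ^ Suc p)"
        using b unfolding rate_def by blast
      then have "\<forall>\<^sub>F \<epsilon> in at_right 0. \<forall>s\<in>{0..T}. \<forall>\<eta>\<in>test_ball (\<rho> s) A. \<bar>D \<epsilon> s \<eta>\<bar> \<le> C * (1 / \<epsilon>) ^ p"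
        using eventually_unit by eventually_elim simp
      then show "\<exists>C. \<forall>\<^sub>F \<epsilon> in at_right 0. \<forall>s\<in>{0..T}. \<forall>\<eta>\<in>test_ball (\<rho> s) A. \<bar>D \<epsilon> s \<eta>\<bar> \<le> C * (1 / \<epsilon>) ^ p" ..
    qed
    ultimately show ?case using Suc.IH by blast
  qed
  then have "rate (\<lambda>\<epsilon>. \<epsilon> * (1 / \<epsilon>) ^ 0) {0..T} D" by (intro rate_improve) auto
  then show ?thesis unfolding rate_def by simp
qed

end

section \<open>Estimates of order zero for Colombeau families\<close>

text \<open>At the points of an accessible set the one-sided derivatives relative to it are unique.\<close>

definition accessible :: "'a::euclidean_space set \<Rightarrow> bool" where
  "accessible X \<longleftrightarrow> (\<forall>x\<in>X. \<forall>b\<in>Basis. at (0::real) within {h. x + h *\<^sub>R b \<in> X} \<noteq> bot)"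

lemma accessible_UNIV: "accessible UNIV"
  by (simp add: accessible_def)

lemma accessible_half_space: "accessible half_space"
  unfolding accessible_def
proof (intro ballI)
  fix p b :: "real \<times> real" assume p: "p \<in> half_space" and b: "b \<in> Basis"
  have "{0<..} \<subseteq> {h. p + h *\<^sub>R b \<in> half_space}"
    using p b by (auto simp: Basis_prod_def)
  then have "at 0 within {0<..} \<le> at (0::real) within {h. p + h *\<^sub>R b \<in> half_space}"
    by (rule at_le)
  moreover have "at 0 within {0<..} \<noteq> (bot::real filter)" using trivial_limit_at_right_real[of 0] .
  ultimately show "at 0 within {h. p + h *\<^sub>R b \<in> half_space} \<noteq> bot"
    by (metis bot.extremum_uniqueI)
qed

text \<open>Inductions on multi-indices give equalities on \<open>X\<close> only, while
  \<open>partial_deriv\<close> takes a function on the whole space; this lemma carries such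
  equalities through one more derivative.\<close>

lemma partial_deriv_cong:
  assumes "\<And>x. x \<in> X \<Longrightarrow> f x = g x" "x \<in> X"
  shows "partial_deriv X b f x = partial_deriv X b g x"
proof -
  let ?S = "{h. x + h *\<^sub>R b \<in> X}"
  have "((\<lambda>h. f (x + h *\<^sub>R b)) has_vector_derivative D) (at 0 within ?S) \<longleftrightarrow>
    ((\<lambda>h. g (x + h *\<^sub>R b)) has_vector_derivative D) (at 0 within ?S)" for D
    using assms by (intro has_vector_derivative_cong_ev) (auto simp: eventually_nhds intro: exI[of _ UNIV])
  then show ?thesis by (simp add: partial_deriv_def vector_derivative_def)
qed

section \<open>Iterated derivatives of smooth functions\<close>

lemma iter_deriv_Cons: "iter_deriv X (b # \<alpha>) f = partial_deriv X b (iter_deriv X \<alpha> f)"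
  by (simp add: iter_deriv_def)

lemma iter_deriv_Nil: "iter_deriv X [] f = f"
  by (simp add: iter_deriv_def)

text \<open>The last list entry is the innermost derivative. A derivative taken on representatives
  is thus appended at the end, whereas differentiating an iterated derivative adds an entry at the
  front.\<close>

lemma iter_deriv_partial: "iter_deriv X \<alpha> (partial_deriv X b f) = iter_deriv X (\<alpha> @ [b]) f"
  by (simp add: iter_deriv_def)

lemma multi_indices_Cons: "b # \<alpha> \<in> multi_indices \<longleftrightarrow> b \<in> Basis \<and> \<alpha> \<in> multi_indices"
  by (simp add: multi_indices_def)

lemma multi_indices_Nil: "[] \<in> multi_indices"
  by (simp add: multi_indices_def)

lemma multi_indices_append: "\<alpha> @ \<beta> \<in> multi_indices \<longleftrightarrow> \<alpha> \<in> multi_indices \<and> \<beta> \<in> multi_indices"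
  by (auto simp: multi_indices_def)

lemma smooth_on_deriv:
  assumes "smooth_on X f" "\<alpha> \<in> multi_indices" "b \<in> Basis" "x \<in> X"
  shows "((\<lambda>h. iter_deriv X \<alpha> f (x + h *\<^sub>R b)) has_vector_derivative iter_deriv X (b # \<alpha>) f x)
     (at 0 within {h. x + h *\<^sub>R b \<in> X})"
proof -
  have "(\<lambda>h. iter_deriv X \<alpha> f (x + h *\<^sub>R b)) differentiable (at 0 within {h. x + h *\<^sub>R b \<in> X})"
    using assms unfolding smooth_on_def by blast
  then show ?thesis
    unfolding iter_deriv_Cons partial_deriv_def by (simp add: vector_derivative_works[symmetric])
qed

lemma smooth_on_cont: "smooth_on X f \<Longrightarrow> \<alpha> \<in> multi_indices \<Longrightarrow> continuous_on X (iter_deriv X \<alpha> f)"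
  unfolding smooth_on_def by blast

lemma smooth_on_partial:
  assumes "smooth_on X f" "b \<in> Basis" shows "smooth_on X (partial_deriv X b f)"
  using assms unfolding smooth_on_def iter_deriv_partial
  by (simp add: multi_indices_append multi_indices_Cons multi_indices_Nil)

lemma iter_deriv_diff:
  assumes X: "accessible X" and f: "smooth_on X f" and g: "smooth_on X g" and "\<alpha> \<in> multi_indices" "x \<in> X"
  shows "iter_deriv X \<alpha> (\<lambda>x. f x - g x) x = iter_deriv X \<alpha> f x - iter_deriv X \<alpha> g x"
  using assms(4,5)
proof (induction \<alpha> arbitrary: x)
  case (Cons b \<alpha>)
  then have b: "b \<in> Basis" and \<alpha>: "\<alpha> \<in> multi_indices" by (auto simp: multi_indices_Cons)
  have "iter_deriv X (b # \<alpha>) (\<lambda>x. f x - g x) x = partial_deriv X b (\<lambda>x. iter_deriv X \<alpha> f x - iter_deriv X \<alpha> g x) x"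
    unfolding iter_deriv_Cons by (rule partial_deriv_cong[OF Cons.IH[OF \<alpha>] Cons.prems(2)])
  also have "\<dots> = iter_deriv X (b # \<alpha>) f x - iter_deriv X (b # \<alpha>) g x"
    unfolding partial_deriv_def
    using has_vector_derivative_diff[OF smooth_on_deriv[OF f \<alpha> b Cons.prems(2)] smooth_on_deriv[OF g \<alpha> b Cons.prems(2)]]
      X b Cons.prems(2) by (intro vector_derivative_within) (auto simp: accessible_def)
  finally show ?case .
qed (simp add: iter_deriv_Nil)

lemma iter_deriv_zero:
  assumes X: "accessible X" and "\<alpha> \<in> multi_indices" "x \<in> X"
  shows "iter_deriv X \<alpha> (\<lambda>x. 0) x = 0"
  using assms(2,3)
proof (induction \<alpha> arbitrary: x)
  case (Cons b \<alpha>)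
  then have b: "b \<in> Basis" and \<alpha>: "\<alpha> \<in> multi_indices" by (auto simp: multi_indices_Cons)
  have "iter_deriv X (b # \<alpha>) (\<lambda>x. 0) x = partial_deriv X b (\<lambda>x. 0) x"
    unfolding iter_deriv_Cons by (rule partial_deriv_cong[OF Cons.IH[OF \<alpha>] Cons.prems(2)])
  also have "\<dots> = 0"
    unfolding partial_deriv_def
    using X b Cons.prems(2) by (intro vector_derivative_within) (auto simp: accessible_def)
  finally show ?case .
qed (simp add: iter_deriv_Nil)

text \<open>Makes \<open>colombeau_rel\<close> reflexive on moderate families, so that a moderate
  family is a member of its own class.\<close>

lemma zero_negligible:
  assumes X: "accessible X"
  shows "(\<lambda>\<epsilon> x. 0) \<in> negligible_families X"
proof -
  have z: "iter_deriv X \<alpha> (\<lambda>x. 0) x = 0" if "\<alpha> \<in> multi_indices" "x \<in> X" for \<alpha> x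
    by (rule iter_deriv_zero[OF X that])
  have "smooth_on X (\<lambda>x. 0)"
    unfolding smooth_on_def
  proof (intro ballI conjI)
    fix \<alpha> :: "'a list" assume \<alpha>: "\<alpha> \<in> multi_indices"
    show "continuous_on X (iter_deriv X \<alpha> (\<lambda>x. 0))"
      using z[OF \<alpha>] continuous_on_cong[of X X "iter_deriv X \<alpha> (\<lambda>x. 0)" "\<lambda>_. 0"] by simp
    fix b :: 'a and x assume "b \<in> Basis" "x \<in> X"
    have "((\<lambda>h. iter_deriv X \<alpha> (\<lambda>x. 0) (x + h *\<^sub>R b)) has_derivative (\<lambda>_. 0)) (at 0 within {h. x + h *\<^sub>R b \<in> X})"
      by (rule has_derivative_transform[where f="\<lambda>_. 0"]) (use z[OF \<alpha>] \<open>x \<in> X\<close> in auto)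
    then show "(\<lambda>h. iter_deriv X \<alpha> (\<lambda>x. 0) (x + h *\<^sub>R b)) differentiable (at 0 within {h. x + h *\<^sub>R b \<in> X})"
      unfolding differentiable_def by blast
  qed
  moreover have "(\<lambda>\<epsilon>::real. SUP x\<in>K. \<bar>iter_deriv X \<alpha> (\<lambda>x. 0) x\<bar>) \<in> O[at_right 0](\<lambda>\<epsilon>. \<epsilon> powr q)"
    if "K \<noteq> {}" "K \<subseteq> X" "\<alpha> \<in> multi_indices" for K \<alpha> q
  proof -
    have "(SUP x\<in>K. \<bar>iter_deriv X \<alpha> (\<lambda>x. 0) x\<bar>) = (SUP x\<in>K. 0)"
      using that z by (intro SUP_cong) auto
    then show ?thesis using that by simp
  qed
  ultimately show ?thesis unfolding negligible_families_def by auto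
qed

lemma negligible_moderate: "u \<in> negligible_families X \<Longrightarrow> u \<in> moderate X"
proof -
  assume u: "u \<in> negligible_families X"
  show "u \<in> moderate X"
    unfolding moderate_def
  proof (intro CollectI conjI allI impI ballI)
    fix \<epsilon> :: real assume "\<epsilon> \<in> {0<..1}"
    then show "smooth_on X (u \<epsilon>)" using u unfolding negligible_families_def by simp
  next
    fix K and \<alpha> :: "'a list" assume K: "compact K \<and> K \<noteq> {} \<and> K \<subseteq> X" and \<alpha>: "\<alpha> \<in> multi_indices"
    have "(\<lambda>\<epsilon>. SUP x\<in>K. \<bar>iter_deriv X \<alpha> (u \<epsilon>) x\<bar>) \<in> O[at_right 0](\<lambda>\<epsilon>. \<epsilon> powr (- 0))"
      unfolding minus_zero
      by (rule u[unfolded negligible_families_def, THEN CollectD, THEN conjunct2, rule_format, OF K \<alpha> order_refl])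
    then show "\<exists>p\<ge>0. (\<lambda>\<epsilon>. SUP x\<in>K. \<bar>iter_deriv X \<alpha> (u \<epsilon>) x\<bar>) \<in> O[at_right 0](\<lambda>\<epsilon>. \<epsilon> powr (- p))"
      by (rule exI[of _ 0, OF conjI[OF order_refl]])
  qed
qed

lemma partial_moderate:
  assumes "u \<in> moderate X" "b \<in> Basis" shows "(\<lambda>\<epsilon>. partial_deriv X b (u \<epsilon>)) \<in> moderate X"
  using assms unfolding moderate_def
  by (auto simp: iter_deriv_partial smooth_on_partial multi_indices_append multi_indices_Cons multi_indices_Nil)

lemma colombeau_rel_refl:
  assumes "accessible X" "u \<in> moderate X" shows "(u, u) \<in> colombeau_rel X"
  using assms zero_negligible by (simp add: colombeau_rel_def)

text \<open>
  Only the bounds on the functions themselves are retained here: the class of a family that is not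
  moderate is empty, so moderateness of all occurring products comes for free from the equation.
\<close>

definition negligible0 :: "'a::euclidean_space set \<Rightarrow> 'a family \<Rightarrow> bool" where
  "negligible0 X f \<longleftrightarrow> (\<forall>K q. compact K \<longrightarrow> K \<subseteq> X \<longrightarrow> (\<exists>C. \<forall>\<^sub>F \<epsilon> in at_right 0. \<forall>x\<in>K. \<bar>f \<epsilon> x\<bar> \<le> C * \<epsilon> powr q))"

definition moderate0 :: "'a::euclidean_space set \<Rightarrow> 'a family \<Rightarrow> bool" where
  "moderate0 X f \<longleftrightarrow> (\<forall>K. compact K \<longrightarrow> K \<subseteq> X \<longrightarrow> (\<exists>p C. \<forall>\<^sub>F \<epsilon> in at_right 0. \<forall>x\<in>K. \<bar>f \<epsilon> x\<bar> \<le> C * \<epsilon> powr (-p)))"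

text \<open>A real supremum dominates the values only if these are bounded above. Continuity on the
  compact set provides this for \<open>\<epsilon>\<close> in \<open>(0, 1]\<close>, which is enough
  near \<open>0\<close>.\<close>

lemma bigo_SUP_bound:
  assumes sm: "\<And>\<epsilon>. \<epsilon> \<in> {0<..1} \<Longrightarrow> smooth_on X (u \<epsilon>)" and K: "compact K" "K \<subseteq> X" and \<alpha>: "\<alpha> \<in> multi_indices"
    and O: "(\<lambda>\<epsilon>. SUP x\<in>K. \<bar>iter_deriv X \<alpha> (u \<epsilon>) x\<bar>) \<in> O[at_right 0](\<lambda>\<epsilon>. \<epsilon> powr q)"
  shows "\<exists>C. \<forall>\<^sub>F \<epsilon> in at_right 0. \<forall>x\<in>K. \<bar>iter_deriv X \<alpha> (u \<epsilon>) x\<bar> \<le> C * \<epsilon> powr q"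
proof -
  obtain C where C: "\<forall>\<^sub>F \<epsilon> in at_right 0. norm (SUP x\<in>K. \<bar>iter_deriv X \<alpha> (u \<epsilon>) x\<bar>) \<le> C * norm (\<epsilon> powr q)"
    using O unfolding bigo_def by blast
  have "\<forall>\<^sub>F \<epsilon> in at_right 0. \<forall>x\<in>K. \<bar>iter_deriv X \<alpha> (u \<epsilon>) x\<bar> \<le> C * \<epsilon> powr q"
    using C eventually_unit
  proof eventually_elim
    case (elim \<epsilon>)
    show ?case
    proof
      fix x assume x: "x \<in> K"
      have "compact (iter_deriv X \<alpha> (u \<epsilon>) ` K)"
        by (intro compact_continuous_image K continuous_on_subset[OF smooth_on_cont[OF sm[OF elim(2)] \<alpha>] K(2)])
      then have "bounded (iter_deriv X \<alpha> (u \<epsilon>) ` K)" by (rule compact_imp_bounded)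
      then have "bdd_above ((\<lambda>x. \<bar>iter_deriv X \<alpha> (u \<epsilon>) x\<bar>) ` K)"
        by (auto simp: bounded_iff bdd_above_def)
      then have "\<bar>iter_deriv X \<alpha> (u \<epsilon>) x\<bar> \<le> (SUP x\<in>K. \<bar>iter_deriv X \<alpha> (u \<epsilon>) x\<bar>)"
        using x by (rule cSUP_upper2) auto
      then show "\<bar>iter_deriv X \<alpha> (u \<epsilon>) x\<bar> \<le> C * \<epsilon> powr q" using elim(1) by simp
    qed
  qed
  then show ?thesis by blast
qed

lemma moderate_mod0:
  assumes "u \<in> moderate X" "\<alpha> \<in> multi_indices"
  shows "moderate0 X (\<lambda>\<epsilon>. iter_deriv X \<alpha> (u \<epsilon>))"
  unfolding moderate0_def
proof (intro allI impI)
  fix K assume K: "compact K" "K \<subseteq> X"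
  show "\<exists>p C. \<forall>\<^sub>F \<epsilon> in at_right 0. \<forall>x\<in>K. \<bar>iter_deriv X \<alpha> (u \<epsilon>) x\<bar> \<le> C * \<epsilon> powr (-p)"
  proof (cases "K = {}")
    case False
    then obtain p where "(\<lambda>\<epsilon>. SUP x\<in>K. \<bar>iter_deriv X \<alpha> (u \<epsilon>) x\<bar>) \<in> O[at_right 0](\<lambda>\<epsilon>. \<epsilon> powr (-p))"
      using assms K unfolding moderate_def by blast
    from bigo_SUP_bound[OF _ K assms(2) this] assms(1) show ?thesis unfolding moderate_def by blast
  qed simp
qed

lemma powr_unit_mono: "\<epsilon> \<in> {0<..1} \<Longrightarrow> p \<le> q \<Longrightarrow> \<epsilon> powr q \<le> \<epsilon> powr (p::real)"
  by (simp add: powr_mono')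

lemma negligible_negl0:
  assumes "u \<in> negligible_families X" "\<alpha> \<in> multi_indices"
  shows "negligible0 X (\<lambda>\<epsilon>. iter_deriv X \<alpha> (u \<epsilon>))"
  unfolding negligible0_def
proof (intro allI impI)
  fix K q assume K: "compact K" "K \<subseteq> X"
  show "\<exists>C. \<forall>\<^sub>F \<epsilon> in at_right 0. \<forall>x\<in>K. \<bar>iter_deriv X \<alpha> (u \<epsilon>) x\<bar> \<le> C * \<epsilon> powr q"
  proof (cases "K = {}")
    case False
    \<comment> \<open>The definition provides exponents \<open>q \<ge> 0\<close> only, but
      \<open>negligible0\<close> asks for all real ones, so that \<open>negligible0_mult\<close> may
      pass to \<open>p + q\<close> without a case distinction.\<close>
    then have "(\<lambda>\<epsilon>. SUP x\<in>K. \<bar>iter_deriv X \<alpha> (u \<epsilon>) x\<bar>) \<in> O[at_right 0](\<lambda>\<epsilon>. \<epsilon> powr (max q 0))"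
      using assms K unfolding negligible_families_def by simp
    from bigo_SUP_bound[OF _ K assms(2) this] assms(1)
    obtain C where C: "\<forall>\<^sub>F \<epsilon> in at_right 0. \<forall>x\<in>K. \<bar>iter_deriv X \<alpha> (u \<epsilon>) x\<bar> \<le> C * \<epsilon> powr (max q 0)"
      unfolding negligible_families_def by blast
    have "\<forall>\<^sub>F \<epsilon> in at_right 0. \<forall>x\<in>K. \<bar>iter_deriv X \<alpha> (u \<epsilon>) x\<bar> \<le> \<bar>C\<bar> * \<epsilon> powr q"
      using C eventually_unit
    proof eventually_elim
      case (elim \<epsilon>)
      have "C * \<epsilon> powr (max q 0) \<le> \<bar>C\<bar> * \<epsilon> powr q"
        using powr_unit_mono[OF elim(2), of q "max q 0"] by (intro mult_mono) auto
      then show ?case using elim(1) by (meson order_trans)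
    qed
    then show ?thesis by blast
  qed simp
qed

text \<open>The trace of \<open>colombeau_rel\<close> at order zero. Moderateness of both sides
  belongs to the relation because compatibility with products depends on it.\<close>

definition equiv0 :: "'a::euclidean_space set \<Rightarrow> 'a family \<Rightarrow> 'a family \<Rightarrow> bool" where
  "equiv0 X f g \<longleftrightarrow> moderate0 X f \<and> moderate0 X g \<and> negligible0 X (\<lambda>\<epsilon> x. f \<epsilon> x - g \<epsilon> x)"

lemma negligible0_cong: "negligible0 X f \<Longrightarrow> (\<And>\<epsilon> x. \<epsilon> \<in> {0<..1} \<Longrightarrow> x \<in> X \<Longrightarrow> f \<epsilon> x = g \<epsilon> x) \<Longrightarrow> negligible0 X g"
  unfolding negligible0_def
proof (intro allI impI)
  fix K q assume h: "\<forall>K q. compact K \<longrightarrow> K \<subseteq> X \<longrightarrow> (\<exists>C. \<forall>\<^sub>F \<epsilon> in at_right 0. \<forall>x\<in>K. \<bar>f \<epsilon> x\<bar> \<le> C * \<epsilon> powr q)"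
    "(\<And>\<epsilon> x. \<epsilon> \<in> {0<..1} \<Longrightarrow> x \<in> X \<Longrightarrow> f \<epsilon> x = g \<epsilon> x)" "compact K" "K \<subseteq> X"
  then obtain C where C: "\<forall>\<^sub>F \<epsilon> in at_right 0. \<forall>x\<in>K. \<bar>f \<epsilon> x\<bar> \<le> C * \<epsilon> powr q" by blast
  have "\<forall>\<^sub>F \<epsilon> in at_right 0. \<forall>x\<in>K. \<bar>g \<epsilon> x\<bar> \<le> C * \<epsilon> powr q"
    using C eventually_unit by eventually_elim (use h in fastforce)
  then show "\<exists>C. \<forall>\<^sub>F \<epsilon> in at_right 0. \<forall>x\<in>K. \<bar>g \<epsilon> x\<bar> \<le> C * \<epsilon> powr q" ..
qed

lemma negligible0_add:
  assumes "negligible0 X f" "negligible0 X g" shows "negligible0 X (\<lambda>\<epsilon> x. f \<epsilon> x + g \<epsilon> x)"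
  unfolding negligible0_def
proof (intro allI impI)
  fix K q assume K: "compact K" "K \<subseteq> X"
  obtain C C' where C: "\<forall>\<^sub>F \<epsilon> in at_right 0. \<forall>x\<in>K. \<bar>f \<epsilon> x\<bar> \<le> C * \<epsilon> powr q"
    "\<forall>\<^sub>F \<epsilon> in at_right 0. \<forall>x\<in>K. \<bar>g \<epsilon> x\<bar> \<le> C' * \<epsilon> powr q"
    using assms K unfolding negligible0_def by meson
  have "\<forall>\<^sub>F \<epsilon> in at_right 0. \<forall>x\<in>K. \<bar>f \<epsilon> x + g \<epsilon> x\<bar> \<le> (C + C') * \<epsilon> powr q"
    using C by eventually_elim (auto simp: distrib_right intro!: order_trans[OF abs_triangle_ineq] add_mono)
  then show "\<exists>C. \<forall>\<^sub>F \<epsilon> in at_right 0. \<forall>x\<in>K. \<bar>f \<epsilon> x + g \<epsilon> x\<bar> \<le> C * \<epsilon> powr q" ..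
qed

lemma negligible0_mult:
  assumes "moderate0 X f" "negligible0 X g" shows "negligible0 X (\<lambda>\<epsilon> x. f \<epsilon> x * g \<epsilon> x)"
  unfolding negligible0_def
proof (intro allI impI)
  fix K q assume K: "compact K" "K \<subseteq> X"
  obtain p C where C: "\<forall>\<^sub>F \<epsilon> in at_right 0. \<forall>x\<in>K. \<bar>f \<epsilon> x\<bar> \<le> C * \<epsilon> powr (-p)"
    using assms K unfolding moderate0_def by meson
  obtain C' where C': "\<forall>\<^sub>F \<epsilon> in at_right 0. \<forall>x\<in>K. \<bar>g \<epsilon> x\<bar> \<le> C' * \<epsilon> powr (p + q)"
    using assms K unfolding negligible0_def by meson
  have "\<forall>\<^sub>F \<epsilon> in at_right 0. \<forall>x\<in>K. \<bar>f \<epsilon> x * g \<epsilon> x\<bar> \<le> (C * C') * \<epsilon> powr q"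
    using C C' eventually_unit
  proof eventually_elim
    case (elim \<epsilon>)
    show ?case
    proof
      fix x assume x: "x \<in> K"
      have "\<bar>f \<epsilon> x * g \<epsilon> x\<bar> \<le> (C * \<epsilon> powr (-p)) * (C' * \<epsilon> powr (p + q))"
        unfolding abs_mult using elim(1,2) x by (intro mult_mono) (auto intro: order_trans[OF abs_ge_zero])
      also have "\<dots> = (C * C') * \<epsilon> powr q"
        using elim(3) by (simp add: powr_add[symmetric] mult_ac)
      finally show "\<bar>f \<epsilon> x * g \<epsilon> x\<bar> \<le> (C * C') * \<epsilon> powr q" .
    qed
  qed
  then show "\<exists>C. \<forall>\<^sub>F \<epsilon> in at_right 0. \<forall>x\<in>K. \<bar>f \<epsilon> x * g \<epsilon> x\<bar> \<le> C * \<epsilon> powr q" ..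
qed

lemma moderate0_mult:
  assumes "moderate0 X f" "moderate0 X g" shows "moderate0 X (\<lambda>\<epsilon> x. f \<epsilon> x * g \<epsilon> x)"
  unfolding moderate0_def
proof (intro allI impI)
  fix K assume K: "compact K" "K \<subseteq> X"
  obtain p C where C: "\<forall>\<^sub>F \<epsilon> in at_right 0. \<forall>x\<in>K. \<bar>f \<epsilon> x\<bar> \<le> C * \<epsilon> powr (-p)"
    using assms K unfolding moderate0_def by meson
  obtain q C' where C': "\<forall>\<^sub>F \<epsilon> in at_right 0. \<forall>x\<in>K. \<bar>g \<epsilon> x\<bar> \<le> C' * \<epsilon> powr (-q)"
    using assms K unfolding moderate0_def by meson
  have "\<forall>\<^sub>F \<epsilon> in at_right 0. \<forall>x\<in>K. \<bar>f \<epsilon> x * g \<epsilon> x\<bar> \<le> (C * C') * \<epsilon> powr (-(p + q))"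
    using C C' eventually_unit
  proof eventually_elim
    case (elim \<epsilon>)
    show ?case
    proof
      fix x assume x: "x \<in> K"
      have "\<bar>f \<epsilon> x * g \<epsilon> x\<bar> \<le> (C * \<epsilon> powr (-p)) * (C' * \<epsilon> powr (-q))"
        unfolding abs_mult using elim(1,2) x by (intro mult_mono) (auto intro: order_trans[OF abs_ge_zero])
      also have "\<dots> = (C * C') * \<epsilon> powr (-(p + q))"
        using powr_add[of \<epsilon> "-p" "-q"] by (simp add: mult_ac)
      finally show "\<bar>f \<epsilon> x * g \<epsilon> x\<bar> \<le> (C * C') * \<epsilon> powr (-(p + q))" .
    qed
  qed
  then show "\<exists>p C. \<forall>\<^sub>F \<epsilon> in at_right 0. \<forall>x\<in>K. \<bar>f \<epsilon> x * g \<epsilon> x\<bar> \<le> C * \<epsilon> powr (-p)" by blast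
qed

lemma equiv0_sym: "equiv0 X f g \<Longrightarrow> equiv0 X g f"
  unfolding equiv0_def negligible0_def by (simp add: abs_minus_commute)

lemma equiv0_trans: "equiv0 X f g \<Longrightarrow> equiv0 X g h \<Longrightarrow> equiv0 X f h"
  unfolding equiv0_def using negligible0_add[of X "\<lambda>\<epsilon> x. f \<epsilon> x - g \<epsilon> x" "\<lambda>\<epsilon> x. g \<epsilon> x - h \<epsilon> x"] by simp

lemma equiv0_mult:
  assumes "equiv0 X f g" "equiv0 X f' g'"
  shows "equiv0 X (\<lambda>\<epsilon> x. f \<epsilon> x * f' \<epsilon> x) (\<lambda>\<epsilon> x. g \<epsilon> x * g' \<epsilon> x)"
proof -
  have "negligible0 X (\<lambda>\<epsilon> x. f \<epsilon> x * (f' \<epsilon> x - g' \<epsilon> x) + g' \<epsilon> x * (f \<epsilon> x - g \<epsilon> x))"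
    using assms unfolding equiv0_def by (intro negligible0_add negligible0_mult) auto
  then have "negligible0 X (\<lambda>\<epsilon> x. f \<epsilon> x * f' \<epsilon> x - g \<epsilon> x * g' \<epsilon> x)" by (simp add: algebra_simps)
  then show ?thesis using assms moderate0_mult unfolding equiv0_def by blast
qed

lemma colombeau_rel_eqv:
  assumes X: "accessible X" and "(f, g) \<in> colombeau_rel X" "\<alpha> \<in> multi_indices"
  shows "equiv0 X (\<lambda>\<epsilon>. iter_deriv X \<alpha> (f \<epsilon>)) (\<lambda>\<epsilon>. iter_deriv X \<alpha> (g \<epsilon>))"
proof -
  have fg: "f \<in> moderate X" "g \<in> moderate X" "(\<lambda>\<epsilon> x. f \<epsilon> x - g \<epsilon> x) \<in> negligible_families X"
    using assms by (auto simp: colombeau_rel_def)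
  have sm: "smooth_on X (f \<epsilon>)" "smooth_on X (g \<epsilon>)" if "\<epsilon> \<in> {0<..1}" for \<epsilon>
    using fg(1,2) that by (auto simp: moderate_def)
  have "negligible0 X (\<lambda>\<epsilon> x. iter_deriv X \<alpha> (f \<epsilon>) x - iter_deriv X \<alpha> (g \<epsilon>) x)"
    by (rule negligible0_cong[OF negligible_negl0[OF fg(3) assms(3)]]) (rule iter_deriv_diff[OF X sm assms(3)])
  then show ?thesis using moderate_mod0[OF fg(1) assms(3)] moderate_mod0[OF fg(2) assms(3)]
    by (simp add: equiv0_def)
qed

lemma colombeau_rel_eqv0:
  assumes "accessible X" "(f, g) \<in> colombeau_rel X"
  shows "equiv0 X f g"
  using colombeau_rel_eqv[OF assms multi_indices_Nil] by (simp add: iter_deriv_Nil)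

section \<open>From classes to one representative\<close>

lemma gclass_iff: "g \<in> gclass X f \<longleftrightarrow> (f, g) \<in> colombeau_rel X"
  by (simp add: gclass_def)

text \<open>The operation \<open>gderiv\<close> is a union over all representatives. Instead of
  showing that the union is a single class, it suffices to relate each of its members to the
  derivative of one chosen \<open>v\<close>.\<close>

lemma gderiv_eqv:
  assumes X: "accessible X" and b: "b \<in> Basis" and \<alpha>: "\<alpha> \<in> multi_indices"
    and U: "\<And>w. w \<in> U \<Longrightarrow> equiv0 X (\<lambda>\<epsilon>. iter_deriv X (\<alpha> @ [b]) (v \<epsilon>)) (\<lambda>\<epsilon>. iter_deriv X (\<alpha> @ [b]) (w \<epsilon>))"
    and p: "p \<in> gderiv X b U"
  shows "equiv0 X (\<lambda>\<epsilon>. iter_deriv X (\<alpha> @ [b]) (v \<epsilon>)) (\<lambda>\<epsilon>. iter_deriv X \<alpha> (p \<epsilon>))"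
proof -
  obtain w where w: "w \<in> U" "(\<lambda>\<epsilon>. partial_deriv X b (w \<epsilon>), p) \<in> colombeau_rel X"
    using p by (auto simp: gderiv_def gclass_iff)
  have "equiv0 X (\<lambda>\<epsilon>. iter_deriv X (\<alpha> @ [b]) (w \<epsilon>)) (\<lambda>\<epsilon>. iter_deriv X \<alpha> (p \<epsilon>))"
    using colombeau_rel_eqv[OF X w(2) \<alpha>] by (simp add: iter_deriv_partial)
  then show ?thesis using U[OF w(1)] equiv0_trans by blast
qed

lemma colombeau_elem:
  assumes X: "accessible X" and U: "U \<in> colombeau X"
  obtains v where "v \<in> U" "v \<in> moderate X" "\<And>w. w \<in> U \<Longrightarrow> (v, w) \<in> colombeau_rel X"
proof -
  obtain v where v: "v \<in> moderate X" "U = colombeau_rel X `` {v}"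
    using U unfolding colombeau_def by (auto elim: quotientE)
  then have "v \<in> U" using colombeau_rel_refl[OF X v(1)] by simp
  with v that show thesis by simp
qed

section \<open>The half-space and its boundary line\<close>

lemma half_space_basis: "(1, 0) \<in> (Basis :: (real \<times> real) set)" "(0, 1) \<in> (Basis :: (real \<times> real) set)"
  by (auto simp: Basis_prod_def)

lemma half_space_indices: 
  "[(1, 0)] \<in> (multi_indices :: (real \<times> real) list set)" "[(0, 1)] \<in> (multi_indices :: (real \<times> real) list set)"
  by (auto simp: multi_indices_def half_space_basis)

text \<open>A spatial increment never leaves the half-space, so at the boundary the relative spatial
  derivative is the ordinary one; this holds for every function \<open>f\<close>.\<close>

lemma iter_deriv_restrict0:
  assumes \<alpha>: "\<alpha> \<in> (multi_indices :: real list set)"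
  shows "iter_deriv UNIV \<alpha> (\<lambda>x. f (0, x)) = (\<lambda>x. iter_deriv half_space (map (\<lambda>b. (0, b)) \<alpha>) f (0::real, x))"
  using assms
proof (induction \<alpha>)
  case (Cons b \<alpha>)
  then have "b = 1" by (simp add: multi_indices_Cons)
  then show ?case using Cons
    by (simp add: iter_deriv_Cons multi_indices_Cons partial_deriv_def fun_eq_iff)
qed (simp add: iter_deriv_Nil)

lemma smooth_on_restrict0:
  assumes f: "smooth_on half_space f" 
  shows "smooth_on UNIV (\<lambda>x. f (0::real, x))"
  unfolding smooth_on_def
proof (intro ballI conjI)
  fix \<alpha> :: "real list" assume \<alpha>: "\<alpha> \<in> multi_indices"
  then have \<alpha>': "map (\<lambda>b. (0, b)) \<alpha> \<in> (multi_indices :: (real \<times> real) list set)"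
    by (auto simp: multi_indices_def Basis_prod_def)
  show "continuous_on UNIV (iter_deriv UNIV \<alpha> (\<lambda>x. f (0::real, x)))"
    unfolding iter_deriv_restrict0[OF \<alpha>]
    by (rule continuous_on_compose2[OF smooth_on_cont[OF f \<alpha>']]) (auto intro!: continuous_intros)
  fix b x :: real assume b: "b \<in> Basis"
  then have b': "(0, b) \<in> (Basis :: (real \<times> real) set)" by (auto simp: Basis_prod_def)
  have "(0::real, x) \<in> half_space" by simp
  from smooth_on_deriv[OF f \<alpha>' b' this]
  have "((\<lambda>h. iter_deriv half_space (map (\<lambda>b. (0, b)) \<alpha>) f ((0, x) + h *\<^sub>R (0, b))) differentiable
      (at 0 within {h. (0, x) + h *\<^sub>R (0::real, b) \<in> half_space}))"
    using differentiableI_vector by blast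
  then show "(\<lambda>h. iter_deriv UNIV \<alpha> (\<lambda>x. f (0, x)) (x + h *\<^sub>R b)) differentiable
      (at 0 within {h. x + h *\<^sub>R b \<in> UNIV})"
    unfolding iter_deriv_restrict0[OF \<alpha>] by simp
qed

lemma moderate_restrict0:
  assumes v: "v \<in> moderate half_space"
  shows "(\<lambda>\<epsilon> x. v \<epsilon> (0::real, x)) \<in> moderate UNIV"
  unfolding moderate_def
proof (intro CollectI conjI allI impI ballI)
  fix \<epsilon> :: real assume "\<epsilon> \<in> {0<..1}"
  then show "smooth_on UNIV (\<lambda>x. v \<epsilon> (0, x))" 
    using v smooth_on_restrict0 unfolding moderate_def by blast
next
  fix K :: "real set" and \<alpha> :: "real list" assume K: "compact K \<and> K \<noteq> {} \<and> K \<subseteq> UNIV" and \<alpha>: "\<alpha> \<in> multi_indices"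
  then have \<alpha>': "map (\<lambda>b. (0, b)) \<alpha> \<in> (multi_indices :: (real \<times> real) list set)"
    by (auto simp: multi_indices_def Basis_prod_def)
  have K': "compact ({0::real} \<times> K)" "{0::real} \<times> K \<noteq> {}" "{0::real} \<times> K \<subseteq> half_space"
    using K by (auto intro: compact_Times)
  have "(SUP x\<in>K. \<bar>iter_deriv UNIV \<alpha> (\<lambda>x. v \<epsilon> (0, x)) x\<bar>)
     = (SUP p\<in>{0}\<times>K. \<bar>iter_deriv half_space (map (\<lambda>b. (0, b)) \<alpha>) (v \<epsilon>) p\<bar>)" for \<epsilon>
  proof -
    have "{0::real} \<times> K = (\<lambda>x. (0, x)) ` K" by auto
    then show ?thesis unfolding iter_deriv_restrict0[OF \<alpha>] by (simp add: image_image)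
  qed
  moreover obtain p where "p \<ge> 0"
    "(\<lambda>\<epsilon>. SUP x\<in>{0}\<times>K. \<bar>iter_deriv half_space (map (\<lambda>b. (0, b)) \<alpha>) (v \<epsilon>) x\<bar>) \<in> O[at_right 0](\<lambda>\<epsilon>. \<epsilon> powr (- p))"
    using v K' \<alpha>' unfolding moderate_def by blast
  ultimately show "\<exists>p\<ge>0. (\<lambda>\<epsilon>. SUP x\<in>K. \<bar>iter_deriv UNIV \<alpha> (\<lambda>x. v \<epsilon> (0, x)) x\<bar>) \<in> O[at_right 0](\<lambda>\<epsilon>. \<epsilon> powr (- p))"
    by auto
qed

text \<open>The restriction of \<open>v\<close> is moderate, hence a member of its own class and
  thereby of the union \<open>grestrict0 U\<close>. This membership is what the assumed equality is
  evaluated at.\<close>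

lemma grestrict0_eq:
  assumes U: "grestrict0 U = gclass UNIV f" and v: "v \<in> U" "v \<in> moderate half_space"
  shows "negligible0 UNIV (\<lambda>\<epsilon> x. v \<epsilon> (0, x) - f \<epsilon> x)"
proof -
  have "(\<lambda>\<epsilon> x. v \<epsilon> (0, x)) \<in> gclass UNIV (\<lambda>\<epsilon> x. v \<epsilon> (0, x))"
    unfolding gclass_iff by (rule colombeau_rel_refl[OF accessible_UNIV moderate_restrict0[OF v(2)]])
  then have "(\<lambda>\<epsilon> x. v \<epsilon> (0, x)) \<in> gclass UNIV f"
    using U v(1) unfolding grestrict0_def by blast
  then have "equiv0 UNIV f (\<lambda>\<epsilon> x. v \<epsilon> (0, x))"
    unfolding gclass_iff using colombeau_rel_eqv0[OF accessible_UNIV] by blast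
  then show ?thesis using equiv0_sym unfolding equiv0_def by blast
qed

text \<open>The equation is read from right to left: the zero family is in the right-hand class, so
  it arises on the left from certain representatives of the derivatives and of the speed. Each of
  them is then exchanged for the one built from \<open>v\<close> or \<open>C0\<close>, up to
  negligible terms of order zero.\<close>

lemma generalized_solution_rep:
  fixes C0 :: "(real \<times> real) family"
  assumes "generalized_solution (gclass half_space C0) (gclass UNIV f0) (gclass UNIV f1) U"
  obtains v where "v \<in> U" "v \<in> moderate half_space"
    "negligible0 half_space (\<lambda>\<epsilon> p. iter_deriv half_space [(1,0),(1,0)] (v \<epsilon>) p
         - (C0 \<epsilon> p)\<^sup>2 * iter_deriv half_space [(0,1),(0,1)] (v \<epsilon>) p)"
    "negligible0 UNIV (\<lambda>\<epsilon> x. v \<epsilon> (0, x) - f0 \<epsilon> x)"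
    "negligible0 UNIV (\<lambda>\<epsilon> x. iter_deriv half_space [(1,0)] (v \<epsilon>) (0, x) - f1 \<epsilon> x)"
proof -
  let ?H = half_space and ?C = "gclass half_space C0"
  note acc = accessible_half_space
  have U: "U \<in> colombeau ?H" and eq: "gdiff ?H (gdt (gdt U)) (gmult ?H (gmult ?H ?C ?C) (gdx (gdx U)))
       = gclass ?H (\<lambda>\<epsilon> p. 0)" and r0: "grestrict0 U = gclass UNIV f0" and r1: "grestrict0 (gdt U) = gclass UNIV f1"
    using assms by (auto simp: generalized_solution_def)
  obtain v where v: "v \<in> U" "v \<in> moderate ?H" "\<And>w. w \<in> U \<Longrightarrow> (v, w) \<in> colombeau_rel ?H"
    using colombeau_elem[OF acc U] by blast
  have "(\<lambda>\<epsilon> p. 0) \<in> gclass ?H (\<lambda>\<epsilon> p. 0)"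
    unfolding gclass_iff by (rule colombeau_rel_refl[OF acc negligible_moderate[OF zero_negligible[OF acc]]])
  then obtain p q where pq: "p \<in> gdt (gdt U)" "q \<in> gmult ?H (gmult ?H ?C ?C) (gdx (gdx U))"
     "(\<lambda>\<epsilon> x. p \<epsilon> x - q \<epsilon> x, \<lambda>\<epsilon> x. 0) \<in> colombeau_rel ?H"
    unfolding eq[symmetric] gdiff_def gclass_iff[symmetric] by blast
  obtain c12 w where cw: "c12 \<in> gmult ?H ?C ?C" "w \<in> gdx (gdx U)" "(\<lambda>\<epsilon> x. c12 \<epsilon> x * w \<epsilon> x, q) \<in> colombeau_rel ?H"
    using pq(2) unfolding gmult_def[of _ "gmult ?H ?C ?C"] UN_iff gclass_iff by blast
  obtain c1 c2 where c: "(C0, c1) \<in> colombeau_rel ?H" "(C0, c2) \<in> colombeau_rel ?H"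
     "(\<lambda>\<epsilon> x. c1 \<epsilon> x * c2 \<epsilon> x, c12) \<in> colombeau_rel ?H"
    using cw(1) unfolding gmult_def by (auto simp: gclass_iff)
  have second: "equiv0 ?H (\<lambda>\<epsilon>. iter_deriv ?H [b, b] (v \<epsilon>)) p"
    if b: "b \<in> Basis" and p: "p \<in> gderiv ?H b (gderiv ?H b U)" for b p
  proof -
    have bb: "[b] \<in> multi_indices" "[b, b] \<in> multi_indices" using b by (auto simp: multi_indices_def)
    have 1: "equiv0 ?H (\<lambda>\<epsilon>. iter_deriv ?H ([b] @ [b]) (v \<epsilon>)) (\<lambda>\<epsilon>. iter_deriv ?H ([b] @ [b]) (w \<epsilon>))" if "w \<in> U" for w
      using colombeau_rel_eqv[OF acc v(3)[OF that] bb(2)] by simp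
    have 2: "equiv0 ?H (\<lambda>\<epsilon>. iter_deriv ?H ([] @ [b]) (partial_deriv ?H b (v \<epsilon>))) (\<lambda>\<epsilon>. iter_deriv ?H ([] @ [b]) (w \<epsilon>))"
      if "w \<in> gderiv ?H b U" for w
      using gderiv_eqv[OF acc b bb(1) 1 that] by (simp add: iter_deriv_partial)
    show ?thesis
      using gderiv_eqv[OF acc b multi_indices_Nil 2 p] by (simp add: iter_deriv_partial iter_deriv_Nil)
  qed
  have ep: "equiv0 ?H (\<lambda>\<epsilon>. iter_deriv ?H [(1,0),(1,0)] (v \<epsilon>)) p"
    by (rule second[OF half_space_basis(1) pq(1)])
  have ew: "equiv0 ?H (\<lambda>\<epsilon>. iter_deriv ?H [(0,1),(0,1)] (v \<epsilon>)) w"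
    by (rule second[OF half_space_basis(2) cw(2)])
  have "equiv0 ?H (\<lambda>\<epsilon> x. C0 \<epsilon> x * C0 \<epsilon> x) (\<lambda>\<epsilon> x. c1 \<epsilon> x * c2 \<epsilon> x)"
    using c colombeau_rel_eqv0[OF acc] by (intro equiv0_mult) blast+
  then have "equiv0 ?H (\<lambda>\<epsilon> x. C0 \<epsilon> x * C0 \<epsilon> x) c12"
    using c(3) colombeau_rel_eqv0[OF acc] equiv0_trans by blast
  from equiv0_mult[OF this ew]
  have eq: "equiv0 ?H (\<lambda>\<epsilon> x. (C0 \<epsilon> x * C0 \<epsilon> x) * iter_deriv ?H [(0,1),(0,1)] (v \<epsilon>) x) q"
    using cw(3) colombeau_rel_eqv0[OF acc] equiv0_trans by blast
  have n1: "negligible0 ?H (\<lambda>\<epsilon> x. iter_deriv ?H [(1,0),(1,0)] (v \<epsilon>) x - p \<epsilon> x)" using ep by (simp add: equiv0_def)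
  have n2: "negligible0 ?H (\<lambda>\<epsilon> x. (p \<epsilon> x - q \<epsilon> x) - 0)" using colombeau_rel_eqv0[OF acc pq(3)] by (simp add: equiv0_def)
  have n3: "negligible0 ?H (\<lambda>\<epsilon> x. q \<epsilon> x - (C0 \<epsilon> x * C0 \<epsilon> x) * iter_deriv ?H [(0,1),(0,1)] (v \<epsilon>) x)"
    using equiv0_sym[OF eq] by (simp add: equiv0_def)
  have N: "negligible0 ?H (\<lambda>\<epsilon> p. iter_deriv ?H [(1,0),(1,0)] (v \<epsilon>) p - (C0 \<epsilon> p)\<^sup>2 * iter_deriv ?H [(0,1),(0,1)] (v \<epsilon>) p)"
    using negligible0_add[OF negligible0_add[OF n1 n2] n3] by (simp add: power2_eq_square)
  have vt: "(\<lambda>\<epsilon>. partial_deriv ?H (1,0) (v \<epsilon>)) \<in> moderate ?H"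
    by (rule partial_moderate[OF v(2) half_space_basis(1)])
  have "(\<lambda>\<epsilon>. partial_deriv ?H (1,0) (v \<epsilon>)) \<in> gdt U"
    unfolding gderiv_def using v(1) colombeau_rel_refl[OF acc vt] by (auto simp: gclass_iff)
  from grestrict0_eq[OF r1 this vt] grestrict0_eq[OF r0 v(1,2)] N show thesis
    using that[OF v(1,2)] by (simp add: iter_deriv_def)
qed

section \<open>Partial derivatives on the half-space as ordinary derivatives\<close>

lemma half_space_deriv_t:
  assumes f: "smooth_on half_space f" and \<alpha>: "\<alpha> \<in> multi_indices" and t: "t \<ge> 0"
  shows "((\<lambda>s. iter_deriv half_space \<alpha> f (s, x)) has_real_derivative
     iter_deriv half_space ((1,0) # \<alpha>) f (t, x)) (at t within {0..})"
proof -
  have "(t, x) \<in> half_space" using t by simp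
  from smooth_on_deriv[OF f \<alpha> half_space_basis(1) this]
  have "((\<lambda>h. iter_deriv half_space \<alpha> f (t + h, x)) has_real_derivative
     iter_deriv half_space ((1,0) # \<alpha>) f (t, x)) (at 0 within {h. 0 \<le> t + h})"
    by (simp add: has_real_derivative_iff_has_vector_derivative)
  moreover have "(+) t ` {h. 0 \<le> t + h} = {0..}" by (auto simp: image_iff intro!: exI[of _ "x - t" for x])
  ultimately show ?thesis
    using DERIV_at_within_shift[of "\<lambda>s. iter_deriv half_space \<alpha> f (s, x)" _ t 0 "{h. 0 \<le> t + h}"] by simp
qed

lemma half_space_deriv_x:
  assumes f: "smooth_on half_space f" and \<alpha>: "\<alpha> \<in> multi_indices" and t: "t \<ge> 0"
  shows "((\<lambda>y. iter_deriv half_space \<alpha> f (t, y)) has_real_derivative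
     iter_deriv half_space ((0,1) # \<alpha>) f (t, x)) (at x)"
proof -
  have "(t, x) \<in> half_space" using t by simp
  from smooth_on_deriv[OF f \<alpha> half_space_basis(2) this]
  have "((\<lambda>h. iter_deriv half_space \<alpha> f (t, x + h)) has_real_derivative
     iter_deriv half_space ((0,1) # \<alpha>) f (t, x)) (at 0)"
    using t by (simp add: has_real_derivative_iff_has_vector_derivative)
  then show ?thesis
    using DERIV_shift[of "\<lambda>y. iter_deriv half_space \<alpha> f (t, y)" _ 0 x] by (simp add: add.commute)
qed

section \<open>Pairing smooth functions with test functions\<close>

text \<open>For test functions of radius at most \<open>B\<close> this is the integral over the
  whole line. The compact interval allows differentiation under the integral and makes the bounds on
  a slab applicable.\<close>

definition pairing :: "real \<Rightarrow> (real \<times> real \<Rightarrow> real) \<Rightarrow> real \<Rightarrow> real functional" where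
  "pairing B f s \<eta> = integral {-B..B} (\<lambda>x. f (s, x) * \<eta> x)"

lemma slice_cont:
  assumes "continuous_on half_space f" "s \<ge> 0"
  shows "continuous_on S (\<lambda>x. f (s, x))"
  by (rule continuous_on_compose2[OF assms(1)]) (use assms(2) in \<open>auto intro!: continuous_intros\<close>)

lemma pairing_integrable:
  assumes "continuous_on half_space f" "s \<ge> 0" "\<eta> \<in> tests R"
  shows "(\<lambda>x. f (s, x) * \<eta> x) integrable_on {-B..B}"
  by (intro integrable_continuous_real continuous_on_mult slice_cont[OF assms(1,2)] tests_cont0[OF assms(3)])

lemma pairing_lin:
  assumes "continuous_on half_space f" "s \<ge> 0"
  shows "test_linear (pairing B f s)"
  unfolding test_linear_def
proof (intro conjI allI ballI)
  fix R \<eta> r assume "\<eta> \<in> tests R"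
  show "pairing B f s (\<lambda>x. r * \<eta> x) = r * pairing B f s \<eta>"
    unfolding pairing_def by (subst integral_mult_right[symmetric]) (simp add: mult_ac)
next
  fix R \<eta> \<zeta> assume t: "\<eta> \<in> tests R" "\<zeta> \<in> tests R"
  show "pairing B f s (\<lambda>x. \<eta> x + \<zeta> x) = pairing B f s \<eta> + pairing B f s \<zeta>"
    unfolding pairing_def distrib_left
    by (rule integral_add[OF pairing_integrable[OF assms t(1)] pairing_integrable[OF assms t(2)]])
qed

lemma pairing_bound:
  assumes f: "continuous_on {-B..B} (\<lambda>x. f (s, x))" and \<eta>: "\<eta> \<in> tests R" and B: "0 \<le> B"
    and F: "\<And>x. x \<in> {-B..B} \<Longrightarrow> \<bar>f (s, x)\<bar> \<le> F" and A: "\<And>x. \<bar>\<eta> x\<bar> \<le> A"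
  shows "\<bar>pairing B f s \<eta>\<bar> \<le> 2 * B * F * A"
proof -
  have "norm (integral (cbox (-B) B) (\<lambda>x. f (s, x) * \<eta> x)) \<le> (F * A) * measure lborel (cbox (-B) B)"
  proof (rule integrable_bound)
    show "0 \<le> F * A" using F[of 0] A[of 0] B by (intro mult_nonneg_nonneg) auto
    show "(\<lambda>x. f (s, x) * \<eta> x) integrable_on cbox (- B) B" 
      by (intro integrable_continuous continuous_on_mult tests_cont0[OF \<eta>]) (use f in simp)
    show "\<And>x. x \<in> cbox (- B) B \<Longrightarrow> norm (f (s, x) * \<eta> x) \<le> F * A"
      using F A by (auto simp: abs_mult intro!: mult_mono intro: order_trans[OF abs_ge_zero])
  qed
  then show ?thesis using B by (simp add: pairing_def mult_ac)
qed

lemma slab_bounded: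
  fixes f :: "real \<times> real \<Rightarrow> real"
  assumes "continuous_on half_space f"
  obtains F where "0 \<le> F" "\<And>s x. s \<in> {0..T} \<Longrightarrow> x \<in> {-B..B} \<Longrightarrow> \<bar>f (s, x)\<bar> \<le> F"
proof -
  have "compact (f ` ({0..T} \<times> {-B..B}))"
    by (intro compact_continuous_image continuous_on_subset[OF assms] compact_Times) auto
  then have "bounded (f ` ({0..T} \<times> {-B..B}))" by (rule compact_imp_bounded)
  then obtain F where "\<forall>p\<in>{0..T} \<times> {-B..B}. \<bar>f p\<bar> \<le> F" unfolding bounded_iff by auto
  then have "\<bar>f (s, x)\<bar> \<le> max F 0" if "s \<in> {0..T}" "x \<in> {-B..B}" for s x
    using that by (intro max.coboundedI1) simp
  with max.cobounded2 show thesis by (rule that)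
qed

lemma pairing_ctrl:
  assumes f: "continuous_on half_space f" and B: "0 \<le> B"
  shows "\<exists>M\<ge>0. \<forall>s\<in>{0..T}. order_bound R M 0 (pairing B f s)"
proof -
  obtain F where F: "0 \<le> F" "\<And>s x. s \<in> {0..T} \<Longrightarrow> x \<in> {-B..B} \<Longrightarrow> \<bar>f (s, x)\<bar> \<le> F"
    using slab_bounded[OF f] by blast
  have "order_bound R (2 * B * F) 0 (pairing B f s)" if "s \<in> {0..T}" for s
    unfolding order_bound_def
  proof (intro ballI allI impI)
    fix \<eta> A assume \<eta>: "\<eta> \<in> tests R" and A: "\<forall>k\<le>0. \<forall>x. \<bar>dv k \<eta> x\<bar> \<le> A"
    show "\<bar>pairing B f s \<eta>\<bar> \<le> 2 * B * F * A"
      by (rule pairing_bound[OF slice_cont[OF f] \<eta> B]) (use that F A in auto)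
  qed
  then show ?thesis using F(1) B by (intro exI[of _ "2 * B * F"]) auto
qed

lemma pairing_deriv:
  assumes f: "smooth_on half_space f" and \<alpha>: "\<alpha> \<in> multi_indices" and s: "s \<ge> 0" and \<eta>: "\<eta> \<in> tests R"
  shows "((\<lambda>s. pairing B (iter_deriv half_space \<alpha> f) s \<eta>) has_real_derivative
     pairing B (iter_deriv half_space ((1,0) # \<alpha>) f) s \<eta>) (at s within {0..})"
proof -
  have \<alpha>': "(1,0) # \<alpha> \<in> multi_indices" using \<alpha> half_space_basis by (simp add: multi_indices_Cons)
  note c = smooth_on_cont[OF f \<alpha>] smooth_on_cont[OF f \<alpha>']
  have "((\<lambda>s. integral (cbox (-B) B) (\<lambda>x. iter_deriv half_space \<alpha> f (s, x) * \<eta> x)) has_real_derivative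
      integral (cbox (-B) B) (\<lambda>x. iter_deriv half_space ((1,0) # \<alpha>) f (s, x) * \<eta> x)) (at s within {0..})"
  proof (rule leibniz_rule_field_derivative)
    show "((\<lambda>s. iter_deriv half_space \<alpha> f (s, x) * \<eta> x) has_real_derivative
        iter_deriv half_space ((1,0) # \<alpha>) f (s, x) * \<eta> x) (at s within {0..})" if "s \<in> {0..}" for s x
      using that by (intro DERIV_cmult_right half_space_deriv_t[OF f \<alpha>]) simp
    show "(\<lambda>x. iter_deriv half_space \<alpha> f (s, x) * \<eta> x) integrable_on cbox (- B) B" if "s \<in> {0..}" for s
      using pairing_integrable[OF c(1) _ \<eta>] that by simp
    have "continuous_on ({0..} \<times> cbox (- B) B) (\<lambda>p. iter_deriv half_space ((1, 0) # \<alpha>) f p * \<eta> (snd p))"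
      by (intro continuous_on_mult continuous_on_subset[OF c(2)] continuous_on_compose2[OF tests_cont0[OF \<eta>, of UNIV]]
           continuous_intros) auto
    then show "continuous_on ({0..} \<times> cbox (- B) B) (\<lambda>(s, x). iter_deriv half_space ((1, 0) # \<alpha>) f (s, x) * \<eta> x)"
      by (simp add: split_beta)
  qed (use s in auto)
  then show ?thesis by (simp add: pairing_def)
qed

lemma integral_by_parts_test:
  assumes g: "\<And>x. (g has_real_derivative g' x) (at x)" and g': "continuous_on UNIV g'"
    and \<eta>: "\<eta> \<in> tests R" and B: "R < B" "0 \<le> B"
  shows "integral {-B..B} (\<lambda>x. g' x * \<eta> x) = - integral {-B..B} (\<lambda>x. g x * deriv \<eta> x)"
proof -
  have d: "deriv \<eta> \<in> tests R" using tests_dv[OF \<eta>, of 1] by simp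
  have "((\<lambda>x. g' x * \<eta> x + deriv \<eta> x * g x) has_integral (g B * \<eta> B - g (-B) * \<eta> (-B))) {-B..B}"
  proof (rule fundamental_theorem_of_calculus)
    fix x
    have "((\<lambda>x. g x * \<eta> x) has_real_derivative g' x * \<eta> x + deriv \<eta> x * g x) (at x within {-B..B})"
      using DERIV_mult[OF g[of x] tests_DERIV[OF \<eta>, of 0 x]] by (simp add: has_field_derivative_at_within)
    then show "((\<lambda>x. g x * \<eta> x) has_vector_derivative g' x * \<eta> x + deriv \<eta> x * g x) (at x within {-B..B})"
      by (simp add: has_real_derivative_iff_has_vector_derivative)
  qed (use B in simp)
  \<comment> \<open>Because \<open>R < B\<close> is strict, the test function vanishes at the end
    points themselves, and with it the boundary terms.\<close>
  moreover have "\<eta> B = 0" "\<eta> (-B) = 0" using tests_zero[OF \<eta>] B by auto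
  ultimately have z: "((\<lambda>x. g' x * \<eta> x + deriv \<eta> x * g x) has_integral 0) {-B..B}" by simp
  have gc: "continuous_on S g" for S
    using g by (meson DERIV_isCont continuous_at_imp_continuous_on)
  have i: "(\<lambda>x. g' x * \<eta> x) integrable_on {-B..B}" "(\<lambda>x. deriv \<eta> x * g x) integrable_on {-B..B}"
    by (intro integrable_continuous_real continuous_on_mult gc tests_cont0[OF \<eta>] tests_cont0[OF d]
        continuous_on_subset[OF g'] subset_UNIV)+
  have "integral {-B..B} (\<lambda>x. g' x * \<eta> x) + integral {-B..B} (\<lambda>x. deriv \<eta> x * g x) = 0"
    using integral_add[OF i] integral_unique[OF z] by simp
  then show ?thesis by (simp add: mult.commute)
qed

lemma pairing_parts:
  assumes f: "smooth_on half_space f" and s: "s \<ge> 0" and \<eta>: "\<eta> \<in> tests R" and B: "R < B" "0 \<le> B"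
  shows "pairing B (iter_deriv half_space [(0,1),(0,1)] f) s \<eta> = pairing B f s (dv 2 \<eta>)"
proof -
  have d: "deriv \<eta> \<in> tests R" using tests_dv[OF \<eta>, of 1] by simp
  have \<alpha>: "[(0,1),(0,1)] \<in> (multi_indices :: (real\<times>real) list set)" by (auto simp: multi_indices_def half_space_basis)
  show ?thesis
    using integral_by_parts_test[OF half_space_deriv_x[OF f half_space_indices(2) s]
         slice_cont[OF smooth_on_cont[OF f \<alpha>] s] \<eta> B]
      integral_by_parts_test[OF half_space_deriv_x[OF f multi_indices_Nil s]
         slice_cont[OF smooth_on_cont[OF f half_space_indices(2)] s] d B]
    by (simp add: pairing_def iter_deriv_Nil numeral_2_eq_2)
qed

section \<open>Mollified initial data\<close>

lemma lborel_integral_compact: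
  fixes f :: "real \<Rightarrow> real"
  assumes f: "continuous_on {-B..B} f" and z: "\<And>x. \<bar>x\<bar> > B \<Longrightarrow> f x = 0"
  shows "(LINT x|lborel. f x) = integral {-B..B} f"
proof -
  have "(LINT x|lborel. f x) = (LINT x:{-B..B}|lborel. f x)"
    unfolding set_lebesgue_integral_def
  proof (rule Bochner_Integration.integral_cong)
    show "f x = indicator {-B..B} x *\<^sub>R f x" for x
      using z[of x] by (cases "x \<in> {-B..B}") auto
  qed simp
  also have "\<dots> = integral {-B..B} f"
    by (rule set_borel_integral_eq_integral(2)[OF borel_integrable_atLeastAtMost'[OF f]])
  finally show ?thesis .
qed

text \<open>The Taylor estimate in the upper limit of integration, with the quadratic remainder that
  \<open>has_real_derivative_moving_test\<close> requires.\<close>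

lemma integral_taylor:
  fixes h :: "real \<Rightarrow> real"
  assumes h: "\<And>x. (h has_real_derivative h' x) (at x)" and C: "\<And>x. \<bar>h' x\<bar> \<le> C"
    and s: "s \<in> {a..b}" "s0 \<in> {a..b}"
  shows "\<bar>integral {a..s} h - integral {a..s0} h - (s - s0) * h s0\<bar> \<le> C * (s - s0)\<^sup>2"
proof -
  have hc: "continuous_on {a..b} h" using h by (meson DERIV_isCont continuous_at_imp_continuous_on)
  have sub: "closed_segment s0 s \<subseteq> {a..b}" using s by (auto simp: closed_segment_eq_real_ivl)
  let ?g = "\<lambda>y. integral {a..y} h - y * h s0"
  have "norm (?g s - ?g s0) \<le> (C * \<bar>s - s0\<bar>) * norm (s - s0)"
  proof (rule field_differentiable_bound[of "closed_segment s0 s" ?g "\<lambda>y. h y - h s0"])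
    fix z assume z: "z \<in> closed_segment s0 s"
    have "((\<lambda>y. integral {a..y} h) has_real_derivative h z) (at z within {a..b})"
      by (rule integral_has_real_derivative[OF hc]) (use z sub in auto)
    then have "((\<lambda>y. integral {a..y} h) has_real_derivative h z) (at z within closed_segment s0 s)"
      by (rule has_field_derivative_subset[OF _ sub])
    then show "(?g has_real_derivative h z - h s0) (at z within closed_segment s0 s)"
      by (auto intro!: derivative_eq_intros)
    have "\<bar>h (s0 + (z - s0)) - h s0\<bar> \<le> C * \<bar>z - s0\<bar>" by (rule taylor_bounds(1)[OF h C])
    also have "\<dots> \<le> C * \<bar>s - s0\<bar>"
    proof (rule mult_left_mono)
      show "\<bar>z - s0\<bar> \<le> \<bar>s - s0\<bar>" using z by (auto simp: closed_segment_eq_real_ivl split: if_splits)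
      show "0 \<le> C" using C[of 0] by linarith
    qed
    finally show "norm (h z - h s0) \<le> C * \<bar>s - s0\<bar>" by simp
  qed auto
  then show ?thesis by (simp add: algebra_simps power2_eq_square)
qed

lemma dv_reflect:
  assumes g: "g \<in> tests G"
  shows "dv k (\<lambda>y. g (x - y)) = (\<lambda>y. (-1) ^ k * dv k g (x - y))"
    and "G + \<bar>x\<bar> \<le> G' \<Longrightarrow> (\<lambda>y. g (x - y)) \<in> tests G'"
proof -
  have d: "((\<lambda>y. (-1) ^ k * dv k g (x - y)) has_real_derivative (-1) ^ Suc k * dv (Suc k) g (x - y)) (at y)" for k y
  proof -
    have "((\<lambda>y. dv k g (x - y)) has_real_derivative dv (Suc k) g (x - y) * (- 1)) (at y)"
      by (rule DERIV_chain2[OF tests_DERIV[OF g]]) (auto intro!: derivative_eq_intros)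
    from DERIV_cmult[OF this, of "(-1) ^ k"] show ?thesis by (simp add: mult_ac)
  qed
  show "dv k (\<lambda>y. g (x - y)) = (\<lambda>y. (-1) ^ k * dv k g (x - y))"
    by (rule dv_eqI[where D="\<lambda>k y. (-1) ^ k * dv k g (x - y)"]) (simp, rule d)
  show "(\<lambda>y. g (x - y)) \<in> tests G'" if "G + \<bar>x\<bar> \<le> G'"
    by (rule testsI[where D="\<lambda>k y. (-1) ^ k * dv k g (x - y)"])
       (simp, rule d, use that tests_zero[OF g] in auto)
qed

text \<open>Convolution with a distribution is an instance of a moving test function: the curve of
  functionals is constantly \<open>w\<close>, and only the reflected, translated kernel
  moves.\<close>

lemma mollified_cont:
  assumes w: "test_linear w" "\<And>R. \<exists>M N. order_bound R M N w" and g: "g \<in> tests G"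
  shows "continuous_on {-B..B} (distr_conv w g)"
  unfolding continuous_on_eq_continuous_within distr_conv_def
proof
  fix s0 assume s0: "s0 \<in> {-B..B}"
  obtain M N where MN: "order_bound (G + B) M N w" using w(2) by blast
  obtain A where A: "\<And>k x. k \<le> Suc N \<Longrightarrow> \<bar>dv k g x\<bar> \<le> A" using common_bound[OF g] by blast
  show "continuous (at s0 within {-B..B}) (\<lambda>x. w (\<lambda>y. g (x - y)))"
  proof (rule continuous_moving_test[where L="\<lambda>_. w" and g="\<lambda>x y. g (x - y)" and C=A and R="G+B" and M=M and N=N])
    show "\<And>s. s \<in> {- B..B} \<Longrightarrow> (\<lambda>y. g (s - y)) \<in> tests (G + B)"
      by (rule dv_reflect(2)[OF g]) auto
    fix k s y assume "s \<in> {-B..B}" "k \<le> N"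
    then show "\<bar>dv k (\<lambda>y. g (s - y)) y - dv k (\<lambda>y. g (s0 - y)) y\<bar> \<le> A * \<bar>s - s0\<bar>"
      using taylor_bounds(1)[of "dv k g" "dv (Suc k) g" A "s0 - y" "s - s0", OF tests_DERIV[OF g] A[of "Suc k"]]
      unfolding dv_reflect(1)[OF g] by (simp add: abs_mult right_diff_distrib[symmetric] del: funpow.simps)
  qed (use s0 MN w(1) in auto)
qed

text \<open>Both sides have the same derivative with respect to the upper limit of integration.\<close>

lemma mollified_pairing:
  assumes w: "test_linear w" "\<And>R. \<exists>M N. order_bound R M N w" and g: "g \<in> tests G" and \<eta>: "\<eta> \<in> tests R" and B: "0 \<le> B"
  shows "integral {-B..B} (\<lambda>x. distr_conv w g x * \<eta> x) = w (\<lambda>y. integral {-B..B} (\<lambda>x. g (x - y) * \<eta> x))"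
proof -
  define h where "h k y x = (-1) ^ k * dv k g (x - y) * \<eta> x" for k y x
  define J where "J b y = integral {-B..b} (\<lambda>x. g (x - y) * \<eta> x)" for b y
  have J0: "J b y = integral {-B..b} (h 0 y)" for b y by (simp add: J_def h_def[abs_def])
  have g\<eta>: "((\<lambda>y. h k y x) has_real_derivative h (Suc k) y x) (at y)" for k y x
  proof -
    have "((\<lambda>y. dv k g (x - y)) has_real_derivative dv (Suc k) g (x - y) * (- 1)) (at y)"
      by (rule DERIV_chain2[OF tests_DERIV[OF g]]) (auto intro!: derivative_eq_intros)
    from DERIV_cmult_right[OF DERIV_cmult[OF this, of "(-1) ^ k"], of "\<eta> x"] show ?thesis by (simp add: mult_ac h_def)
  qed
  have hc: "continuous_on S (\<lambda>(y, x). h k y x)" for S k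
    unfolding h_def split_beta
    by (intro continuous_intros continuous_on_compose2[OF tests_cont[OF g, of UNIV]]
        continuous_on_compose2[OF tests_cont0[OF \<eta>, of UNIV]]) auto
  have hc1: "continuous_on S (h k y)" for S k y
    unfolding h_def
    by (intro continuous_intros continuous_on_compose2[OF tests_cont[OF g, of UNIV]]
        tests_cont0[OF \<eta>]) auto
  have Jd: "((\<lambda>y. integral {-B..b} (h k y)) has_real_derivative integral {-B..b} (h (Suc k) y)) (at y)" for k b y
  proof -
    have "((\<lambda>y. integral (cbox (-B) b) (h k y)) has_real_derivative integral (cbox (-B) b) (h (Suc k) y)) (at y within UNIV)"
    proof (rule leibniz_rule_field_derivative)
      show "continuous_on (UNIV \<times> cbox (- B) b) (\<lambda>(y, x). h (Suc k) y x)" by (rule hc)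
      show "\<And>y. h k y integrable_on cbox (- B) b" using hc1 by (intro integrable_continuous) auto
      show "((\<lambda>y. h k y x) has_real_derivative h (Suc k) y x) (at y within UNIV)" for x y using g\<eta> by simp
    qed auto
    then show ?thesis by simp
  qed
  have Jt: "J b \<in> tests (G + B)" if "b \<in> {-B..B}" for b
  proof (rule testsI[where D="\<lambda>k y. integral {-B..b} (h k y)"])
    fix y assume y: "\<bar>y\<bar> > G + B"
    have "integral {-B..b} (h 0 y) = integral {-B..b} (\<lambda>x. 0)"
      by (rule integral_cong) (use y that tests_zero[OF g] in \<open>auto simp: h_def\<close>)
    then show "J b y = 0" by (simp add: J0)
  qed (use J0 Jd in auto)
  have Jdv: "dv k (J b) y = integral {-B..b} (h k y)" for k b y
    using dv_eqI[where D="\<lambda>k y. integral {-B..b} (h k y)" and f="J b" and k=k] J0 Jd by metis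
  obtain M N where MN: "order_bound (G + B) M N w" using w(2) by blast
  obtain A where A: "\<And>k x. k \<le> Suc N \<Longrightarrow> \<bar>dv k g x\<bar> \<le> A" using common_bound[OF g] by blast
  obtain A' where A': "\<And>k x. k \<le> 1 \<Longrightarrow> \<bar>dv k \<eta> x\<bar> \<le> A'" using common_bound[OF \<eta>] by blast
  \<comment> \<open>The product rule for the derivative of \<open>h k y\<close> in \<open>x\<close>,
    with bounds that are uniform in \<open>y\<close> and in \<open>k \<le> N\<close>.\<close>
  define C where "C = 2 * A * A'"
  have hx: "(h k y has_real_derivative (-1) ^ k * dv (Suc k) g (x - y) * \<eta> x + (-1) ^ k * dv k g (x - y) * deriv \<eta> x) (at x)" for k x y
  proof -
    have "((\<lambda>x. dv k g (x - y)) has_real_derivative dv (Suc k) g (x - y) * 1) (at x)"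
      by (rule DERIV_chain2[OF tests_DERIV[OF g]]) (auto intro!: derivative_eq_intros)
    from DERIV_mult[OF DERIV_cmult[OF this, of "(-1) ^ k"] tests_DERIV[OF \<eta>, of 0 x]]
    show ?thesis unfolding h_def by (simp add: mult_ac)
  qed
  have hb: "\<bar>(-1) ^ k * dv (Suc k) g (x - y) * \<eta> x + (-1) ^ k * dv k g (x - y) * deriv \<eta> x\<bar> \<le> C" if "k \<le> N" for k x y
  proof -
    have "\<bar>dv (Suc k) g (x - y)\<bar> * \<bar>\<eta> x\<bar> \<le> A * A'" 
      using A[of "Suc k" "x-y"] A'[of 0 x] that
      by (intro mult_mono) (auto intro: order_trans[OF abs_ge_zero])
    moreover have "\<bar>dv k g (x - y)\<bar> * \<bar>deriv \<eta> x\<bar> \<le> A * A'"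
      using A[of k "x-y"] A'[of 1 x] that
      by (intro mult_mono) (auto intro: order_trans[OF abs_ge_zero])
    ultimately show ?thesis unfolding C_def
      by (intro order_trans[OF abs_triangle_ineq]) (simp add: abs_mult del: funpow.simps)
  qed
  \<comment> \<open>Again the constant curve \<open>w\<close>, now tested with \<open>J b\<close>.
    The summand \<open>0\<close> is the derivative of the constant curve, the other one comes from
    the motion of the upper limit.\<close>
  have K: "((\<lambda>b. w (J b)) has_real_derivative 0 + w (\<lambda>y. \<eta> b * g (b - y))) (at b within {-B..B})" if b: "b \<in> {-B..B}" for b
  proof (rule has_real_derivative_moving_test[where L="\<lambda>_. w" and g=J and C=C and R="G+B" and M=M and N=N])
    have gb: "(\<lambda>y. g (b - y)) \<in> tests (G + B)" by (rule dv_reflect(2)[OF g]) (use b in auto)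
    show "(\<lambda>y. \<eta> b * g (b - y)) \<in> tests (G + B)" by (rule tests_scale[OF gb])
    fix k s y assume s: "s \<in> {-B..B}" "k \<le> N"
    show "\<bar>dv k (J s) y - dv k (J b) y - (s - b) * dv k (\<lambda>y. \<eta> b * g (b - y)) y\<bar> \<le> C * (s - b)\<^sup>2"
      using integral_taylor[OF hx hb[OF s(2)] s(1) b, of y]
      unfolding Jdv dv_scale[OF gb] dv_reflect(1)[OF g] by (simp add: h_def mult_ac)
  qed (use b MN w(1) Jt in auto)
  have K': "((\<lambda>b. w (J b)) has_vector_derivative distr_conv w g b * \<eta> b) (at b within {-B..B})" if b: "b \<in> {-B..B}" for b
  proof -
    have gb: "(\<lambda>y. g (b - y)) \<in> tests (G + B)" by (rule dv_reflect(2)[OF g]) (use b in auto)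
    show ?thesis using K[OF b] test_linear_scale[OF w(1) gb, of "\<eta> b"]
      by (simp add: has_real_derivative_iff_has_vector_derivative distr_conv_def mult.commute)
  qed
  have "((\<lambda>x. distr_conv w g x * \<eta> x) has_integral (w (J B) - w (J (-B)))) {-B..B}"
    by (rule fundamental_theorem_of_calculus[OF _ K']) (use B in auto)
  moreover have "w (J (-B)) = 0"
  proof -
    \<comment> \<open>The empty integral is written as a multiple of a test function, so that
      homogeneity of \<open>w\<close> gives the value \<open>0\<close>.\<close>
    have "J (-B) = (\<lambda>y. 0 * g y)" by (auto simp: J_def)
    then show ?thesis using test_linear_scale[OF w(1) g, of 0] by simp
  qed
  ultimately show ?thesis by (simp add: integral_unique J_def[abs_def])
qed

lemma scaled_tests:
  assumes \<psi>: "\<psi> \<in> tests G" and \<epsilon>: "\<epsilon> \<in> {0<..1::real}"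
  shows "scaled \<psi> \<epsilon> \<in> tests G"
proof (rule testsI[where D="\<lambda>k x. dv k \<psi> (x / \<epsilon>) / \<epsilon> ^ Suc k"])
  fix k x
  have "((\<lambda>x. dv k \<psi> (x / \<epsilon>)) has_real_derivative dv (Suc k) \<psi> (x / \<epsilon>) * (1 / \<epsilon>)) (at x)"
    by (rule DERIV_chain2[OF tests_DERIV[OF \<psi>]]) (use \<epsilon> in \<open>auto intro!: derivative_eq_intros\<close>)
  from DERIV_cdivide[OF this, of "\<epsilon> ^ Suc k"]
  show "((\<lambda>x. dv k \<psi> (x / \<epsilon>) / \<epsilon> ^ Suc k) has_real_derivative dv (Suc k) \<psi> (x / \<epsilon>) / \<epsilon> ^ Suc (Suc k)) (at x)"
    by (simp add: mult_ac)
next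
  fix x :: real assume "\<bar>x\<bar> > G"
  moreover have "\<bar>x\<bar> \<le> \<bar>x / \<epsilon>\<bar>" using \<epsilon> by (simp add: abs_mult le_divide_eq mult_left_le)
  ultimately show "scaled \<psi> \<epsilon> x = 0" using tests_zero[OF \<psi>, of "x / \<epsilon>"] by (simp add: scaled_def)
qed (use \<epsilon> in \<open>simp add: scaled_def\<close>)

text \<open>The mollifier is moved to the test function: the integral is \<open>w J\<close> with
  \<open>J y\<close> the integral of \<open>\<psi> z * \<eta> (y + \<epsilon> * z)\<close>. As
  \<open>\<psi>\<close> has integral \<open>1\<close>, each derivative of \<open>J - \<eta>\<close>
  averages increments over distances of order \<open>\<epsilon>\<close> and is
  \<open>O(\<epsilon>)\<close>; the order bound of \<open>w\<close> concludes.\<close>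

lemma mollifier_convergence:
  assumes w: "test_linear w" "\<And>R. \<exists>M N. order_bound R M N w" and \<psi>: "\<psi> \<in> tests G" "(LINT x|lborel. \<psi> x) = 1" and B: "R < B" "0 \<le> R" "0 \<le> G"
  shows "\<exists>C. \<forall>\<epsilon>\<in>{0<..1::real}. \<forall>\<eta>\<in>test_ball R A.
     \<bar>integral {-B..B} (\<lambda>x. distr_conv w (scaled \<psi> \<epsilon>) x * \<eta> x) - w \<eta>\<bar> \<le> C * \<epsilon>"
proof -
  obtain P where P: "\<And>x. \<bar>\<psi> x\<bar> \<le> P" using tests_bounded[OF \<psi>(1), of 0] by auto
  have P0: "0 \<le> P" using P[of 0] by linarith
  obtain M0 N where "order_bound (R + G) M0 N w" using w(2) by blast
  then have MN: "order_bound (R + G) \<bar>M0\<bar> N w" by (rule order_bound_mono) auto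
  \<comment> \<open>\<open>2 * G\<close> is the length of the interval of integration,
    \<open>P\<close> bounds \<open>\<psi>\<close>, and the other \<open>G\<close> comes from
    \<open>\<bar>\<epsilon> * z\<bar> \<le> \<epsilon> * G\<close>. The sum serves all orders
    \<open>k \<le> N\<close>.\<close>
  define A' where "A' = 2 * G * (P * G) * (\<Sum>k\<le>N. \<bar>A (Suc k)\<bar>)"
  have \<psi>1: "integral {-G..G} \<psi> = 1"
    using lborel_integral_compact[OF tests_cont0[OF \<psi>(1)] tests_zero[OF \<psi>(1)]] \<psi>(2) by simp
  have main: "\<bar>integral {-B..B} (\<lambda>x. distr_conv w (scaled \<psi> \<epsilon>) x * \<eta> x) - w \<eta>\<bar> \<le> \<bar>M0\<bar> * (A' * \<epsilon>)"
    if \<epsilon>: "\<epsilon> \<in> {0<..1}" and \<eta>b: "\<eta> \<in> test_ball R A" for \<epsilon> \<eta>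
  proof -
    have \<eta>: "\<eta> \<in> tests R" and A: "\<And>k x. \<bar>dv k \<eta> x\<bar> \<le> A k" using \<eta>b by (auto simp: test_ball_def)
    have g: "scaled \<psi> \<epsilon> \<in> tests G" by (rule scaled_tests[OF \<psi>(1) \<epsilon>])
    define J where "J y = integral {-G..G} (\<lambda>z. \<psi> z * \<eta> (y + \<epsilon> * z))" for y
    have J: "integral {-B..B} (\<lambda>x. scaled \<psi> \<epsilon> (x - y) * \<eta> x) = J y" for y
    proof -
      have "integral {-B..B} (\<lambda>x. scaled \<psi> \<epsilon> (x - y) * \<eta> x) = (LINT x|lborel. scaled \<psi> \<epsilon> (x - y) * \<eta> x)"
        by (rule lborel_integral_compact[symmetric])
           (use tests_zero[OF \<eta>] B in \<open>auto intro!: continuous_intros tests_cont0[OF \<eta>] continuous_on_compose2[OF tests_cont0[OF g, of UNIV]]\<close>)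
      also have "\<dots> = \<bar>\<epsilon>\<bar> *\<^sub>R (LINT z|lborel. scaled \<psi> \<epsilon> (y + \<epsilon> * z - y) * \<eta> (y + \<epsilon> * z))"
        using \<epsilon> by (intro lborel_integral_real_affine) auto
      also have "\<dots> = (LINT z|lborel. \<psi> z * \<eta> (y + \<epsilon> * z))"
        using \<epsilon> by (simp add: scaled_def)
      also have "\<dots> = J y" unfolding J_def
        by (rule lborel_integral_compact)
           (use tests_zero[OF \<psi>(1)] in \<open>auto intro!: continuous_intros tests_cont0[OF \<psi>(1)] continuous_on_compose2[OF tests_cont0[OF \<eta>, of UNIV]]\<close>)
      finally show ?thesis .
    qed
    have jd: "((\<lambda>y. integral {-G..G} (\<lambda>z. \<psi> z * dv k \<eta> (y + \<epsilon> * z))) has_real_derivative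
        integral {-G..G} (\<lambda>z. \<psi> z * dv (Suc k) \<eta> (y + \<epsilon> * z))) (at y)" for k y
    proof -
      have "((\<lambda>y. integral (cbox (-G) G) (\<lambda>z. \<psi> z * dv k \<eta> (y + \<epsilon> * z))) has_real_derivative
        integral (cbox (-G) G) (\<lambda>z. \<psi> z * dv (Suc k) \<eta> (y + \<epsilon> * z))) (at y within UNIV)"
      proof (rule leibniz_rule_field_derivative)
        show "((\<lambda>y. \<psi> z * dv k \<eta> (y + \<epsilon> * z)) has_real_derivative \<psi> z * dv (Suc k) \<eta> (y + \<epsilon> * z)) (at y within UNIV)" for y z
          by (rule DERIV_cmult, rule DERIV_shift_arg, rule tests_DERIV[OF \<eta>])
        show "(\<lambda>z. \<psi> z * dv k \<eta> (y + \<epsilon> * z)) integrable_on cbox (- G) G" for y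
          by (intro integrable_continuous continuous_intros tests_cont0[OF \<psi>(1)] continuous_on_compose2[OF tests_cont[OF \<eta>, of UNIV]]) auto
        show "continuous_on (UNIV \<times> cbox (- G) G) (\<lambda>(y, z). \<psi> z * dv (Suc k) \<eta> (y + \<epsilon> * z))"
          unfolding split_beta
          by (intro continuous_intros continuous_on_compose2[OF tests_cont0[OF \<psi>(1), of UNIV]] continuous_on_compose2[OF tests_cont[OF \<eta>, of UNIV]]) auto
      qed auto
      then show ?thesis by simp
    qed
    have Jt: "J \<in> tests (R + G)"
    proof (rule testsI[where D="\<lambda>k y. integral {-G..G} (\<lambda>z. \<psi> z * dv k \<eta> (y + \<epsilon> * z))"])
      fix y assume y: "\<bar>y\<bar> > R + G"
      have "integral {-G..G} (\<lambda>z. \<psi> z * \<eta> (y + \<epsilon> * z)) = integral {-G..G} (\<lambda>z. 0)"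
      proof (rule integral_cong)
        fix z assume z: "z \<in> {-G..G}"
        have "\<bar>\<epsilon> * z\<bar> \<le> 1 * G" unfolding abs_mult using \<epsilon> z by (intro mult_mono) auto
        then have "\<bar>y + \<epsilon> * z\<bar> > R" using y by linarith
        then show "\<psi> z * \<eta> (y + \<epsilon> * z) = 0" using tests_zero[OF \<eta>] by simp
      qed
      then show "J y = 0" by (simp add: J_def)
    qed (use J_def jd in auto)
    have Jdv: "dv k J y = integral {-G..G} (\<lambda>z. \<psi> z * dv k \<eta> (y + \<epsilon> * z))" for k y
    proof -
      have "dv k J = (\<lambda>y. integral {-G..G} (\<lambda>z. \<psi> z * dv k \<eta> (y + \<epsilon> * z)))"
        by (rule dv_eqI[where D="\<lambda>k y. integral {-G..G} (\<lambda>z. \<psi> z * dv k \<eta> (y + \<epsilon> * z))"]) (simp add: J_def, rule jd)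
      then show ?thesis by simp
    qed
    have \<eta>': "\<eta> \<in> tests (R + G)" using tests_mono[OF \<eta>] B by simp
    have "\<bar>w (\<lambda>y. J y - \<eta> y)\<bar> \<le> \<bar>M0\<bar> * (A' * \<epsilon>)"
    proof (rule order_boundD[OF MN tests_diff[OF Jt \<eta>']])
      fix k y assume k: "k \<le> N"
      have i1: "(\<lambda>z. \<psi> z * dv k \<eta> (y + \<epsilon> * z)) integrable_on {-G..G}"
        by (intro integrable_continuous_real continuous_intros tests_cont0[OF \<psi>(1)] continuous_on_compose2[OF tests_cont[OF \<eta>, of UNIV]]) auto
      have i2: "(\<lambda>z. \<psi> z * dv k \<eta> y) integrable_on {-G..G}"
        by (intro integrable_continuous_real continuous_intros tests_cont0[OF \<psi>(1)])
      have "dv k \<eta> y = integral {-G..G} (\<lambda>z. \<psi> z * dv k \<eta> y)" using \<psi>1 by simp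
      then have "dv k J y - dv k \<eta> y = integral {-G..G} (\<lambda>z. \<psi> z * dv k \<eta> (y + \<epsilon> * z) - \<psi> z * dv k \<eta> y)"
        unfolding Jdv using integral_diff[OF i1 i2] by simp
      moreover have "norm (integral (cbox (-G) G) (\<lambda>z. \<psi> z * dv k \<eta> (y + \<epsilon> * z) - \<psi> z * dv k \<eta> y))
          \<le> (P * (A (Suc k) * (\<epsilon> * G))) * measure lborel (cbox (-G) G)"
      proof (rule integrable_bound)
        have A0: "0 \<le> A (Suc k)" using A[of "Suc k" 0] by linarith
        show "0 \<le> P * (A (Suc k) * (\<epsilon> * G))" using P0 A0 \<epsilon> B by simp
        show "(\<lambda>z. \<psi> z * dv k \<eta> (y + \<epsilon> * z) - \<psi> z * dv k \<eta> y) integrable_on cbox (- G) G"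
          using integrable_diff[OF i1 i2] by simp
        fix z assume z: "z \<in> cbox (-G) G"
        have "\<bar>dv k \<eta> (y + \<epsilon> * z) - dv k \<eta> y\<bar> \<le> A (Suc k) * \<bar>\<epsilon> * z\<bar>"
          by (rule taylor_bounds(1)[OF tests_DERIV[OF \<eta>] A])
        also have "\<dots> \<le> A (Suc k) * (\<epsilon> * G)"
          using z \<epsilon> A0 by (intro mult_left_mono) (auto simp: abs_mult)
        finally have "\<bar>\<psi> z\<bar> * \<bar>dv k \<eta> (y + \<epsilon> * z) - dv k \<eta> y\<bar> \<le> P * (A (Suc k) * (\<epsilon> * G))"
          using P P0 by (intro mult_mono) auto
        then show "norm (\<psi> z * dv k \<eta> (y + \<epsilon> * z) - \<psi> z * dv k \<eta> y) \<le> P * (A (Suc k) * (\<epsilon> * G))"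
          by (simp add: abs_mult[symmetric] right_diff_distrib)
      qed
      moreover have "(P * (A (Suc k) * (\<epsilon> * G))) * measure lborel (cbox (-G) G) \<le> A' * \<epsilon>"
      proof -
        have "A (Suc k) \<le> (\<Sum>k\<le>N. \<bar>A (Suc k)\<bar>)"
          using member_le_sum[of k "{..N}" "\<lambda>k. \<bar>A (Suc k)\<bar>"] k by simp
        then have "(2 * G * (P * G)) * A (Suc k) * \<epsilon> \<le> A' * \<epsilon>"
          unfolding A'_def using P0 B \<epsilon> by (intro mult_right_mono mult_left_mono) auto
        then show ?thesis using B by (simp add: mult_ac)
      qed
      ultimately show "\<bar>dv k (\<lambda>y. J y - \<eta> y) y\<bar> \<le> A' * \<epsilon>"
        unfolding dv_diff[OF Jt \<eta>'] by simp
    qed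
    then have "\<bar>w J - w \<eta>\<bar> \<le> \<bar>M0\<bar> * (A' * \<epsilon>)" using test_linear_diff[OF w(1) Jt \<eta>'] by simp
    moreover have "integral {-B..B} (\<lambda>x. distr_conv w (scaled \<psi> \<epsilon>) x * \<eta> x) = w J"
      using mollified_pairing[OF w g \<eta>, of B] B J by simp
    ultimately show ?thesis by simp
  qed
  then show ?thesis by (intro exI[of _ "\<bar>M0\<bar> * A'"]) (simp add: mult.assoc)
qed

section \<open>Distributions on the open half-plane\<close>

lemma vector_derivative_zero:
  assumes "\<forall>\<^sub>F h in nhds 0. f h = 0"
  shows "vector_derivative f (at (0::real)) = (0::real)"
proof -
  have "(f has_vector_derivative 0) (at 0) \<longleftrightarrow> ((\<lambda>_. 0::real) has_vector_derivative 0) (at (0::real))"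
    by (rule has_vector_derivative_cong_ev)
       (use assms eventually_nhds_x_imp_x[OF assms] in \<open>auto elim: eventually_mono\<close>)
  then show ?thesis by (intro vector_derivative_at) simp
qed

lemma iter_deriv_off_supp:
  assumes "p \<notin> supp \<theta>"
  shows "iter_deriv UNIV \<alpha> \<theta> p = 0"
  using assms
proof (induction \<alpha> arbitrary: p)
  case Nil
  then show ?case using closure_subset[of "{x. \<theta> x \<noteq> 0}"] by (auto simp: iter_deriv_Nil supp_def)
next
  case (Cons b \<alpha>)
  have op: "open (- supp \<theta>)" by (simp add: supp_def open_Compl)
  have "((\<lambda>h. p + h *\<^sub>R b) \<longlongrightarrow> p + 0 *\<^sub>R b) (nhds 0)"
    by (intro tendsto_intros filterlim_ident)
  then have "\<forall>\<^sub>F h in nhds 0. p + h *\<^sub>R b \<in> - supp \<theta>"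
    using topological_tendstoD[OF _ op] Cons.prems by fastforce
  then have "\<forall>\<^sub>F h in nhds 0. iter_deriv UNIV \<alpha> \<theta> (p + h *\<^sub>R b) = 0"
    by eventually_elim (use Cons.IH in auto)
  then show ?case
    unfolding iter_deriv_Cons partial_deriv_def using vector_derivative_zero by simp
qed

lemma iter_deriv_bounded:
  assumes \<theta>: "\<theta> \<in> test_functions \<Omega>" and \<alpha>: "\<alpha> \<in> multi_indices"
  obtains A where "\<And>p. \<bar>iter_deriv UNIV \<alpha> \<theta> p\<bar> \<le> A"
proof -
  have s: "smooth_on UNIV \<theta>" "compact (supp \<theta>)" using \<theta> by (auto simp: test_functions_def)
  have "compact (iter_deriv UNIV \<alpha> \<theta> ` supp \<theta>)"
    by (intro compact_continuous_image continuous_on_subset[OF smooth_on_cont[OF s(1) \<alpha>]] s(2)) simp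
  then have "bounded (iter_deriv UNIV \<alpha> \<theta> ` supp \<theta>)" by (rule compact_imp_bounded)
  then obtain A where A: "\<forall>p\<in>supp \<theta>. \<bar>iter_deriv UNIV \<alpha> \<theta> p\<bar> \<le> A" unfolding bounded_iff by auto
  have "\<bar>iter_deriv UNIV \<alpha> \<theta> p\<bar> \<le> max A 0" for p
    using A iter_deriv_off_supp[of p \<theta> \<alpha>] by (cases "p \<in> supp \<theta>") (auto intro: max.coboundedI1)
  then show thesis using that by blast
qed

abbreviation x_derivs :: "nat \<Rightarrow> (real \<times> real) list" where
  "x_derivs k \<equiv> replicate k (0, 1)"

lemma x_derivs_index: "x_derivs k \<in> multi_indices" "(1, 0) # x_derivs k \<in> multi_indices"
  by (auto simp: multi_indices_def half_space_basis)

lemma plane_deriv: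
  assumes f: "smooth_on (UNIV::(real\<times>real) set) f" and \<alpha>: "\<alpha> \<in> multi_indices"
  shows "((\<lambda>y. iter_deriv UNIV \<alpha> f (t, y)) has_real_derivative iter_deriv UNIV ((0,1) # \<alpha>) f (t, x)) (at x)"
    and "((\<lambda>s. iter_deriv UNIV \<alpha> f (s, x)) has_real_derivative iter_deriv UNIV ((1,0) # \<alpha>) f (t, x)) (at t)"
proof -
  have "((\<lambda>h. iter_deriv UNIV \<alpha> f (t, x + h)) has_real_derivative iter_deriv UNIV ((0,1) # \<alpha>) f (t, x)) (at 0)"
    using smooth_on_deriv[OF f \<alpha> half_space_basis(2), of "(t, x)"] by (simp add: has_real_derivative_iff_has_vector_derivative)
  then show "((\<lambda>y. iter_deriv UNIV \<alpha> f (t, y)) has_real_derivative iter_deriv UNIV ((0,1) # \<alpha>) f (t, x)) (at x)"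
    using DERIV_shift[of "\<lambda>y. iter_deriv UNIV \<alpha> f (t, y)" _ 0 x] by (simp add: add.commute)
  have "((\<lambda>h. iter_deriv UNIV \<alpha> f (t + h, x)) has_real_derivative iter_deriv UNIV ((1,0) # \<alpha>) f (t, x)) (at 0)"
    using smooth_on_deriv[OF f \<alpha> half_space_basis(1), of "(t, x)"] by (simp add: has_real_derivative_iff_has_vector_derivative)
  then show "((\<lambda>s. iter_deriv UNIV \<alpha> f (s, x)) has_real_derivative iter_deriv UNIV ((1,0) # \<alpha>) f (t, x)) (at t)"
    using DERIV_shift[of "\<lambda>s. iter_deriv UNIV \<alpha> f (s, x)" _ 0 t] by (simp add: add.commute)
qed

lemma slice_test:
  assumes \<theta>: "smooth_on (UNIV::(real\<times>real) set) \<theta>" and z: "\<And>x. \<bar>x\<bar> > R \<Longrightarrow> \<theta> (t, x) = 0"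
  shows "(\<lambda>x. \<theta> (t, x)) \<in> tests R" "dv k (\<lambda>x. \<theta> (t, x)) x = iter_deriv UNIV (x_derivs k) \<theta> (t, x)"
proof -
  have d: "((\<lambda>x. iter_deriv UNIV (x_derivs k) \<theta> (t, x)) has_real_derivative iter_deriv UNIV (x_derivs (Suc k)) \<theta> (t, x)) (at x)" for k x
    using plane_deriv(1)[OF \<theta> x_derivs_index(1)] by simp
  show "(\<lambda>x. \<theta> (t, x)) \<in> tests R"
    by (rule testsI[where D="\<lambda>k x. iter_deriv UNIV (x_derivs k) \<theta> (t, x)"]) (simp add: iter_deriv_Nil, rule d, rule z)
  have "dv k (\<lambda>x. \<theta> (t, x)) = (\<lambda>x. iter_deriv UNIV (x_derivs k) \<theta> (t, x))"
    by (rule dv_eqI[where D="\<lambda>k x. iter_deriv UNIV (x_derivs k) \<theta> (t, x)"]) (simp add: iter_deriv_Nil, rule d)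
  then show "dv k (\<lambda>x. \<theta> (t, x)) x = iter_deriv UNIV (x_derivs k) \<theta> (t, x)" by simp
qed

abbreviation (input) upper :: "(real \<times> real) set" where
  "upper \<equiv> {0<..} \<times> UNIV"

lemma compact_box:
  assumes "compact (K :: (real \<times> real) set)"
  obtains T R where "0 \<le> T" "0 \<le> R" "\<And>t x. (t, x) \<in> K \<Longrightarrow> t \<le> T \<and> \<bar>x\<bar> \<le> R"
proof -
  obtain b where b: "\<And>p. p \<in> K \<Longrightarrow> norm p \<le> b" using compact_imp_bounded[OF assms] by (auto simp: bounded_iff)
  have "t \<le> max b 0 \<and> \<bar>x\<bar> \<le> max b 0" if "(t, x) \<in> K" for t x
    using b[OF that] norm_fst_le[of t x] norm_snd_le[of x t] by auto
  then show thesis using that[of "max b 0" "max b 0"] by auto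
qed

lemma off_supp_zero: "p \<notin> supp \<theta> \<Longrightarrow> \<theta> p = 0"
  using iter_deriv_off_supp[of p \<theta> "[]"] by (simp add: iter_deriv_Nil)

text \<open>The slices of a planar test function form a moving test function on the line. Its
  spatial derivatives are Lipschitz in time because the mixed derivatives are bounded.\<close>

lemma curve_cont:
  fixes \<theta> :: "real \<times> real \<Rightarrow> real" and L :: "real \<Rightarrow> real functional"
  assumes \<theta>: "\<theta> \<in> test_functions \<Omega>" and z: "\<And>t x. \<bar>x\<bar> > R \<Longrightarrow> \<theta> (t, x) = 0"
    and test_linear: "\<And>t. t \<in> S \<Longrightarrow> test_linear (L t)" and order_bound: "\<And>t. t \<in> S \<Longrightarrow> order_bound R M N (L t)"
    and cont: "\<And>\<eta>. \<eta> \<in> tests R \<Longrightarrow> continuous_on S (\<lambda>t. L t \<eta>)"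
  shows "continuous_on S (\<lambda>t. L t (\<lambda>x. \<theta> (t, x)))"
  unfolding continuous_on_eq_continuous_within
proof
  fix s0 assume s0: "s0 \<in> S"
  have sm: "smooth_on UNIV \<theta>" using \<theta> by (simp add: test_functions_def)
  note sl = slice_test[OF sm z]
  have "\<exists>A. \<forall>k\<le>N. \<forall>p. \<bar>iter_deriv UNIV ((1,0) # x_derivs k) \<theta> p\<bar> \<le> A"
    by (rule common_nat_bound) (meson iter_deriv_bounded[OF \<theta> x_derivs_index(2)])
  then obtain A where A: "\<And>k p. k \<le> N \<Longrightarrow> \<bar>iter_deriv UNIV ((1,0) # x_derivs k) \<theta> p\<bar> \<le> A" by blast
  show "continuous (at s0 within S) (\<lambda>t. L t (\<lambda>x. \<theta> (t, x)))"
  proof (rule continuous_moving_test[where L=L and g="\<lambda>t x. \<theta> (t, x)" and R=R and M=M and N=N and C=A])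
    show "continuous (at s0 within S) (\<lambda>t. L t (\<lambda>x. \<theta> (s0, x)))"
      using cont[OF sl(1)] s0 by (simp add: continuous_on_eq_continuous_within)
    fix k s x assume "s \<in> S" "k \<le> N"
    then show "\<bar>dv k (\<lambda>x. \<theta> (s, x)) x - dv k (\<lambda>x. \<theta> (s0, x)) x\<bar> \<le> A * \<bar>s - s0\<bar>"
      using taylor_bounds(1)[of "\<lambda>t. iter_deriv UNIV (x_derivs k) \<theta> (t, x)" "\<lambda>t. iter_deriv UNIV ((1,0) # x_derivs k) \<theta> (t, x)" A s0 "s - s0",
         OF plane_deriv(2)[OF sm x_derivs_index(1)] A] sl(2) by simp
  qed (use s0 test_linear order_bound sl(1) in auto)
qed

section \<open>Curves of distributions\<close>

lemma Ck_distr_1_facts: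
  assumes "Ck_distr 1 {0..} u"
  defines "u' \<equiv> time_deriv {0..} u"
  shows "t \<ge> 0 \<Longrightarrow> u t \<in> distributions UNIV" "t \<ge> 0 \<Longrightarrow> u' t \<in> distributions UNIV"
    "\<eta> \<in> tests R \<Longrightarrow> t \<ge> 0 \<Longrightarrow> ((\<lambda>s. u s \<eta>) has_real_derivative u' t \<eta>) (at t within {0..})"
    "\<eta> \<in> tests R \<Longrightarrow> continuous_on {0..} (\<lambda>t. u' t \<eta>)"
    "\<eta> \<in> tests R \<Longrightarrow> continuous_on {0..} (\<lambda>t. u t \<eta>)"
proof -
  note C = assms(1)[unfolded One_nat_def Ck_distr.simps]
  show "t \<ge> 0 \<Longrightarrow> u t \<in> distributions UNIV" for t using C by simp
  show "t \<ge> 0 \<Longrightarrow> u' t \<in> distributions UNIV" for t using C by (simp add: u'_def)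
  show d: "((\<lambda>s. u s \<eta>) has_real_derivative u' t \<eta>) (at t within {0..})" if "\<eta> \<in> tests R" "t \<ge> 0" for \<eta> t R
    using C that tests_imp_test_function(1)[OF that(1)]
    by (simp add: u'_def time_deriv_def has_real_derivative_iff_has_vector_derivative vector_derivative_works[symmetric])
  show "continuous_on {0..} (\<lambda>t. u' t \<eta>)" if "\<eta> \<in> tests R" for \<eta> R
    using C tests_imp_test_function(1)[OF that] by (simp add: u'_def)
  show "continuous_on {0..} (\<lambda>t. u t \<eta>)" if "\<eta> \<in> tests R" for \<eta> R
    using DERIV_continuous[OF d[OF that]] by (simp add: continuous_on_eq_continuous_within)
qed

text \<open>Every \<open>w t\<close> has some order on the ball, and weak continuity bounds
  \<open>w t \<eta>\<close> on the compact time interval for each \<open>\<eta>\<close>; the uniform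
  boundedness principle then makes order and constant independent of \<open>t\<close>.\<close>

lemma distr_curve_ctrl:
  fixes w :: "real \<Rightarrow> real functional"
  assumes d: "\<And>t. t \<ge> 0 \<Longrightarrow> w t \<in> distributions UNIV"
    and c: "\<And>\<eta>. \<eta> \<in> tests R \<Longrightarrow> continuous_on {0..} (\<lambda>t. w t \<eta>)"
  shows "\<exists>M\<ge>0. \<exists>N. \<forall>t\<in>{0..T}. order_bound R M N (w t)"
proof (rule uniform_boundedness)
  fix t assume "t \<in> {0..T}"
  then have "w t \<in> distributions UNIV" using d by simp
  then show "test_linear (w t)" "\<exists>M N. order_bound R M N (w t)" using distributions_lin distributions_ctrl by blast+
next
  fix \<eta> assume "\<eta> \<in> tests R"
  then have "continuous_on {0..T} (\<lambda>t. w t \<eta>)" by (rule continuous_on_subset[OF c]) auto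
  then have "compact ((\<lambda>t. w t \<eta>) ` {0..T})" by (intro compact_continuous_image compact_Icc)
  then have "bounded ((\<lambda>t. w t \<eta>) ` {0..T})" by (rule compact_imp_bounded)
  then show "\<exists>B. \<forall>t\<in>{0..T}. \<bar>w t \<eta>\<bar> \<le> B" unfolding bounded_iff by auto
qed

lemma curve_distr_eq:
  assumes u: "\<And>t. t \<ge> 0 \<Longrightarrow> u t \<in> distributions UNIV"
    "\<And>R \<eta>. \<eta> \<in> tests R \<Longrightarrow> continuous_on {0..} (\<lambda>t. u t \<eta>)"
    and \<theta>: "\<theta> \<in> test_functions upper" and box: "\<And>t x. T < t \<or> R < \<bar>x\<bar> \<Longrightarrow> \<theta> (t, x) = 0"
  shows "continuous_on {0..T} (\<lambda>t. u t (\<lambda>x. \<theta> (t, x)))"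
    "set_integrable lborel {0<..} (\<lambda>t. u t (\<lambda>x. \<theta> (t, x)))"
    "curve_distr u \<theta> = integral {0..T} (\<lambda>t. u t (\<lambda>x. \<theta> (t, x)))"
proof -
  have "\<exists>M\<ge>0. \<exists>N. \<forall>t\<in>{0..T}. order_bound R M N (u t)" by (rule distr_curve_ctrl[OF u])
  then obtain M N where MN: "\<forall>t\<in>{0..T}. order_bound R M N (u t)" by blast
  show c: "continuous_on {0..T} (\<lambda>t. u t (\<lambda>x. \<theta> (t, x)))"
  proof (rule curve_cont[OF \<theta>, of R _ u M N])
    show "continuous_on {0..T} (\<lambda>t. u t \<eta>)" if "\<eta> \<in> tests R" for \<eta>
      by (rule continuous_on_subset[OF u(2)[OF that]]) auto
  qed (use box MN distributions_lin u in auto)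
  have z: "u t (\<lambda>x. \<theta> (t, x)) = 0" if "t \<ge> 0" "\<And>x. \<theta> (t, x) = 0" for t
  proof -
    have "(\<lambda>x. \<theta> (t, x)) \<in> tests R"
      by (rule slice_test(1)) (use \<theta> box in \<open>auto simp: test_functions_def\<close>)
    from test_linear_scale[OF distributions_lin[OF u(1)[OF that(1)]] this, of 0] show ?thesis using that(2) by simp
  qed
  have z0: "\<theta> (t, x) = 0" if "t \<le> 0" for t x
    by (rule off_supp_zero) (use that \<theta> in \<open>auto simp: test_functions_def\<close>)
  \<comment> \<open>The two indicators differ only at \<open>t = 0\<close> and for
    \<open>t > T\<close>. There the slice is the zero function, at \<open>t = 0\<close> because the
    support lies in the open half-plane.\<close>
  have same: "indicator {0<..} t *\<^sub>R u t (\<lambda>x. \<theta> (t, x)) = indicator {0..T} t *\<^sub>R u t (\<lambda>x. \<theta> (t, x))" for t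
  proof -
    consider "t < 0" | "t = 0" | "0 < t" "t \<le> T" | "0 < t" "T < t" by linarith
    then show ?thesis by cases (use z[of t] z0 box in auto)
  qed
  have i: "set_integrable lborel {0..T} (\<lambda>t. u t (\<lambda>x. \<theta> (t, x)))"
    by (rule borel_integrable_atLeastAtMost'[OF c])
  then show "set_integrable lborel {0<..} (\<lambda>t. u t (\<lambda>x. \<theta> (t, x)))"
    unfolding set_integrable_def same .
  show "curve_distr u \<theta> = integral {0..T} (\<lambda>t. u t (\<lambda>x. \<theta> (t, x)))"
    unfolding curve_distr_def set_lebesgue_integral_def same
    using set_borel_integral_eq_integral(2)[OF i] by (simp add: set_lebesgue_integral_def)
qed

text \<open>The seminorm estimate integrates the uniform order bound of the curve over
  \<open>[0, T]\<close>, whence the constant \<open>M * T\<close>. It involves spatial derivatives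
  only, and each of their suprema is one term of the sum over all multi-indices up to
  \<open>N\<close>.\<close>

lemma curve_distr_in_distributions:
  assumes u: "\<And>t. t \<ge> 0 \<Longrightarrow> u t \<in> distributions UNIV"
    "\<And>R \<eta>. \<eta> \<in> tests R \<Longrightarrow> continuous_on {0..} (\<lambda>t. u t \<eta>)"
  shows "curve_distr u \<in> distributions upper"
proof -
  have box: "\<exists>T R. 0 \<le> T \<and> 0 \<le> R \<and> (\<forall>t x. T < t \<or> R < \<bar>x\<bar> \<longrightarrow> \<theta> (t, x) = 0)" if cs: "compact (supp \<theta>)" for \<theta> :: "real \<times> real \<Rightarrow> real"
  proof -
    obtain T R where "0 \<le> T" "0 \<le> R" "\<And>t x. (t, x) \<in> supp \<theta> \<Longrightarrow> t \<le> T \<and> \<bar>x\<bar> \<le> R" using compact_box[OF cs] by blast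
    then show ?thesis by (intro exI[of _ T] exI[of _ R]) (metis linorder_not_le off_supp_zero)
  qed
  have sm: "smooth_on UNIV \<theta>" "compact (supp \<theta>)" if "\<theta> \<in> test_functions upper" for \<theta> using that by (auto simp: test_functions_def)
  show ?thesis
    unfolding distributions_def
  proof (intro CollectI conjI ballI allI impI)
    fix \<theta> \<eta> assume t: "\<theta> \<in> test_functions upper" "\<eta> \<in> test_functions upper"
    obtain T1 R1 where 1: "\<forall>t x. T1 < t \<or> R1 < \<bar>x\<bar> \<longrightarrow> \<theta> (t, x) = 0" using box[OF sm(2)[OF t(1)]] by blast
    obtain T2 R2 where 2: "\<forall>t x. T2 < t \<or> R2 < \<bar>x\<bar> \<longrightarrow> \<eta> (t, x) = 0" using box[OF sm(2)[OF t(2)]] by blast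
    define T R where "T = max T1 T2" and "R = max R1 R2"
    have b: "T < t \<or> R < \<bar>x\<bar> \<Longrightarrow> \<theta> (t, x) = 0" "T < t \<or> R < \<bar>x\<bar> \<Longrightarrow> \<eta> (t, x) = 0" for t x
      using 1 2 by (auto simp: T_def R_def)
    have add: "u t (\<lambda>x. \<theta> (t, x) + \<eta> (t, x)) = u t (\<lambda>x. \<theta> (t, x)) + u t (\<lambda>x. \<eta> (t, x))" if "t \<ge> 0" for t
      by (rule test_linear_add[OF distributions_lin[OF u(1)[OF that]]]) (intro slice_test sm t b disjI2; assumption)+
    have "curve_distr u (\<lambda>p. \<theta> p + \<eta> p) = (LINT t:{0<..}|lborel. u t (\<lambda>x. \<theta> (t, x)) + u t (\<lambda>x. \<eta> (t, x)))"
      unfolding curve_distr_def by (rule set_lebesgue_integral_cong) (use add in auto)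
    also have "\<dots> = curve_distr u \<theta> + curve_distr u \<eta>"
      unfolding curve_distr_def
      by (rule set_integral_add(2)) (rule curve_distr_eq(2)[OF u t(1) b(1)] curve_distr_eq(2)[OF u t(2) b(2)]; assumption)+
    finally show "curve_distr u (\<lambda>p. \<theta> p + \<eta> p) = curve_distr u \<theta> + curve_distr u \<eta>" .
  next
    fix \<theta> r assume t: "\<theta> \<in> test_functions upper"
    obtain T R where b: "\<forall>t x. T < t \<or> R < \<bar>x\<bar> \<longrightarrow> \<theta> (t, x) = 0" using box[OF sm(2)[OF t]] by blast
    have sc: "u t (\<lambda>x. r * \<theta> (t, x)) = r * u t (\<lambda>x. \<theta> (t, x))" if "t \<ge> 0" for t
      by (rule test_linear_scale[OF distributions_lin[OF u(1)[OF that]], of _ R], rule slice_test(1)[OF sm(1)[OF t]]) (use b in blast)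
    have "curve_distr u (\<lambda>p. r * \<theta> p) = (LINT t:{0<..}|lborel. r * u t (\<lambda>x. \<theta> (t, x)))"
      unfolding curve_distr_def by (rule set_lebesgue_integral_cong) (use sc in auto)
    also have "\<dots> = r * curve_distr u \<theta>" unfolding curve_distr_def by (rule set_integral_mult_right)
    finally show "curve_distr u (\<lambda>p. r * \<theta> p) = r * curve_distr u \<theta>" .
  next
    fix K :: "(real \<times> real) set" assume K: "compact K \<and> K \<subseteq> upper"
    then obtain T R where TR: "0 \<le> T" "0 \<le> R" "\<And>t x. (t, x) \<in> K \<Longrightarrow> t \<le> T \<and> \<bar>x\<bar> \<le> R" using compact_box by blast
    have "\<exists>M\<ge>0. \<exists>N. \<forall>t\<in>{0..T}. order_bound R M N (u t)" by (rule distr_curve_ctrl[OF u])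
    then obtain M N where MN: "0 \<le> M" "\<forall>t\<in>{0..T}. order_bound R M N (u t)" by blast
    have fin: "finite {\<alpha> \<in> (multi_indices :: (real\<times>real) list set). length \<alpha> \<le> N}"
      using finite_lists_length_le[of "Basis :: (real \<times> real) set" N] by (simp add: multi_indices_def)
    show "\<exists>M N. \<forall>\<theta>\<in>test_functions upper. supp \<theta> \<subseteq> K \<longrightarrow> \<bar>curve_distr u \<theta>\<bar>
         \<le> M * (\<Sum>\<alpha>\<in>{\<alpha>\<in>multi_indices. length \<alpha> \<le> N}. SUP x. \<bar>iter_deriv UNIV \<alpha> \<theta> x\<bar>)"
    proof (intro exI ballI impI)
      fix \<theta> assume t: "\<theta> \<in> test_functions upper" and "supp \<theta> \<subseteq> K"
      then have b: "T < t \<or> R < \<bar>x\<bar> \<Longrightarrow> \<theta> (t, x) = 0" for t x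
        using TR(3)[of t x] off_supp_zero[of "(t, x)" \<theta>] by (cases "(t, x) \<in> K") auto
      define S where "S = (\<Sum>\<alpha>\<in>{\<alpha>\<in>multi_indices. length \<alpha> \<le> N}. SUP x. \<bar>iter_deriv UNIV \<alpha> \<theta> x\<bar>)"
      have bdd: "bdd_above (range (\<lambda>x. \<bar>iter_deriv UNIV \<alpha> \<theta> x\<bar>))" if "\<alpha> \<in> multi_indices" for \<alpha>
        using iter_deriv_bounded[OF t that] by (metis bdd_above.I2)
      have S: "\<bar>iter_deriv UNIV (x_derivs k) \<theta> p\<bar> \<le> S" if "k \<le> N" for k p
      proof -
        have "\<bar>iter_deriv UNIV (x_derivs k) \<theta> p\<bar> \<le> (SUP x. \<bar>iter_deriv UNIV (x_derivs k) \<theta> x\<bar>)"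
          by (rule cSUP_upper[OF _ bdd[OF x_derivs_index(1)]]) simp
        also have "\<dots> \<le> S" unfolding S_def
        proof (rule member_le_sum[OF _ _ fin])
          show "x_derivs k \<in> {\<alpha> \<in> multi_indices. length \<alpha> \<le> N}" using that x_derivs_index(1) by simp
          fix \<alpha> assume "\<alpha> \<in> {\<alpha> \<in> (multi_indices :: (real\<times>real) list set). length \<alpha> \<le> N} - {x_derivs k}"
          then have "\<alpha> \<in> multi_indices" by simp
          then show "0 \<le> (SUP x. \<bar>iter_deriv UNIV \<alpha> \<theta> x\<bar>)"
            by (intro cSUP_upper2[OF bdd, of _ 0]) auto
        qed
        finally show ?thesis .
      qed
      have "norm (integral (cbox 0 T) (\<lambda>t. u t (\<lambda>x. \<theta> (t, x)))) \<le> (M * S) * measure lborel (cbox 0 T)"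
      proof (rule integrable_bound)
        show "0 \<le> M * S" using MN(1) S[of 0 0] by (intro mult_nonneg_nonneg) auto
        show "(\<lambda>t. u t (\<lambda>x. \<theta> (t, x))) integrable_on cbox 0 T"
          using curve_distr_eq(1)[OF u t b] by (intro integrable_continuous) simp
        fix s assume "s \<in> cbox 0 T"
        then have s: "s \<in> {0..T}" by simp
        note sl = slice_test[OF sm(1)[OF t], of R s, OF b[OF disjI2]]
        show "norm (u s (\<lambda>x. \<theta> (s, x))) \<le> M * S"
          unfolding real_norm_def
          by (rule order_boundD[OF MN(2)[rule_format, OF s] sl(1)]) (use sl(2) S in simp_all)
      qed
      moreover have "curve_distr u \<theta> = integral {0..T} (\<lambda>t. u t (\<lambda>x. \<theta> (t, x)))"
        by (rule curve_distr_eq(3)[OF u t b])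
      ultimately show "\<bar>curve_distr u \<theta>\<bar> \<le> (M * T) * (\<Sum>\<alpha>\<in>{\<alpha>\<in>multi_indices. length \<alpha> \<le> N}. SUP x. \<bar>iter_deriv UNIV \<alpha> \<theta> x\<bar>)"
        unfolding S_def[symmetric] using TR(1) by (simp add: mult_ac)
    qed
  qed
qed

section \<open>The regularised speed\<close>

text \<open>Covers non-integrable \<open>f\<close> as well, whose integral is \<open>0\<close> by
  convention. This allows convolutions of the speed to be bounded by pointwise estimates
  alone.\<close>

lemma norm_lebesgue_integral_le:
  fixes f g :: "real \<Rightarrow> real"
  assumes "integrable lborel g" "\<And>x. \<bar>f x\<bar> \<le> g x"
  shows "\<bar>LINT x|lborel. f x\<bar> \<le> (LINT x|lborel. g x)"
proof (cases "integrable lborel f")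
  case True
  then show ?thesis
    using integral_abs_bound[of lborel f] Bochner_Integration.integral_mono[OF integrable_abs[OF True] assms]
    by linarith
next
  case False
  have "0 \<le> (LINT x|lborel. g x)"
    by (rule Bochner_Integration.integral_nonneg) (use assms(2) order_trans[OF abs_ge_zero] in blast)
  then show ?thesis using False by (simp add: not_integrable_integral_eq)
qed

text \<open>The kernel is at most \<open>P / \<epsilon>\<close> on an interval of length
  \<open>2 * \<epsilon>\<close>, so the bound does not depend on \<open>\<epsilon>\<close>.\<close>

lemma conv_bounded:
  assumes \<phi>: "\<And>x. \<bar>\<phi> x\<bar> \<le> P" "\<And>x. \<bar>x\<bar> > 1 \<Longrightarrow> \<phi> x = 0" and f: "\<And>s. \<bar>f s\<bar> \<le> F" and \<epsilon>: "0 < \<epsilon>"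
  shows "\<bar>conv f (scaled \<phi> \<epsilon>) t\<bar> \<le> 2 * F * P"
proof -
  have F: "0 \<le> F" "0 \<le> P" using f[of 0] \<phi>(1)[of 0] by linarith+
  let ?g = "\<lambda>s. indicator {t - \<epsilon>..t + \<epsilon>} s * (F * P / \<epsilon>)"
  have "\<bar>conv f (scaled \<phi> \<epsilon>) t\<bar> \<le> (LINT s|lborel. ?g s)"
    unfolding conv_def
  proof (rule norm_lebesgue_integral_le)
    show "integrable lborel ?g"
      by (rule Bochner_Integration.integrable_mult_left) (use \<epsilon> in \<open>simp add: integrable_indicator_iff\<close>)
    fix s
    show "\<bar>f s * scaled \<phi> \<epsilon> (t - s)\<bar> \<le> ?g s"
    proof (cases "s \<in> {t - \<epsilon>..t + \<epsilon>}")
      case True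
      have "\<bar>f s\<bar> * \<bar>\<phi> ((t - s) / \<epsilon>)\<bar> \<le> F * P" using f \<phi> F by (intro mult_mono) auto
      then show ?thesis using True \<epsilon> by (simp add: scaled_def abs_mult divide_right_mono)
    next
      case False
      then have "\<bar>(t - s) / \<epsilon>\<bar> > 1" using \<epsilon> by (auto simp: less_divide_eq)
      then show ?thesis using \<phi>(2) False by (simp add: scaled_def)
    qed
  qed
  also have "\<dots> = 2 * F * P" using \<epsilon> by simp
  finally show ?thesis .
qed

text \<open>The scaled kernel sees only times within distance \<open>\<epsilon>\<close> of
  \<open>t\<close>, where \<open>f\<close> may be replaced by the constant \<open>b\<close>; the
  total mass of the kernel is \<open>1\<close>.\<close>

lemma conv_locally_constant:
  assumes \<phi>: "(LINT x|lborel. \<phi> x) = 1" "\<And>x. \<bar>x\<bar> > 1 \<Longrightarrow> \<phi> x = 0" and \<epsilon>: "0 < \<epsilon>"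
    and f: "\<And>s. \<bar>t - s\<bar> \<le> \<epsilon> \<Longrightarrow> f s = b"
  shows "conv f (scaled \<phi> \<epsilon>) t = b"
proof -
  have "f s * scaled \<phi> \<epsilon> (t - s) = b * scaled \<phi> \<epsilon> (t - s)" for s
  proof (cases "\<bar>t - s\<bar> \<le> \<epsilon>")
    case False
    then have "\<bar>(t - s) / \<epsilon>\<bar> > 1" using \<epsilon> by (simp add: less_divide_eq)
    then show ?thesis using \<phi>(2) by (simp add: scaled_def)
  qed (simp add: f)
  then have "conv f (scaled \<phi> \<epsilon>) t = (LINT s|lborel. b * scaled \<phi> \<epsilon> (t - s))"
    unfolding conv_def by (simp only:)
  also have "\<dots> = \<bar>- \<epsilon>\<bar> *\<^sub>R (LINT z|lborel. b * scaled \<phi> \<epsilon> (t - (t + (- \<epsilon>) * z)))"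
    using \<epsilon> by (intro lborel_integral_real_affine) auto
  also have "\<dots> = b" using \<epsilon> \<phi>(1) by (simp add: scaled_def)
  finally show ?thesis .
qed

section \<open>The pieces of constant speed\<close>

lemma piece_exists:
  assumes "\<tau> 0 = (0::real)" "s \<ge> 0"
  shows "\<exists>j\<le>m. s = \<tau> j \<or> s \<in> piece m \<tau> j"
proof -
  define J where "J = {j. j \<le> m \<and> \<tau> j \<le> s}"
  have J: "finite J" "0 \<in> J" using assms by (auto simp: J_def)
  then have M: "Max J \<in> J" by (intro Max_in) auto
  have "s < \<tau> (Suc (Max J))" if "Max J < m"
  proof (rule ccontr)
    assume "\<not> s < \<tau> (Suc (Max J))"
    then have "Suc (Max J) \<in> J" using that by (simp add: J_def)
    then show False using Max_ge[OF J(1)] by fastforce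
  qed
  then have "s = \<tau> (Max J) \<or> s \<in> piece m \<tau> (Max J)" using M by (auto simp: J_def piece_def)
  then show ?thesis using M by (auto simp: J_def)
qed

lemma speed_bounded:
  assumes "piecewise_constant_speed m \<tau> a c"
  obtains F where "\<And>s. \<bar>(if s < 0 then a 0 else c s)\<bar> \<le> F"
proof -
  \<comment> \<open>The constant extension to negative times, the values on the pieces, and the
    values at \<open>0\<close> and at the jumps, which are not tied to the
    \<open>a j\<close>.\<close>
  define F where "F = \<bar>a 0\<bar> + (\<Sum>j\<le>m. \<bar>a j\<bar>) + (\<Sum>j\<le>m. \<bar>c (\<tau> j)\<bar>)"
  have nn: "0 \<le> (\<Sum>j\<le>m. \<bar>a j\<bar>)" "0 \<le> (\<Sum>j\<le>m. \<bar>c (\<tau> j)\<bar>)" by (auto intro: sum_nonneg)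
  have "\<bar>(if s < 0 then a 0 else c s)\<bar> \<le> F" for s
  proof (cases "s < 0")
    case False
    then obtain j where j: "j \<le> m" "s = \<tau> j \<or> s \<in> piece m \<tau> j"
      using piece_exists[of \<tau> s m] assms by (auto simp: piecewise_constant_speed_def)
    have "\<bar>a j\<bar> \<le> (\<Sum>j\<le>m. \<bar>a j\<bar>)" "\<bar>c (\<tau> j)\<bar> \<le> (\<Sum>j\<le>m. \<bar>c (\<tau> j)\<bar>)"
      using j(1) by (auto intro!: member_le_sum)
    moreover have "c s = c (\<tau> j) \<or> c s = a j"
      using j assms by (auto simp: piecewise_constant_speed_def)
    ultimately show ?thesis using False nn unfolding F_def by auto
  qed (use nn in \<open>simp add: F_def\<close>)
  then show thesis by (rule that)
qed

lemma piece_open: "open (piece m \<tau> j)"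
proof -
  have "piece m \<tau> j = (if j < m then {\<tau> j<..<\<tau> (Suc j)} else {\<tau> j<..})" by (auto simp: piece_def)
  then show ?thesis by simp
qed

text \<open>The equation is stated with time derivatives relative to a piece, the estimates use the
  derivative relative to \<open>{0..}\<close>. On an open piece both are the ordinary derivative,
  and the signs of the two distributional derivatives in \<open>x\<close> cancel.\<close>

lemma piece_second_derivative:
  assumes u: "piecewise_distributional_solution m \<tau> c u0 u1 u" and j: "j \<le> m" and t: "t \<in> piece m \<tau> j" "0 \<le> \<tau> j"
    and \<eta>: "\<eta> \<in> tests R"
  shows "((\<lambda>s. time_deriv {0..} u s \<eta>) has_real_derivative (c t)\<^sup>2 * u t (dv 2 \<eta>)) (at t)"
proof -
  let ?I = "piece m \<tau> j"
  have C2: "Ck_distr 2 ?I u" and eq: "distr_eq UNIV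
             (\<lambda>\<theta>. time_deriv ?I (time_deriv ?I u) t \<theta> - (c t)\<^sup>2 * distr_deriv 1 (distr_deriv 1 (u t)) \<theta>) (\<lambda>\<theta>. 0)"
    using u j t by (auto simp: piecewise_distributional_solution_def)
  have test: "\<eta> \<in> test_functions UNIV" by (rule tests_imp_test_function(1)[OF \<eta>])
  have at: "at s within ?I = at s" "at s within {0..} = at s" if "s \<in> ?I" for s
    using at_within_open[OF that piece_open] that t(2) 
    by (auto simp: piece_def intro!: at_within_interior)
  have same: "time_deriv ?I u s \<eta> = time_deriv {0..} u s \<eta>" if "s \<in> ?I" for s
    using at[OF that] by (simp add: time_deriv_def)
  have "(\<lambda>s. time_deriv ?I u s \<eta>) differentiable (at t within ?I)"
    using C2 test t(1) by (simp add: numeral_2_eq_2)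
  then have "((\<lambda>s. time_deriv ?I u s \<eta>) has_vector_derivative time_deriv ?I (time_deriv ?I u) t \<eta>) (at t within ?I)"
    unfolding time_deriv_def[of ?I "time_deriv ?I u"] by (simp add: vector_derivative_works[symmetric])
  moreover have "time_deriv ?I (time_deriv ?I u) t \<eta> = (c t)\<^sup>2 * u t (dv 2 \<eta>)"
    using eq test by (simp add: distr_eq_def distr_deriv_def partial_deriv_real numeral_2_eq_2)
  ultimately have "((\<lambda>s. time_deriv ?I u s \<eta>) has_real_derivative (c t)\<^sup>2 * u t (dv 2 \<eta>)) (at t)"
    using at(1)[OF t(1)] by (simp add: has_real_derivative_iff_has_vector_derivative)
  then show ?thesis
    by (rule has_field_derivative_transform_within_open[OF _ piece_open t(1) same])
qed

text \<open>Fubini on a compact box. The box includes \<open>t = 0\<close>, where \<open>f\<close>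
  is still continuous and the test function vanishes, so nothing is added to the integral over the
  open half-plane.\<close>

lemma set_integral_slices:
  fixes f \<theta> :: "real \<times> real \<Rightarrow> real"
  assumes f: "continuous_on half_space f" and \<theta>: "\<theta> \<in> test_functions upper"
    and z: "\<And>t x. T < t \<or> B < \<bar>x\<bar> \<Longrightarrow> \<theta> (t, x) = 0"
  shows "(LINT p:upper|lborel. f p * \<theta> p) = integral {0..T} (\<lambda>t. pairing B f t (\<lambda>x. \<theta> (t, x)))"
    "(\<lambda>t. pairing B f t (\<lambda>x. \<theta> (t, x))) integrable_on {0..T}"
proof -
  let ?K = "cbox (0, -B) (T, B)"
  have K: "?K = {0..T} \<times> {-B..B}" by (simp add: cbox_Pair_eq)
  have sm: "smooth_on UNIV \<theta>" using \<theta> by (simp add: test_functions_def)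
  have c: "continuous_on ?K (\<lambda>p. f p * \<theta> p)"
    using smooth_on_cont[OF sm multi_indices_Nil]
    by (intro continuous_on_mult continuous_on_subset[OF f]) (auto simp: K iter_deriv_Nil intro: continuous_on_subset)
  have z0: "\<theta> (t, x) = 0" if "t \<le> 0" for t x
    by (rule off_supp_zero) (use that \<theta> in \<open>auto simp: test_functions_def\<close>)
  have "(LINT p:upper|lborel. f p * \<theta> p) = (LINT p:?K|lborel. f p * \<theta> p)"
    unfolding set_lebesgue_integral_def
  proof (rule Bochner_Integration.integral_cong)
    fix p :: "real \<times> real"
    obtain t x where p: "p = (t, x)" by fastforce
    show "indicator upper p *\<^sub>R (f p * \<theta> p) = indicator ?K p *\<^sub>R (f p * \<theta> p)"
    proof (cases "\<theta> (t, x) = 0")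
      case False
      then have "0 < t" "t \<le> T" "\<bar>x\<bar> \<le> B" using z[of t x] z0[of t x] by (meson not_le)+
      then show ?thesis unfolding p K by (simp add: indicator_def abs_le_iff)
    qed (simp add: p)
  qed simp
  also have "\<dots> = integral ?K (\<lambda>p. f p * \<theta> p)"
    by (rule set_borel_integral_eq_integral(2))
       (use borel_integrable_compact[OF compact_cbox c] in \<open>simp add: set_integrable_def\<close>)
  also have "\<dots> = integral (cbox 0 T) (\<lambda>t. integral (cbox (-B) B) (\<lambda>x. f (t, x) * \<theta> (t, x)))"
    by (rule integral_prod_continuous[OF c])
  finally show "(LINT p:upper|lborel. f p * \<theta> p) = integral {0..T} (\<lambda>t. pairing B f t (\<lambda>x. \<theta> (t, x)))"
    by (simp add: pairing_def)
  have "continuous_on (cbox 0 T) (\<lambda>t. integral (cbox (-B) B) (\<lambda>x. f (t, x) * \<theta> (t, x)))"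
    by (rule integral_continuous_on_param) (use c in \<open>simp add: K split_beta\<close>)
  then show "(\<lambda>t. pairing B f t (\<lambda>x. \<theta> (t, x))) integrable_on {0..T}"
    unfolding pairing_def by (intro integrable_continuous_real) simp
qed

section \<open>Convergence of the generalized solution\<close>

text \<open>Although the speed depends on time, the identity is needed at one instant only; so a
  constant \<open>b\<close> suffices, to be taken as the value of the regularised speed at
  \<open>s\<close>.\<close>

lemma pairing_second_time_derivative:
  assumes f: "smooth_on half_space f" and s: "s > 0" and \<eta>: "\<eta> \<in> tests R" and B: "R < B" "0 \<le> B"
  shows "((\<lambda>s. pairing B (iter_deriv half_space [(1,0)] f) s \<eta>) has_real_derivative
     b\<^sup>2 * pairing B f s (dv 2 \<eta>) +
     pairing B (\<lambda>p. iter_deriv half_space [(1,0),(1,0)] f p - b\<^sup>2 * iter_deriv half_space [(0,1),(0,1)] f p) s \<eta>) (at s)"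
proof -
  have s0: "s \<ge> 0" using s by simp
  have \<alpha>: "[(1,0),(1,0)] \<in> (multi_indices :: (real\<times>real) list set)" "[(0,1),(0,1)] \<in> (multi_indices :: (real\<times>real) list set)"
    by (auto simp: multi_indices_def half_space_basis)
  note i = pairing_integrable[OF smooth_on_cont[OF f \<alpha>(1)] s0 \<eta>, of B] pairing_integrable[OF smooth_on_cont[OF f \<alpha>(2)] s0 \<eta>, of B]
  have "pairing B (\<lambda>p. iter_deriv half_space [(1,0),(1,0)] f p - b\<^sup>2 * iter_deriv half_space [(0,1),(0,1)] f p) s \<eta>
    = pairing B (iter_deriv half_space [(1,0),(1,0)] f) s \<eta> - b\<^sup>2 * pairing B (iter_deriv half_space [(0,1),(0,1)] f) s \<eta>"
    using integral_diff[OF i(1) integrable_on_mult_right[OF i(2), of "b\<^sup>2"]]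
    by (simp add: pairing_def left_diff_distrib mult.assoc)
  moreover have "at s within {0..} = at s" using s by (intro at_within_interior) auto
  ultimately show ?thesis
    using pairing_deriv[OF f half_space_indices(1) s0 \<eta>, of B] pairing_parts[OF f s0 \<eta> B] by simp
qed

text \<open>Two errors of size \<open>O(\<epsilon>)\<close> add up: the negligible difference
  between the representative and the mollified datum, used with exponent \<open>1\<close>, and the
  mollification error itself.\<close>

lemma initial_data_error:
  assumes w: "w \<in> distributions UNIV" and y: "distr_eq UNIV y w"
    and g: "\<And>\<epsilon>. \<epsilon> \<in> {0<..1} \<Longrightarrow> continuous_on half_space (g \<epsilon>)"
    and ng: "negligible0 UNIV (\<lambda>\<epsilon> x. g \<epsilon> (0, x) - distr_conv w (scaled \<psi> \<epsilon>) x)"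
    and \<psi>: "data_mollifier \<psi>" and B: "R < B" "0 \<le> R"
  shows "\<exists>C. \<forall>\<^sub>F \<epsilon> in at_right 0. \<forall>\<eta>\<in>test_ball R A. \<bar>pairing B (g \<epsilon>) 0 \<eta> - y \<eta>\<bar> \<le> C * \<epsilon>"
proof -
  obtain G0 where G0: "\<psi> \<in> tests G0" and \<psi>1: "(LINT x|lborel. \<psi> x) = 1"
    using \<psi> test_function_imp_tests unfolding data_mollifier_def by blast
  define G where "G = max G0 0"
  have \<psi>t: "\<psi> \<in> tests G" "0 \<le> G" using tests_mono[OF G0] by (auto simp: G_def)
  have wl: "test_linear w" "\<And>R. \<exists>M N. order_bound R M N w" using distributions_lin[OF w] distributions_ctrl[OF w] by blast+
  let ?w = "\<lambda>\<epsilon>. distr_conv w (scaled \<psi> \<epsilon>)"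
  obtain C1 where C1: "\<forall>\<epsilon>\<in>{0<..1}. \<forall>\<eta>\<in>test_ball R A. \<bar>integral {-B..B} (\<lambda>x. ?w \<epsilon> x * \<eta> x) - w \<eta>\<bar> \<le> C1 * \<epsilon>"
    using mollifier_convergence[OF wl \<psi>t(1) \<psi>1 B \<psi>t(2)] by blast
  obtain C2 where "\<forall>\<^sub>F \<epsilon> in at_right 0. \<forall>x\<in>{-B..B}. \<bar>g \<epsilon> (0, x) - ?w \<epsilon> x\<bar> \<le> C2 * \<epsilon> powr 1"
    using ng unfolding negligible0_def by (meson compact_Icc subset_UNIV)
  then have "\<forall>\<^sub>F \<epsilon> in at_right 0. \<forall>\<eta>\<in>test_ball R A. \<bar>pairing B (g \<epsilon>) 0 \<eta> - y \<eta>\<bar> \<le> (2 * B * C2 * A 0 + C1) * \<epsilon>"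
    using eventually_unit
  proof eventually_elim
    case (elim \<epsilon>)
    show ?case
    proof
      fix \<eta> assume \<eta>b: "\<eta> \<in> test_ball R A"
      then have \<eta>: "\<eta> \<in> tests R" and A: "\<And>x. \<bar>\<eta> x\<bar> \<le> A 0" by (auto simp: test_ball_def dest: spec[of _ 0])
      have yw: "y \<eta> = w \<eta>" using y tests_imp_test_function(1)[OF \<eta>] by (simp add: distr_eq_def)
      let ?h = "\<lambda>p. g \<epsilon> (0, snd p) - ?w \<epsilon> (snd p)"
      have c1: "continuous_on {-B..B} (\<lambda>x. g \<epsilon> (0, x))" by (rule slice_cont[OF g[OF elim(2)]]) simp
      have c2: "continuous_on {-B..B} (?w \<epsilon>)" by (rule mollified_cont[OF wl scaled_tests[OF \<psi>t(1) elim(2)]])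
      have "\<bar>pairing B ?h 0 \<eta>\<bar> \<le> 2 * B * (C2 * \<epsilon>) * A 0"
        by (rule pairing_bound[OF _ \<eta>]) (use c1 c2 elim A B in \<open>auto intro!: continuous_intros\<close>)
      moreover have "pairing B ?h 0 \<eta> = integral {-B..B} (\<lambda>x. g \<epsilon> (0, x) * \<eta> x - ?w \<epsilon> x * \<eta> x)"
        by (simp add: pairing_def left_diff_distrib)
      moreover have "\<dots> = pairing B (g \<epsilon>) 0 \<eta> - integral {-B..B} (\<lambda>x. ?w \<epsilon> x * \<eta> x)"
        unfolding pairing_def
        by (intro integral_diff integrable_continuous_real continuous_on_mult c1 c2 tests_cont0[OF \<eta>])
      moreover have "\<bar>integral {-B..B} (\<lambda>x. ?w \<epsilon> x * \<eta> x) - w \<eta>\<bar> \<le> C1 * \<epsilon>"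
        using C1 elim(2) \<eta>b by blast
      ultimately have "\<bar>pairing B (g \<epsilon>) 0 \<eta> - y \<eta>\<bar> \<le> 2 * B * (C2 * \<epsilon>) * A 0 + C1 * \<epsilon>"
        unfolding yw by linarith
      then show "\<bar>pairing B (g \<epsilon>) 0 \<eta> - y \<eta>\<bar> \<le> (2 * B * C2 * A 0 + C1) * \<epsilon>" by (simp add: algebra_simps)
    qed
  qed
  then show ?thesis by blast
qed

lemma slab: "compact ({0..T} \<times> {-B..B})" "{0..T::real} \<times> {-B..B::real} \<subseteq> half_space"
  by (auto intro: compact_Times)

lemma pairing_negligible:
  assumes f: "negligible0 half_space f" and B: "0 \<le> B"
    and c: "\<And>\<epsilon> s. \<epsilon> \<in> {0<..1} \<Longrightarrow> s \<in> {0..T} \<Longrightarrow> continuous_on {-B..B} (\<lambda>x. f \<epsilon> (s, x))"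
  shows "\<exists>C. \<forall>\<^sub>F \<epsilon> in at_right 0. \<forall>s\<in>{0..T}. \<forall>\<eta>\<in>test_ball (\<rho> s) A. \<bar>pairing B (f \<epsilon>) s \<eta>\<bar> \<le> C * \<epsilon>"
proof -
  obtain C where "\<forall>\<^sub>F \<epsilon> in at_right 0. \<forall>p\<in>{0..T} \<times> {-B..B}. \<bar>f \<epsilon> p\<bar> \<le> C * \<epsilon> powr 1"
    using f slab unfolding negligible0_def by meson
  then have "\<forall>\<^sub>F \<epsilon> in at_right 0. \<forall>s\<in>{0..T}. \<forall>\<eta>\<in>test_ball (\<rho> s) A. \<bar>pairing B (f \<epsilon>) s \<eta>\<bar> \<le> (2 * B * C * A 0) * \<epsilon>"
    using eventually_unit
  proof eventually_elim
    case (elim \<epsilon>)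
    show ?case
    proof (intro ballI)
      fix s \<eta> assume s: "s \<in> {0..T}" and \<eta>: "\<eta> \<in> test_ball (\<rho> s) A"
      have "\<bar>pairing B (f \<epsilon>) s \<eta>\<bar> \<le> 2 * B * (C * \<epsilon>) * A 0"
        by (rule pairing_bound[OF c[OF elim(2) s] _ B])
           (use \<eta> elim s in \<open>auto simp: test_ball_def dest: spec[of _ 0]\<close>)
      then show "\<bar>pairing B (f \<epsilon>) s \<eta>\<bar> \<le> (2 * B * C * A 0) * \<epsilon>" by (simp add: mult_ac)
    qed
  qed
  then show ?thesis by blast
qed

text \<open>The exponent comes from the supremum of the family on the slab alone; the test function
  enters only through the bound \<open>A 0\<close> for its values. Hence \<open>k\<close> can be
  chosen before \<open>A\<close>. It is rounded up to a natural number because the rate is improved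
  by induction.\<close>

lemma pairing_moderate:
  assumes f: "moderate0 half_space f" and B: "0 \<le> B"
    and c: "\<And>\<epsilon> s. \<epsilon> \<in> {0<..1} \<Longrightarrow> s \<in> {0..T} \<Longrightarrow> continuous_on {-B..B} (\<lambda>x. f \<epsilon> (s, x))"
  shows "\<exists>k. \<forall>A. \<exists>C. \<forall>\<^sub>F \<epsilon> in at_right 0. \<forall>s\<in>{0..T}. \<forall>\<eta>\<in>test_ball (\<rho> s) A. \<bar>pairing B (f \<epsilon>) s \<eta>\<bar> \<le> C * (1 / \<epsilon>) ^ k"
proof -
  obtain q C where qC: "\<forall>\<^sub>F \<epsilon> in at_right 0. \<forall>p\<in>{0..T} \<times> {-B..B}. \<bar>f \<epsilon> p\<bar> \<le> C * \<epsilon> powr (-q)"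
    using f slab unfolding moderate0_def by meson
  obtain k :: nat where k: "q \<le> k" using real_arch_simple by blast
  have "\<forall>\<^sub>F \<epsilon> in at_right 0. \<forall>s\<in>{0..T}. \<forall>\<eta>\<in>test_ball (\<rho> s) A.
      \<bar>pairing B (f \<epsilon>) s \<eta>\<bar> \<le> (2 * B * \<bar>C\<bar> * A 0) * (1 / \<epsilon>) ^ k" for A
    using qC eventually_unit
  proof eventually_elim
    case (elim \<epsilon>)
    have "\<epsilon> powr (-q) \<le> \<epsilon> powr (- real k)" by (rule powr_unit_mono[OF elim(2)]) (use k in simp)
    also have "\<dots> = (1 / \<epsilon>) ^ k" using elim(2) by (simp add: powr_minus powr_realpow power_inverse divide_inverse)
    finally have le: "C * \<epsilon> powr (-q) \<le> \<bar>C\<bar> * (1 / \<epsilon>) ^ k" by (intro mult_mono) auto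
    show ?case
    proof (intro ballI)
      fix s \<eta> assume s: "s \<in> {0..T}" and \<eta>: "\<eta> \<in> test_ball (\<rho> s) A"
      have "\<bar>f \<epsilon> (s, x)\<bar> \<le> \<bar>C\<bar> * (1 / \<epsilon>) ^ k" if "x \<in> {-B..B}" for x
        using elim(1) s that le by (meson SigmaI order_trans)
      then have "\<bar>pairing B (f \<epsilon>) s \<eta>\<bar> \<le> 2 * B * (\<bar>C\<bar> * (1 / \<epsilon>) ^ k) * A 0"
        by (intro pairing_bound[OF c[OF elim(2) s] _ B])
           (use \<eta> in \<open>auto simp: test_ball_def dest: spec[of _ 0]\<close>)
      then show "\<bar>pairing B (f \<epsilon>) s \<eta>\<bar> \<le> (2 * B * \<bar>C\<bar> * A 0) * (1 / \<epsilon>) ^ k" by (simp add: mult_ac)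
    qed
  qed
  then show ?thesis by blast
qed

theorem theorem6p1:
  fixes m :: nat and \<tau> a :: "nat \<Rightarrow> real" and c \<phi> \<psi> :: "real \<Rightarrow> real"
    and u0 u1 :: "real functional"
    and U :: "(real \<times> real) gen_fun"
    and u :: "real \<Rightarrow> real functional"
  assumes "speed_mollifier \<phi>" and "data_mollifier \<psi>"
    and "piecewise_constant_speed m \<tau> a c"
    and "u0 \<in> distributions UNIV" and "u1 \<in> distributions UNIV"
    and "generalized_solution (gen_speed \<phi> (a 0) c) (gen_data \<psi> u0) (gen_data \<psi> u1) U"
    and "piecewise_distributional_solution m \<tau> c u0 u1 u"
  shows "associated ({0<..} \<times> UNIV) U (curve_distr u)"
proof -
  define f where "f s = (if s < 0 then a 0 else c s)" for s
  define cc where "cc \<epsilon> t = conv f (scaled \<phi> \<epsilon>) t" for \<epsilon> t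
  have C: "gen_speed \<phi> (a 0) c = gclass half_space (\<lambda>\<epsilon> (t, x). cc \<epsilon> t)"
    by (simp add: gen_speed_def cc_def f_def[abs_def])
  obtain v where v: "v \<in> U" "v \<in> moderate half_space"
    and v_eq: "negligible0 half_space (\<lambda>\<epsilon> p. iter_deriv half_space [(1,0),(1,0)] (v \<epsilon>) p
         - (case p of (t, x) \<Rightarrow> cc \<epsilon> t)\<^sup>2 * iter_deriv half_space [(0,1),(0,1)] (v \<epsilon>) p)"
    and v_ini: "negligible0 UNIV (\<lambda>\<epsilon> x. v \<epsilon> (0, x) - distr_conv u0 (scaled \<psi> \<epsilon>) x)"
      "negligible0 UNIV (\<lambda>\<epsilon> x. iter_deriv half_space [(1,0)] (v \<epsilon>) (0, x) - distr_conv u1 (scaled \<psi> \<epsilon>) x)"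
    using generalized_solution_rep[OF assms(6)[unfolded C gen_data_def]] by blast
  have sm: "smooth_on half_space (v \<epsilon>)" if "\<epsilon> \<in> {0<..1}" for \<epsilon>
    using v(2) that by (auto simp: moderate_def)

  obtain R\<phi> where \<phi>t: "\<phi> \<in> tests R\<phi>" and \<phi>1: "(LINT x|lborel. \<phi> x) = 1" and \<phi>s: "supp \<phi> \<subseteq> {-1..1}"
    using assms(1) test_function_imp_tests unfolding speed_mollifier_def by blast
  have \<phi>z: "\<phi> x = 0" if "\<bar>x\<bar> > 1" for x
    using \<phi>s that off_supp_zero[of x \<phi>] by force
  obtain P\<phi> where \<phi>b: "\<And>x. \<bar>\<phi> x\<bar> \<le> P\<phi>" using tests_bounded[OF \<phi>t, of 0] by auto
  obtain F where F: "\<And>s. \<bar>f s\<bar> \<le> F" using speed_bounded[OF assms(3)] unfolding f_def by blast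
  have \<tau>: "\<tau> 0 = 0" "\<And>j. j < m \<Longrightarrow> \<tau> j < \<tau> (Suc j)" and cpos: "\<And>t. t \<ge> 0 \<Longrightarrow> c t > 0"
    and ca: "\<And>j t. j \<le> m \<Longrightarrow> t \<in> piece m \<tau> j \<Longrightarrow> c t = a j"
    using assms(3) by (auto simp: piecewise_constant_speed_def)
  have \<tau>_nonneg: "0 \<le> \<tau> j" if "j \<le> m" for j
    using that
  proof (induction j)
    case (Suc j) then show ?case using \<tau>(2)[of j] by simp
  qed (simp add: \<tau>)

  have Ck: "Ck_distr 1 {0..} u" and ini: "distr_eq UNIV (u 0) u0" "distr_eq UNIV (time_deriv {0..} u 0) u1"
    using assms(7) by (auto simp: piecewise_distributional_solution_def)
  define u' where "u' = time_deriv {0..} u"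
  note uf = Ck_distr_1_facts[OF Ck, folded u'_def]

  have conv: "((\<lambda>\<epsilon>. LINT p:upper|lborel. v \<epsilon> p * \<theta> p) \<longlongrightarrow> curve_distr u \<theta>) (at_right 0)"
    if \<theta>: "\<theta> \<in> test_functions upper" for \<theta>
  proof -
    have \<theta>s: "smooth_on UNIV \<theta>" "compact (supp \<theta>)" using \<theta> by (auto simp: test_functions_def)
    obtain T0 R where TR: "0 \<le> T0" "0 \<le> R" "\<And>t x. (t, x) \<in> supp \<theta> \<Longrightarrow> t \<le> T0 \<and> \<bar>x\<bar> \<le> R"
      using compact_box[OF \<theta>s(2)] by blast
    \<comment> \<open>Beyond the support of the test function and strictly beyond the last jump, so
      that the last piece, cut off at \<open>T\<close>, is not degenerate.\<close>
    define T where "T = max T0 (\<tau> m) + 1"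
    have T: "T0 < T" "\<tau> m < T" "0 < T" using TR by (auto simp: T_def)
    have \<theta>0: "\<theta> (t, x) = 0" if "T < t \<or> R < \<bar>x\<bar>" for t x
      using TR(3)[of t x] T that off_supp_zero[of "(t, x)" \<theta>] by force
    \<comment> \<open>Any common bound of the speeds would do. It is the slope of the backward cone
      \<open>\<rho>\<close>, which has radius \<open>R\<close> at time \<open>T\<close>; adding
      \<open>1\<close> to the largest radius gives the strict inequality needed for integration by
      parts.\<close>
    define abar where "abar = (\<Sum>j\<le>m. \<bar>a j\<bar>)"
    define \<rho> where "\<rho> s = R + abar * (T - s)" for s
    define B where "B = \<rho> 0 + 1"
    \<comment> \<open>The jump times with the final time \<open>T\<close> appended in place of
      infinity.\<close>
    define \<sigma> where "\<sigma> j = (if j \<le> m then \<tau> j else T)" for j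
    have abar: "0 \<le> abar" by (simp add: abar_def sum_nonneg)
    have \<rho>0: "R \<le> \<rho> s" "\<rho> s \<le> \<rho> 0" if "s \<in> {0..T}" for s
      using abar that by (auto simp: \<rho>_def mult_left_mono)
    have B: "\<rho> 0 < B" "0 \<le> B" "R \<le> \<rho> 0" "0 \<le> \<rho> 0" "R \<le> B" using \<rho>0[of 0] T TR(2) by (auto simp: B_def)
    have \<sigma>: "\<sigma> 0 = 0" "\<And>j. j \<le> m \<Longrightarrow> \<sigma> j < \<sigma> (Suc j)" "\<sigma> (Suc m) = T"
      using \<tau> T by (auto simp: \<sigma>_def le_less)
    have piece: "s \<in> piece m \<tau> j" if "j \<le> m" "s \<in> {\<sigma> j<..<\<sigma> (Suc j)}" for j s
      using that by (auto simp: \<sigma>_def piece_def)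
    \<comment> \<open>Positivity is assumed for \<open>c\<close>, not for the \<open>a j\<close>; it
      is transferred at the midpoint of each piece.\<close>
    have apos: "0 \<le> a j" if "j \<le> m" for j
    proof -
      have s: "(\<sigma> j + \<sigma> (Suc j)) / 2 \<in> {\<sigma> j<..<\<sigma> (Suc j)}" using \<sigma>(2)[OF that] by simp
      have "0 \<le> \<sigma> j" using \<tau>_nonneg[OF that] that by (simp add: \<sigma>_def)
      then have "0 \<le> (\<sigma> j + \<sigma> (Suc j)) / 2" using s by simp
      then show ?thesis using cpos ca[OF that piece[OF that s]] by fastforce
    qed
    have aabar: "a j \<le> abar" if "j \<le> m" for j
      using member_le_sum[of j "{..m}" "\<lambda>j. \<bar>a j\<bar>"] that by (auto simp: abar_def)
    have "\<exists>M\<ge>0. \<exists>N. \<forall>t\<in>{0..T}. order_bound (\<rho> 0) M N (u t)" by (rule distr_curve_ctrl[OF uf(1) uf(5)])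
    then obtain M1 N1 where MN1: "\<And>s. s\<in>{0..T} \<Longrightarrow> order_bound (\<rho> 0) M1 N1 (u s)" by blast
    have "\<exists>M\<ge>0. \<exists>N. \<forall>t\<in>{0..T}. order_bound (\<rho> 0) M N (u' t)" by (rule distr_curve_ctrl[OF uf(2) uf(4)])
    then obtain M2 N2 where MN2: "\<And>s. s\<in>{0..T} \<Longrightarrow> order_bound (\<rho> 0) M2 N2 (u' s)" by blast
    \<comment> \<open>The representative solves the regularised equation up to this negligible
      residual, which after testing in space becomes the source \<open>n\<close>.\<close>
    define nn where "nn \<epsilon> p = iter_deriv half_space [(1,0),(1,0)] (v \<epsilon>) p
         - (cc \<epsilon> (fst p))\<^sup>2 * iter_deriv half_space [(0,1),(0,1)] (v \<epsilon>) p" for \<epsilon> p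
    define P where "P \<epsilon> = pairing B (v \<epsilon>)" for \<epsilon>
    define P' where "P' \<epsilon> = pairing B (iter_deriv half_space [(1,0)] (v \<epsilon>))" for \<epsilon>
    define n where "n \<epsilon> = pairing B (nn \<epsilon>)" for \<epsilon>
    have cont: "continuous_on half_space (iter_deriv half_space \<alpha> (v \<epsilon>))"
      if "\<epsilon> \<in> {0<..1}" "\<alpha> \<in> multi_indices" for \<epsilon> \<alpha>
      by (rule smooth_on_cont[OF sm[OF that(1)] that(2)])
    have cont0: "continuous_on half_space (v \<epsilon>)" if "\<epsilon> \<in> {0<..1}" for \<epsilon>
      using cont[OF that multi_indices_Nil] by (simp add: iter_deriv_Nil)
    have \<alpha>2: "[(1,0),(1,0)] \<in> (multi_indices :: (real\<times>real) list set)" "[(0,1),(0,1)] \<in> (multi_indices :: (real\<times>real) list set)"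
      by (auto simp: multi_indices_def half_space_basis)

    have approx: "wave_approximation m \<sigma> a T R abar (max M1 M2) (max N1 N2) P P' n cc u u' \<rho>"
    proof
      fix s show "\<rho> s = R + abar * (T - s)" by (rule \<rho>_def)
    next
      show "\<sigma> 0 = 0" "\<sigma> (Suc m) = T" by fact+
      fix j assume j: "j \<le> m"
      show "\<sigma> j < \<sigma> (Suc j)" "0 \<le> a j" "a j \<le> abar" using \<sigma>(2) apos aabar j by blast+
    next
      fix s assume s: "s \<in> {0..T}"
      show "test_linear (u s)" "test_linear (u' s)" using s uf(1,2) distributions_lin by auto
      show "order_bound (\<rho> 0) (max M1 M2) (max N1 N2) (u s)" "order_bound (\<rho> 0) (max M1 M2) (max N1 N2) (u' s)"
        using order_bound_mono[OF MN1[OF s]] order_bound_mono[OF MN2[OF s]] by auto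
    next
      fix \<eta> s assume \<eta>: "\<eta> \<in> tests (\<rho> 0)" and s: "s \<in> {0..T}"
      show "((\<lambda>s. u s \<eta>) has_real_derivative u' s \<eta>) (at s within {0..T})"
        by (rule has_field_derivative_subset[OF uf(3)[OF \<eta>]]) (use s in auto)
    next
      fix \<eta> assume \<eta>: "\<eta> \<in> tests (\<rho> 0)"
      show "continuous_on {0..T} (\<lambda>s. u' s \<eta>)" by (rule continuous_on_subset[OF uf(4)[OF \<eta>]]) auto
    next
      fix \<eta> j s assume \<eta>: "\<eta> \<in> tests (\<rho> 0)" and j: "j \<le> m" and s: "s \<in> {\<sigma> j<..<\<sigma> (Suc j)}"
      have p: "s \<in> piece m \<tau> j" by (rule piece[OF j s])
      show "((\<lambda>s. u' s \<eta>) has_real_derivative (a j)\<^sup>2 * u s (dv 2 \<eta>)) (at s)"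
        using piece_second_derivative[OF assms(7) j p \<tau>_nonneg[OF j] \<eta>] ca[OF j p] by (simp add: u'_def)
    next
      fix \<epsilon> s :: real assume \<epsilon>: "\<epsilon> \<in> {0<..1}" and s: "s \<in> {0..T}"
      show "test_linear (P \<epsilon> s)" "test_linear (P' \<epsilon> s)"
        unfolding P_def P'_def using s by (auto intro!: pairing_lin cont0 cont \<epsilon> half_space_indices)
    next
      fix \<epsilon> :: real assume \<epsilon>: "\<epsilon> \<in> {0<..1}"
      obtain M where M: "\<forall>s\<in>{0..T}. order_bound (\<rho> 0) M 0 (pairing B (v \<epsilon>) s)"
        using pairing_ctrl[OF cont0[OF \<epsilon>] B(2)] by blast
      obtain M' where M': "\<forall>s\<in>{0..T}. order_bound (\<rho> 0) M' 0 (pairing B (iter_deriv half_space [(1,0)] (v \<epsilon>)) s)"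
        using pairing_ctrl[OF cont[OF \<epsilon> half_space_indices(1)] B(2)] by blast
      show "\<exists>M N. \<forall>s\<in>{0..T}. order_bound (\<rho> 0) M N (P \<epsilon> s) \<and> order_bound (\<rho> 0) M N (P' \<epsilon> s)"
        unfolding P_def P'_def
        by (intro exI[of _ "max M M'"] exI[of _ 0] ballI conjI;
            rule order_bound_mono[OF bspec[OF M]] order_bound_mono[OF bspec[OF M']]) auto
    next
      fix \<epsilon> s :: real and \<eta> assume \<epsilon>: "\<epsilon> \<in> {0<..1}" and \<eta>: "\<eta> \<in> tests (\<rho> 0)" and s: "s \<in> {0..T}"
      have "((\<lambda>s. P \<epsilon> s \<eta>) has_real_derivative P' \<epsilon> s \<eta>) (at s within {0..})"
        using pairing_deriv[OF sm[OF \<epsilon>] multi_indices_Nil _ \<eta>] s by (simp add: P_def P'_def iter_deriv_Nil)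
      then show "((\<lambda>s. P \<epsilon> s \<eta>) has_real_derivative P' \<epsilon> s \<eta>) (at s within {0..T})"
        by (rule has_field_derivative_subset) auto
    next
      fix \<epsilon> :: real and \<eta> assume \<epsilon>: "\<epsilon> \<in> {0<..1}" and \<eta>: "\<eta> \<in> tests (\<rho> 0)"
      have "continuous_on {0..} (\<lambda>s. P' \<epsilon> s \<eta>)"
        unfolding continuous_on_eq_continuous_within P'_def
        using DERIV_continuous[OF pairing_deriv[OF sm[OF \<epsilon>] half_space_indices(1) _ \<eta>]] by simp
      then show "continuous_on {0..T} (\<lambda>s. P' \<epsilon> s \<eta>)" by (rule continuous_on_subset) auto
    next
      fix \<epsilon> s :: real and \<eta> assume \<epsilon>: "\<epsilon> \<in> {0<..1}" and \<eta>: "\<eta> \<in> tests (\<rho> 0)" and s: "s \<in> {0<..<T}"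
      show "((\<lambda>s. P' \<epsilon> s \<eta>) has_real_derivative (cc \<epsilon> s)\<^sup>2 * P \<epsilon> s (dv 2 \<eta>) + n \<epsilon> s \<eta>) (at s)"
        using pairing_second_time_derivative[OF sm[OF \<epsilon>] _ \<eta> B(1,2), of s "cc \<epsilon> s"] s
        by (simp add: P_def P'_def n_def nn_def pairing_def)
    next
      have "\<bar>cc \<epsilon> s\<bar> \<le> 2 * F * P\<phi>" if "\<epsilon> \<in> {0<..1}" for \<epsilon> s
        unfolding cc_def by (rule conv_bounded[OF \<phi>b \<phi>z F]) (use that in auto)
      then show "\<exists>B. \<forall>\<epsilon>\<in>{0<..1}. \<forall>s\<in>{0..T}. \<bar>cc \<epsilon> s\<bar> \<le> B" by blast
    next
      fix \<epsilon> j s assume \<epsilon>: "\<epsilon> \<in> {0<..1::real}" and j: "j \<le> m" and s: "s \<in> {\<sigma> j<..<\<sigma> (Suc j)}" "\<sigma> j + \<epsilon> < s" "s < \<sigma> (Suc j) - \<epsilon>"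
      show "cc \<epsilon> s = a j"
        unfolding cc_def
      proof (rule conv_locally_constant[OF \<phi>1 \<phi>z])
        show "0 < \<epsilon>" using \<epsilon> by simp
        \<comment> \<open>The window of the mollifier stays inside one open piece: it meets no jump
          and, on the first piece, no negative time.\<close>
        fix r assume "\<bar>s - r\<bar> \<le> \<epsilon>"
        then have r: "r \<in> {\<sigma> j<..<\<sigma> (Suc j)}" using s by auto
        have "0 \<le> \<sigma> j" using \<tau>_nonneg[OF j] j by (simp add: \<sigma>_def)
        then show "f r = a j" using r ca[OF j piece[OF j r]] by (simp add: f_def)
      qed
    next
      have "negligible0 half_space nn" using v_eq by (simp add: nn_def[abs_def] split_beta)
      moreover have "continuous_on {-B..B} (\<lambda>x. nn \<epsilon> (s, x))" if "\<epsilon> \<in> {0<..1}" "s \<in> {0..T}" for \<epsilon> s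
        unfolding nn_def fst_conv using that by (auto intro!: continuous_intros slice_cont cont \<alpha>2)
      ultimately show "\<exists>C. \<forall>\<^sub>F \<epsilon> in at_right 0. \<forall>s\<in>{0..T}. \<forall>\<eta>\<in>test_ball (\<rho> s) A. \<bar>n \<epsilon> s \<eta>\<bar> \<le> C * \<epsilon>" for A
        unfolding n_def by (rule pairing_negligible[OF _ B(2)])
    next
      have "moderate0 half_space v" using moderate_mod0[OF v(2) multi_indices_Nil] by (simp add: iter_deriv_Nil)
      then show "\<exists>p. \<forall>A. \<exists>C. \<forall>\<^sub>F \<epsilon> in at_right 0. \<forall>s\<in>{0..T}. \<forall>\<eta>\<in>test_ball (\<rho> s) A. \<bar>P \<epsilon> s \<eta>\<bar> \<le> C * (1 / \<epsilon>) ^ p"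
        unfolding P_def by (rule pairing_moderate[OF _ B(2)]) (auto intro!: slice_cont cont0)
    next
      fix A
      show "\<exists>C. \<forall>\<^sub>F \<epsilon> in at_right 0. \<forall>\<eta>\<in>test_ball (\<rho> 0) A. \<bar>P \<epsilon> 0 \<eta> - u 0 \<eta>\<bar> \<le> C * \<epsilon>"
        unfolding P_def by (rule initial_data_error[OF assms(4) ini(1) cont0 v_ini(1) assms(2) B(1,4)])
      show "\<exists>C. \<forall>\<^sub>F \<epsilon> in at_right 0. \<forall>\<eta>\<in>test_ball (\<rho> 0) A. \<bar>P' \<epsilon> 0 \<eta> - u' 0 \<eta>\<bar> \<le> C * \<epsilon>"
        unfolding P'_def u'_def by (rule initial_data_error[OF assms(5) ini(2) cont[OF _ half_space_indices(1)] v_ini(2) assms(2) B(1,4)])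
    qed

    have "\<exists>A. \<forall>p. \<bar>iter_deriv UNIV (x_derivs k) \<theta> p\<bar> \<le> A" for k
      by (meson iter_deriv_bounded[OF \<theta> x_derivs_index(1)])
    \<comment> \<open>The bounds hold on the whole plane, so all time slices of
      \<open>\<theta>\<close> lie in bounded sets described by the same sequence
      \<open>A\<close>.\<close>
    then obtain A where A: "\<And>k p. \<bar>iter_deriv UNIV (x_derivs k) \<theta> p\<bar> \<le> A k" by metis
    have slice: "(\<lambda>x. \<theta> (t, x)) \<in> test_ball (\<rho> t) A" if "t \<in> {0..T}" for t
      using slice_test[OF \<theta>s(1), of R t, OF \<theta>0[OF disjI2]] A tests_mono[OF _ \<rho>0(1)[OF that]] by (auto simp: test_ball_def)
    obtain K where K: "\<forall>\<^sub>F \<epsilon> in at_right 0. \<forall>s\<in>{0..T}. \<forall>\<eta>\<in>test_ball (\<rho> s) A. \<bar>P \<epsilon> s \<eta> - u s \<eta>\<bar> \<le> K * \<epsilon>"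
      using wave_approximation.convergence[OF approx] by blast
    \<comment> \<open>The bound \<open>K * \<epsilon>\<close> on the slices is integrated over
      \<open>[0, T]\<close>.\<close>
    have "\<forall>\<^sub>F \<epsilon> in at_right 0. norm ((LINT p:upper|lborel. v \<epsilon> p * \<theta> p) - curve_distr u \<theta>) \<le> K * \<epsilon> * T"
      using K eventually_unit
    proof eventually_elim
      case (elim \<epsilon>)
      have zB: "T < t \<or> B < \<bar>x\<bar> \<Longrightarrow> \<theta> (t, x) = 0" for t x using \<theta>0 B(5) by (meson le_less_trans)
      have I: "(LINT p:upper|lborel. v \<epsilon> p * \<theta> p) = integral {0..T} (\<lambda>t. pairing B (v \<epsilon>) t (\<lambda>x. \<theta> (t, x)))"
        "(\<lambda>t. pairing B (v \<epsilon>) t (\<lambda>x. \<theta> (t, x))) integrable_on {0..T}"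
        by (rule set_integral_slices[OF cont0[OF elim(2)] \<theta> zB]; assumption)+
      have J: "continuous_on {0..T} (\<lambda>t. u t (\<lambda>x. \<theta> (t, x)))" "curve_distr u \<theta> = integral {0..T} (\<lambda>t. u t (\<lambda>x. \<theta> (t, x)))"
        by (rule curve_distr_eq(1,3)[OF uf(1) uf(5) \<theta> \<theta>0]; assumption)+
      have Ji: "(\<lambda>t. u t (\<lambda>x. \<theta> (t, x))) integrable_on {0..T}" by (rule integrable_continuous_real[OF J(1)])
      have "norm (integral (cbox 0 T) (\<lambda>t. pairing B (v \<epsilon>) t (\<lambda>x. \<theta> (t, x)) - u t (\<lambda>x. \<theta> (t, x))))
          \<le> (K * \<epsilon>) * measure lborel (cbox 0 T)"
      proof (rule integrable_bound)
        have b: "norm (pairing B (v \<epsilon>) t (\<lambda>x. \<theta> (t, x)) - u t (\<lambda>x. \<theta> (t, x))) \<le> K * \<epsilon>" if "t \<in> {0..T}" for t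
          using elim(1) that slice[OF that] by (simp add: P_def)
        then show "\<And>t. t \<in> cbox 0 T \<Longrightarrow> norm (pairing B (v \<epsilon>) t (\<lambda>x. \<theta> (t, x)) - u t (\<lambda>x. \<theta> (t, x))) \<le> K * \<epsilon>" by simp
        show "0 \<le> K * \<epsilon>" using b[of 0] T(3) by (meson atLeastAtMost_iff less_imp_le norm_ge_zero order.refl order_trans)
        show "(\<lambda>t. pairing B (v \<epsilon>) t (\<lambda>x. \<theta> (t, x)) - u t (\<lambda>x. \<theta> (t, x))) integrable_on cbox 0 T"
          using integrable_diff[OF I(2) Ji] by simp
      qed
      then show ?case unfolding I(1) J(2) using integral_diff[OF I(2) Ji] T(3) by simp
    qed
    moreover have "((\<lambda>\<epsilon>. K * \<epsilon> * T) \<longlongrightarrow> 0) (at_right 0)" by (auto intro!: tendsto_eq_intros)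
    ultimately have "((\<lambda>\<epsilon>. (LINT p:upper|lborel. v \<epsilon> p * \<theta> p) - curve_distr u \<theta>) \<longlongrightarrow> 0) (at_right 0)"
      by (rule Lim_null_comparison)
    then show ?thesis using Lim_null by blast
  qed
  have "curve_distr u \<in> distributions upper"
    by (rule curve_distr_in_distributions[OF uf(1) uf(5)])
  then show ?thesis unfolding associated_def using v(1) conv by blast
qed

end
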